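(* Let $m\ge 2$ and $1\le n\le m$ be integers. Let $\rho$ be a density operator on $\mathcal{H}_A\otimes\mathcal{H}_{B_1}\otimes\cdots\otimes\mathcal{H}_{B_n}$ (finite-dimensional, $\dim\mathcal{H}_A=d$). Let $M_1,\dots,M_m$ be observables on $\mathcal{H}_A$ with orthonormal eigenbases $\{|\psi^i_k\rangle\}_{k=1}^d$. Let $\mathbf{S}_1,\dots,\mathbf{S}_n$ be nonempty, pairwise disjoint subsets of $\{M_1,\dots,M_m\}$ whose union is $\{M_1,\dots,M_m\}$, and $m_t=|\mathbf{S}_t|$. Then $$\sum_{t=1}^n\sum_{M_i\in\mathbf{S}_t}S(M_i|B_t)\geqslant-\frac{1}{m-1}\log_2\Big(\prod_{1\le i<j\le m}c_{ij}\Big)+\frac{1}{m-1}\sum_{t=1}^n\frac{m_t(m_t-1)}{2}S(A|B_t)+\max\{0,\delta'_{mn}\},$$ where $$\delta'_{mn}=\frac{1}{m-1}\log_2\frac{\prod_{1\le i<j\le m}c_{ij}}{b^{m-1}}+(m-1)S(A)-\sum_{t=1}^n\frac{m_t(m_t-1)}{2(m-1)}S(A)+\sum_{t=1}^n\frac{m_t(m_t-1)}{2(m-1)}\mathcal{I}(A:B_t)-\sum_{t=1}^n\sum_{M_i\in\mathbf{S}_t}\mathcal{I}(M_i:B_t)$$ and $$b=\max_{k_m}\Big\{\sum_{k_2}\cdots\sum_{k_{m-1}}\max_{k_1}|\langle\psi^1_{k_1}|\psi^2_{k_2}\rangle|^2\prod_{i=2}^{m-1}|\langle\psi^i_{k_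i}|\psi^{i+1}_{k_{i+1}}\rangle|^2\Big\}.$$
   Context: All logarithms are base 2. $S(\sigma)=-\mathrm{Tr}\,\sigma\log_2\sigma$; $\rho^X$ is the reduced state of $\rho$ on subsystem(s) $X$, and $S(A)=S(\rho^A)$. $c_{ij}=\max_{k,l}|\langle\psi^i_k|\psi^j_l\rangle|^2$. $S(A|B_t)=S(\rho^{AB_t})-S(\rho^{B_t})$. $\mathcal{I}(A:B_t)=S(\rho^A)+S(\rho^{B_t})-S(\rho^{AB_t})$. Post-measurement state: $\rho^{M_iB_t}=\sum_k(|\psi^i_k\rangle\langle\psi^i_k|\otimes\mathbb{I})\rho^{AB_t}(|\psi^i_k\rangle\langle\psi^i_k|\otimes\mathbb{I})$, with reduced state $\rho^{M_i}$ on $A$. $S(M_i|B_t)=S(\rho^{M_iB_t})-S(\rho^{B_t})$, and $\mathcal{I}(M_i:B_t)=S(\rho^{M_i})+S(\rho^{B_t})-S(\rho^{M_iB_t})$. Each index $k_i$ ranges over $\{1,\dots,d\}$. *)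

theory Defs
  imports "Jordan_Normal_Form.Char_Poly" "HOL-Library.FuncSet"
begin

text \<open>Subsystems are labelled 0 (= A) and t (= B_t, 1 \<le> t \<le> n); subsystem k has
  dimension D k. A basis configuration of the subsystems in X is a function
  x :: nat => nat with x k < D k for k in X and x k = 0 otherwise.
  Operators on the subsystems X are functions (config => config => complex),
  evaluated only on configurations in cfg D X.\<close>

definition cfg :: "(nat \<Rightarrow> nat) \<Rightarrow> nat set \<Rightarrow> (nat \<Rightarrow> nat) set" where
  "cfg D X = {x. \<forall>k. (k \<in> X \<longrightarrow> x k < D k) \<and> (k \<notin> X \<longrightarrow> x k = 0)}"

type_synonym op = "(nat \<Rightarrow> nat) \<Rightarrow> (nat \<Rightarrow> nat) \<Rightarrow> complex"

definition merge :: "nat set \<Rightarrow> (nat \<Rightarrow> nat) \<Rightarrow> (nat \<Rightarrow> nat) \<Rightarrow> (nat \<Rightarrow> nat)" where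
  "merge X x z = (\<lambda>k. if k \<in> X then x k else z k)"

definition ptr :: "(nat \<Rightarrow> nat) \<Rightarrow> nat set \<Rightarrow> nat set \<Rightarrow> op \<Rightarrow> op" where
  "ptr D U X \<sigma> = (\<lambda>x y. \<Sum>z\<in>cfg D (U - X). \<sigma> (merge X x z) (merge X y z))"

definition is_density :: "(nat \<Rightarrow> nat) \<Rightarrow> nat set \<Rightarrow> op \<Rightarrow> bool" where
  "is_density D X \<rho> \<longleftrightarrow>
     (\<forall>x\<in>cfg D X. \<forall>y\<in>cfg D X. \<rho> x y = cnj (\<rho> y x)) \<and>
     (\<forall>v :: (nat \<Rightarrow> nat) \<Rightarrow> complex.
        0 \<le> Re (\<Sum>x\<in>cfg D X. \<Sum>y\<in>cfg D X. cnj (v x) * \<rho> x y * v y)) \<and>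
     (\<Sum>x\<in>cfg D X. \<rho> x x) = 1"

text \<open>Matrix of an operator w.r.t. some enumeration of the finite basis C
  (the spectrum does not depend on the enumeration).\<close>
definition enum_of :: "'a set \<Rightarrow> nat \<Rightarrow> 'a" where
  "enum_of C = (SOME e. bij_betw e {0..<card C} C)"

definition op_mat :: "(nat \<Rightarrow> nat) set \<Rightarrow> op \<Rightarrow> complex mat" where
  "op_mat C \<sigma> = mat (card C) (card C) (\<lambda>(i, j). \<sigma> (enum_of C i) (enum_of C j))"

definition eta :: "real \<Rightarrow> real" where
  "eta x = (if x \<le> 0 then 0 else - x * log 2 x)"

text \<open>von Neumann entropy -Tr \<sigma> log_2 \<sigma> = - \<Sum> \<lambda> log_2 \<lambda> over the eigenvalues
  (with algebraic multiplicity) of the Hermitian matrix, with 0 log 0 = 0.\<close>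
definition vN_entropy :: "complex mat \<Rightarrow> real" where
  "vN_entropy M = (\<Sum>a\<in>{a. poly (char_poly M) a = 0}.
                     real (order a (char_poly M)) * eta (Re a))"

definition ent :: "(nat \<Rightarrow> nat) \<Rightarrow> nat set \<Rightarrow> op \<Rightarrow> real" where
  "ent D X \<sigma> = vN_entropy (op_mat (cfg D X) \<sigma>)"

definition ip :: "nat \<Rightarrow> (nat \<Rightarrow> complex) \<Rightarrow> (nat \<Rightarrow> complex) \<Rightarrow> complex" where
  "ip d u v = (\<Sum>a<d. cnj (u a) * v a)"

text \<open>Post-measurement state: \<Sum>_k (|\<psi>_k><\<psi>_k| \<otimes> I) \<sigma> (|\<psi>_k><\<psi>_k| \<otimes> I),
  the measured system being A (label 0), basis vectors \<psi> k for k = 1..d.\<close>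
definition meas :: "nat \<Rightarrow> (nat \<Rightarrow> nat \<Rightarrow> complex) \<Rightarrow> op \<Rightarrow> op" where
  "meas d \<psi> \<sigma> = (\<lambda>x y. \<Sum>k\<in>{1..d}. \<psi> k (x 0) * cnj (\<psi> k (y 0)) *
       (\<Sum>a<d. \<Sum>b<d. cnj (\<psi> k a) * \<sigma> (x(0 := a)) (y(0 := b)) * \<psi> k b))"

end

theory Submission
  imports Defs
begin

text \<open>The second entry of the maximum is the bound without memory
  \<open>\<Sum>\<^sub>i S(M\<^sub>i) \<ge> - log b + (m - 1) S(A)\<close> rewritten through mutual informations; the first one sums, over
  all pairs of measurements, \<open>S(M|B) + S(N|B) \<ge> - log c + S(A|B)\<close> (same memory) or
  \<open>S(M|B) + S(N|C) \<ge> - log c\<close> (different memories).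

  All three reduce to one elementary mechanism. In terms of eigenvalues \<open>p\<^sub>i\<close>, \<open>q\<^sub>j\<close> and squared overlaps
  \<open>w\<^sub>i\<^sub>j\<close> of the eigenbases, \<open>- D(\<rho>\<parallel>\<sigma>) = \<Sum> w\<^sub>i\<^sub>j p\<^sub>i ln (q\<^sub>j / p\<^sub>i)\<close>, and such sums can be compared as soon as
  the sums \<open>H\<^sub>s = \<Sum> w\<^sub>i\<^sub>j p\<^sub>i q\<^sub>j / (s p\<^sub>i + q\<^sub>j)\<close> can be compared for all \<open>s > 0\<close> (differentiate
  \<open>\<Sum> w\<^sub>i\<^sub>j p\<^sub>i ln (q\<^sub>j / p\<^sub>i + s)\<close> in \<open>s\<close>). Now \<open>H\<^sub>s\<close> is the minimum over all operators \<open>X\<close> of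
  \<open>Tr (1 - X)\<^sup>* \<rho> (1 - X) + Tr X \<sigma> X\<^sup>* / s\<close>. Restricting to block-diagonal \<open>X\<close> gives the relations with one
  memory or none; for two memories, the quadratic forms of \<open>X\<close> on \<open>B\<close> and \<open>Y\<close> on \<open>C\<close> add up to at
  least 1 because \<open>X\<close> and \<open>Y\<close> commute.\<close>

subsection \<open>Sums of logarithms\<close>

text \<open>The quantity minimised over \<open>X\<close> is the finite-dimensional form of Kosaki's
  variational formula for relative entropy. Because a restricted test operator is still a competitor
  in a minimum, neither operator convexity nor matrix logarithms are needed; only scalar logarithms
  of eigenvalues occur. In exchange, eigenvalues 0 must be kept away from \<open>ln\<close>, whence
  the support hypotheses \<open>nest\<close>.

  With one memory, the second argument of the relative entropy is the state measured by the other
  observable; its blocks are at most \<open>c\<close> times the memory state. With two memories no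
  single relative entropy serves. Instead two variational problems are taken at reciprocal
  parameters \<open>s\<close> and \<open>1 / s\<close>, matching the identity
  \<open>x / (s + x) + (1 / x) / (1 / s + 1 / x) = 1\<close>.

  The factor 1/(m-1) appears because every measurement lies in m-1 pairs, and m_t(m_t-1)/2 of all
  pairs share the memory B_t. The constant \<open>b\<close> comes from a chain of relative
  entropies, one for each pair of consecutive bases; every link contributes one copy of
  S(A).\<close>

lemma sum_ln_mono:
  fixes a x :: "'i \<Rightarrow> real" and a' x' :: "'j \<Rightarrow> real"
  assumes x: "\<And>i. i \<in> I \<Longrightarrow> x i > 0" and x': "\<And>j. j \<in> J \<Longrightarrow> x' j > 0"
    and eq: "sum a I = sum a' J"
    and le: "\<And>s. s > 0 \<Longrightarrow> (\<Sum>i\<in>I. a i * x i / (s + x i)) \<le> (\<Sum>j\<in>J. a' j * x' j / (s + x' j))"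
  shows "(\<Sum>i\<in>I. a i * ln (x i)) \<le> (\<Sum>j\<in>J. a' j * ln (x' j))"
proof -
  \<comment> \<open>The \<open>ln (1 + s)\<close> terms cancel in total by \<open>eq\<close>, but
    they make each summand tend to 0 at infinity. As \<open>G\<close> increases towards its limit 0,
    \<open>G 0 \<le> 0\<close>, which is the claim.\<close>
  define G where "G s = (\<Sum>i\<in>I. a i * (ln (x i + s) - ln (1 + s)))
    - (\<Sum>j\<in>J. a' j * (ln (x' j + s) - ln (1 + s)))" for s
  define G' where "G' s = (\<Sum>i\<in>I. a i * (1 / (x i + s) - 1 / (1 + s)))
    - (\<Sum>j\<in>J. a' j * (1 / (x' j + s) - 1 / (1 + s)))" for s
  have der: "(G has_real_derivative G' s) (at s)" if "s \<ge> 0" for s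
    unfolding G_def G'_def
    by (rule derivative_eq_intros refl | use x x' that in \<open>force simp: add_pos_nonneg\<close>)+
       (simp add: mult.commute)
  \<comment> \<open>Because \<open>a / (x + s) = (a - a * x / (s + x)) / s\<close>, hypothesis
    \<open>le\<close> compares the derivatives with the inequality reversed.\<close>
  have split: "(\<Sum>i\<in>I. a i * (1 / (x i + s) - 1 / (1 + s))) =
      (sum a I - (\<Sum>i\<in>I. a i * x i / (s + x i))) / s - sum a I / (1 + s)"
    if "s > 0" "\<And>i. i \<in> I \<Longrightarrow> x i > 0" for s :: real and I :: "'k set" and a x :: "'k \<Rightarrow> real"
  proof -
    have "a i * (1 / (x i + s) - 1 / (1 + s)) = (a i - a i * x i / (s + x i)) / s - a i / (1 + s)"
      if "i \<in> I" for i
    proof -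
      have "x i + s > 0" using \<open>s > 0\<close> \<open>\<And>i. i \<in> I \<Longrightarrow> x i > 0\<close>[OF that] by simp
      then have "a i - a i * x i / (s + x i) = s * (a i / (x i + s))"
        by (simp add: divide_simps) (simp add: algebra_simps)
      then have "(a i - a i * x i / (s + x i)) / s = a i / (x i + s)"
        using \<open>s > 0\<close> by simp
      then show ?thesis by (simp add: algebra_simps)
    qed
    then show ?thesis
      by (simp add: sum_subtractf flip: sum_divide_distrib)
  qed
  have nonneg: "G' s \<ge> 0" if "s > 0" for s
    unfolding G'_def using split[OF that, of I x a] split[OF that, of J x' a'] x x' le[OF that] eq that
    by (simp add: divide_right_mono)
  have G0: "G 0 \<le> G s" if "s > 0" for s
  proof (rule DERIV_nonneg_imp_increasing_open[of 0 s G])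
    show "continuous_on {0..s} G"
      using der by (force intro!: continuous_at_imp_continuous_on DERIV_isCont)
  qed (use that in simp, meson der nonneg less_imp_le)
  have "((\<lambda>s. ln (y + s) - ln (1 + s)) \<longlongrightarrow> (0::real)) at_top" if "y > 0" for y :: real
  proof -
    have "((\<lambda>s. 1 + (y - 1) / (1 + s)) \<longlongrightarrow> 1 + 0) at_top"
      by (intro tendsto_add tendsto_const tendsto_divide_0 filterlim_at_top_imp_at_infinity
          filterlim_tendsto_add_at_top filterlim_ident) auto
    then have "((\<lambda>s. ln (1 + (y - 1) / (1 + s))) \<longlongrightarrow> ln 1) at_top"
      by (intro tendsto_ln) auto
    moreover have "\<forall>\<^sub>F s in at_top. ln (1 + (y - 1) / (1 + s)) = ln (y + s) - ln (1 + s)"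
      using eventually_gt_at_top[of 0]
    proof eventually_elim
      case (elim s)
      then have "1 + (y - 1) / (1 + s) = (y + s) / (1 + s)" by (simp add: field_simps)
      then show ?case using elim that by (simp add: ln_div)
    qed
    ultimately show ?thesis by (simp add: filterlim_cong[OF refl refl])
  qed
  then have "(G \<longlongrightarrow> (\<Sum>i\<in>I. a i * 0) - (\<Sum>j\<in>J. a' j * 0)) at_top"
    unfolding G_def by (intro tendsto_intros) (use x x' in auto)
  moreover have "\<forall>\<^sub>F s in at_top. G 0 \<le> G s"
    using eventually_gt_at_top[of 0] by eventually_elim (rule G0)
  ultimately have "G 0 \<le> 0"
    using tendsto_lowerbound[of G 0 at_top "G 0"] by simp
  then show ?thesis by (simp add: G_def)
qed

subsection \<open>Vectors on finite sets\<close>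

definition hip :: "'v set \<Rightarrow> ('v \<Rightarrow> complex) \<Rightarrow> ('v \<Rightarrow> complex) \<Rightarrow> complex" where
  "hip V f g = (\<Sum>x\<in>V. cnj (f x) * g x)"

definition nsq :: "'v set \<Rightarrow> ('v \<Rightarrow> complex) \<Rightarrow> real" where
  "nsq V f = (\<Sum>x\<in>V. (cmod (f x))\<^sup>2)"

definition orthonormal :: "'v set \<Rightarrow> 'i set \<Rightarrow> ('i \<Rightarrow> 'v \<Rightarrow> complex) \<Rightarrow> bool" where
  "orthonormal V I e \<longleftrightarrow> (\<forall>i\<in>I. \<forall>j\<in>I. hip V (e i) (e j) = (if i = j then 1 else 0))"

definition orthobasis :: "'v set \<Rightarrow> 'i set \<Rightarrow> ('i \<Rightarrow> 'v \<Rightarrow> complex) \<Rightarrow> bool" where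
  "orthobasis V I e \<longleftrightarrow> finite V \<and> finite I \<and> orthonormal V I e \<and>
     (\<forall>x\<in>V. \<forall>y\<in>V. (\<Sum>i\<in>I. e i x * cnj (e i y)) = (if x = y then 1 else 0))"

definition app :: "'v set \<Rightarrow> ('v \<Rightarrow> 'v \<Rightarrow> complex) \<Rightarrow> ('v \<Rightarrow> complex) \<Rightarrow> 'v \<Rightarrow> complex" where
  "app V X f = (\<lambda>x. \<Sum>y\<in>V. X x y * f y)"

definition adj :: "('v \<Rightarrow> 'v \<Rightarrow> complex) \<Rightarrow> 'v \<Rightarrow> 'v \<Rightarrow> complex" where
  "adj X = (\<lambda>x y. cnj (X y x))"

lemma hip_cnj: "cnj (hip V f g) = hip V g f"
  by (simp add: hip_def mult.commute)

lemma hip_cmod_commute: "cmod (hip V f g) = cmod (hip V g f)"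
  by (metis hip_cnj complex_mod_cnj)

lemma hip_diff_left: "hip V (\<lambda>x. f x - g x) h = hip V f h - hip V g h"
  by (simp add: hip_def algebra_simps sum_subtractf)

lemma hip_diff_right: "hip V h (\<lambda>x. f x - g x) = hip V h f - hip V h g"
  by (simp add: hip_def algebra_simps sum_subtractf)

lemma hip_sum_right: "hip V h (\<lambda>x. \<Sum>i\<in>I. c i * f i x) = (\<Sum>i\<in>I. c i * hip V h (f i))"
  unfolding hip_def sum_distrib_left by (subst sum.swap) (simp add: mult_ac)

lemma hip_sum_left: "hip V (\<lambda>x. \<Sum>i\<in>I. c i * f i x) h = (\<Sum>i\<in>I. cnj (c i) * hip V (f i) h)"
  unfolding hip_def cnj_sum sum_distrib_left sum_distrib_right by (subst sum.swap) (simp add: mult_ac)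

lemma hip_cong: "(\<And>x. x \<in> V \<Longrightarrow> f x = f' x) \<Longrightarrow> (\<And>x. x \<in> V \<Longrightarrow> g x = g' x) \<Longrightarrow> hip V f g = hip V f' g'"
  by (simp add: hip_def)

lemma cmod_sq: "complex_of_real ((cmod z)\<^sup>2) = cnj z * z"
  by (metis complex_norm_square mult.commute)

lemma hip_self: "hip V f f = of_real (nsq V f)"
  unfolding hip_def nsq_def of_real_sum cmod_sq ..

lemma nsq_nonneg [simp]: "nsq V f \<ge> 0"
  by (simp add: nsq_def sum_nonneg)

lemma nsq_cong: "(\<And>x. x \<in> V \<Longrightarrow> f x = f' x) \<Longrightarrow> nsq V f = nsq V f'"
  by (simp add: nsq_def)

lemma app_scale: "app V X (\<lambda>x. c * f x) = (\<lambda>x. c * app V X f x)"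
  by (simp add: app_def sum_distrib_left mult_ac)

lemma nsq_scale: "nsq V (\<lambda>x. c * f x) = (cmod c)\<^sup>2 * nsq V f"
  by (simp add: nsq_def norm_mult power_mult_distrib sum_distrib_left)

lemma hip_scale_right: "hip V y (\<lambda>x. c * f x) = c * hip V y f"
  by (simp add: hip_def sum_distrib_left mult_ac)

lemma hip_adj: "hip V (app V (adj X) f) g = hip V f (app V X g)"
  unfolding hip_def app_def adj_def cnj_sum sum_distrib_left sum_distrib_right
  by (subst sum.swap) (simp add: mult_ac)

lemma orthonormalD:
  "orthonormal V I e \<Longrightarrow> i \<in> I \<Longrightarrow> j \<in> I \<Longrightarrow> hip V (e i) (e j) = (if i = j then 1 else 0)"
  by (simp add: orthonormal_def)

lemma nsq_orthonormal_combination: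
  assumes "finite I" "orthonormal V I e"
  shows "nsq V (\<lambda>x. \<Sum>i\<in>I. c i * e i x) = (\<Sum>i\<in>I. (cmod (c i))\<^sup>2)"
proof -
  have "hip V (\<lambda>x. \<Sum>i\<in>I. c i * e i x) (\<lambda>x. \<Sum>i\<in>I. c i * e i x) = (\<Sum>i\<in>I. cnj (c i) * c i)"
    unfolding hip_sum_left hip_sum_right
  proof (intro sum.cong refl)
    fix i assume i: "i \<in> I"
    have "(\<Sum>j\<in>I. c j * hip V (e i) (e j)) = (\<Sum>j\<in>I. if i = j then c j else 0)"
      using i by (intro sum.cong refl) (simp add: orthonormalD[OF assms(2)])
    then show "cnj (c i) * (\<Sum>j\<in>I. c j * hip V (e i) (e j)) = cnj (c i) * c i"
      using i assms(1) by simp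
  qed
  then have "complex_of_real (nsq V (\<lambda>x. \<Sum>i\<in>I. c i * e i x)) = of_real (\<Sum>i\<in>I. (cmod (c i))\<^sup>2)"
    by (simp add: hip_self cmod_sq del: of_real_power)
  then show ?thesis unfolding of_real_eq_iff .
qed

text \<open>Bessel's inequality, Parseval's identity and the completeness of large orthonormal
  families are all read off from this defect.\<close>

lemma projection_defect:
  assumes "finite I" "orthonormal V I e"
  shows "nsq V (\<lambda>x. f x - (\<Sum>i\<in>I. hip V (e i) f * e i x)) = nsq V f - (\<Sum>i\<in>I. (cmod (hip V (e i) f))\<^sup>2)"
proof -
  let ?g = "\<lambda>x. \<Sum>i\<in>I. hip V (e i) f * e i x"
  have "hip V (\<lambda>x. f x - ?g x) (\<lambda>x. f x - ?g x) = hip V f f - hip V f ?g - hip V ?g f + hip V ?g ?g"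
    by (simp add: hip_diff_left hip_diff_right)
  also have "hip V f ?g = (\<Sum>i\<in>I. of_real ((cmod (hip V (e i) f))\<^sup>2))"
    unfolding hip_sum_right cmod_sq hip_cnj by (simp add: mult.commute)
  also have "hip V ?g f = (\<Sum>i\<in>I. of_real ((cmod (hip V (e i) f))\<^sup>2))"
    unfolding hip_sum_left cmod_sq hip_cnj ..
  also have "hip V ?g ?g = (\<Sum>i\<in>I. of_real ((cmod (hip V (e i) f))\<^sup>2))"
    unfolding hip_self nsq_orthonormal_combination[OF assms] by simp
  finally have "complex_of_real (nsq V (\<lambda>x. f x - ?g x)) =
      of_real (nsq V f - (\<Sum>i\<in>I. (cmod (hip V (e i) f))\<^sup>2))"
    by (simp add: hip_self)
  then show ?thesis unfolding of_real_eq_iff .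
qed

lemma bessel:
  assumes "finite I" "orthonormal V I e"
  shows "(\<Sum>i\<in>I. (cmod (hip V (e i) f))\<^sup>2) \<le> nsq V f"
  using projection_defect[OF assms, of f] nsq_nonneg[of V "\<lambda>x. f x - (\<Sum>i\<in>I. hip V (e i) f * e i x)"]
  by linarith

lemma orthobasis_expand:
  assumes "orthobasis V I e" "x \<in> V"
  shows "f x = (\<Sum>i\<in>I. hip V (e i) f * e i x)"
proof -
  have "(\<Sum>i\<in>I. hip V (e i) f * e i x) = (\<Sum>y\<in>V. f y * (\<Sum>i\<in>I. e i x * cnj (e i y)))"
    unfolding hip_def sum_distrib_left sum_distrib_right by (subst sum.swap) (simp add: mult_ac)
  also have "\<dots> = (\<Sum>y\<in>V. f y * (if x = y then 1 else 0))"
    using assms by (intro sum.cong) (auto simp: orthobasis_def)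
  also have "\<dots> = f x"
    using assms by (simp add: orthobasis_def if_distrib cong: if_cong)
  finally show ?thesis ..
qed

lemma parseval:
  assumes "orthobasis V I e"
  shows "(\<Sum>i\<in>I. (cmod (hip V (e i) f))\<^sup>2) = nsq V f"
proof -
  have "nsq V (\<lambda>x. f x - (\<Sum>i\<in>I. hip V (e i) f * e i x)) = 0"
    using orthobasis_expand[OF assms, of _ f] by (simp add: nsq_def)
  then show ?thesis
    using assms projection_defect[of I V e f] by (auto simp: orthobasis_def)
qed

lemma hip_parseval:
  assumes "orthobasis V I e"
  shows "hip V f g = (\<Sum>i\<in>I. hip V f (e i) * hip V (e i) g)"
proof -
  have "hip V f g = hip V f (\<lambda>x. \<Sum>i\<in>I. hip V (e i) g * e i x)"
    by (intro hip_cong) (auto intro: orthobasis_expand[OF assms])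
  also have "\<dots> = (\<Sum>i\<in>I. hip V (e i) g * hip V f (e i))"
    by (rule hip_sum_right)
  finally show ?thesis by (simp add: mult.commute)
qed

lemma nsq_delta:
  assumes "finite V" "x \<in> V"
  shows "nsq V (\<lambda>y. if y = x then 1 else 0) = 1" and "hip V f (\<lambda>y. if y = x then 1 else 0) = cnj (f x)"
proof -
  have "(cmod (if y = x then 1 else 0))\<^sup>2 = (if y = x then 1 else 0)" for y by simp
  then show "nsq V (\<lambda>y. if y = x then 1 else 0) = 1"
    unfolding nsq_def using assms by simp
  have "cnj (f y) * (if y = x then 1 else 0) = (if y = x then cnj (f x) else 0)" for y by simp
  then show "hip V f (\<lambda>y. if y = x then 1 else 0) = cnj (f x)"
    unfolding hip_def using assms by simp
qed

text \<open>Bessel's inequality for the coordinate vectors, summed over all of them, is an equality by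
  counting; hence each of them is one.\<close>
lemma orthonormal_imp_orthobasis:
  assumes V: "finite V" and I: "finite I" and on: "orthonormal V I e" and card: "card I = card V"
  shows "orthobasis V I e"
proof -
  let ?d = "\<lambda>x y. if y = x then 1 else (0::complex)"
  have le: "(\<Sum>i\<in>I. (cmod (e i x))\<^sup>2) \<le> 1" if "x \<in> V" for x
    using bessel[OF I on, of "?d x"] nsq_delta[OF V that] by simp
  have "(\<Sum>x\<in>V. (\<Sum>i\<in>I. (cmod (e i x))\<^sup>2)) = (\<Sum>i\<in>I. nsq V (e i))"
    unfolding nsq_def by (rule sum.swap)
  also have "\<dots> = (\<Sum>i\<in>I. 1)"
    using on hip_self[of V] by (intro sum.cong refl) (metis orthonormal_def of_real_eq_1_iff)
  finally have tot: "(\<Sum>x\<in>V. 1 - (\<Sum>i\<in>I. (cmod (e i x))\<^sup>2)) = 0"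
    using card by (simp add: sum_subtractf)
  have eq: "(\<Sum>i\<in>I. (cmod (e i x))\<^sup>2) = 1" if "x \<in> V" for x
    using sum_nonneg_0[OF V _ tot that] le by force
  have "(\<Sum>i\<in>I. e i x * cnj (e i y)) = (if x = y then 1 else 0)" if "x \<in> V" "y \<in> V" for x y
  proof -
    have "nsq V (\<lambda>z. ?d y z - (\<Sum>i\<in>I. hip V (e i) (?d y) * e i z)) = 0"
      using projection_defect[OF I on, of "?d y"] nsq_delta[OF V that(2)] eq[OF that(2)] by simp
    then have "?d y x - (\<Sum>i\<in>I. hip V (e i) (?d y) * e i x) = 0"
      using V that(1) by (simp add: nsq_def sum_nonneg_eq_0_iff)
    then show ?thesis
      using nsq_delta(2)[OF V that(2)] by (simp add: mult.commute)
  qed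
  then show ?thesis using V I on by (simp add: orthobasis_def)
qed

subsection \<open>Optimal test operators\<close>

text \<open>The parallel sum \<open>r t / (s r + t)\<close> is the minimum of \<open>(1 - x)\<^sup>2 r + x\<^sup>2 t / s\<close>, attained at
  \<open>x = s r / (s r + t)\<close>; this operator attains all these minima simultaneously.\<close>
definition optX :: "'v set \<Rightarrow> 'i set \<Rightarrow> ('i \<Rightarrow> 'v \<Rightarrow> complex) \<Rightarrow> 'j set \<Rightarrow> ('j \<Rightarrow> 'v \<Rightarrow> complex) \<Rightarrow>
    ('i \<Rightarrow> real) \<Rightarrow> ('j \<Rightarrow> real) \<Rightarrow> real \<Rightarrow> 'v \<Rightarrow> 'v \<Rightarrow> complex" where
  "optX V I u J f r t s = (\<lambda>x y. \<Sum>i\<in>I. \<Sum>j\<in>J.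
     of_real (s * r i / (s * r i + t j)) * hip V (u i) (f j) * u i x * cnj (f j y))"

lemma app_optX:
  assumes "orthonormal V J f" "finite J" "j \<in> J"
  shows "app V (optX V I u J f r t s) (f j) =
    (\<lambda>x. \<Sum>i\<in>I. (of_real (s * r i / (s * r i + t j)) * hip V (u i) (f j)) * u i x)"
proof
  fix x
  let ?c = "\<lambda>i j. of_real (s * r i / (s * r i + t j)) * hip V (u i) (f j)"
  have "app V (optX V I u J f r t s) (f j) x = (\<Sum>y\<in>V. \<Sum>i\<in>I. \<Sum>k\<in>J. ?c i k * u i x * (cnj (f k y) * f j y))"
    unfolding app_def optX_def sum_distrib_right by (simp add: mult_ac)
  also have "\<dots> = (\<Sum>i\<in>I. \<Sum>k\<in>J. \<Sum>y\<in>V. ?c i k * u i x * (cnj (f k y) * f j y))"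
    by (subst sum.swap, rule sum.cong[OF refl], rule sum.swap)
  also have "\<dots> = (\<Sum>i\<in>I. \<Sum>k\<in>J. ?c i k * u i x * hip V (f k) (f j))"
    by (simp add: hip_def sum_distrib_left)
  also have "\<dots> = (\<Sum>i\<in>I. \<Sum>k\<in>J. if k = j then ?c i j * u i x else 0)"
    using assms by (intro sum.cong refl) (simp add: orthonormalD)
  finally show "app V (optX V I u J f r t s) (f j) x = (\<Sum>i\<in>I. ?c i j * u i x)"
    using assms by simp
qed

lemma parallel_sum_attained:
  fixes r t s :: real
  assumes "r \<ge> 0" "t \<ge> 0" "s > 0"
  shows "r * (1 - s * r / (s * r + t))\<^sup>2 + t * (s * r / (s * r + t))\<^sup>2 / s = r * t / (s * r + t)"
proof (cases "s * r + t = 0")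
  case True
  then show ?thesis using assms by (auto simp: add_nonneg_eq_0_iff)
next
  case False
  define D where "D = s * r + t"
  have D: "D \<noteq> 0" "t = D - s * r" using False by (auto simp: D_def)
  have "r * (1 - s * r / D)\<^sup>2 + t * (s * r / D)\<^sup>2 / s = r * t / D"
    using D(1) \<open>s > 0\<close> unfolding D(2) by (simp add: field_simps power2_eq_square)
  then show ?thesis by (simp add: D_def)
qed

text \<open>The factor \<open>p * q / (s * p + q)\<close> is the parallel sum of \<open>p\<close>
  and \<open>q / s\<close>, so this is the lower bound over all splittings of a number into
  \<open>z + w\<close>. The defect is a perfect square.\<close>

lemma parallel_sum_le:
  fixes p q s :: real and z w :: complex
  assumes "p \<ge> 0" "q \<ge> 0" "s > 0"
  shows "(cmod (z + w))\<^sup>2 * (p * q / (s * p + q)) \<le> p * (cmod z)\<^sup>2 + q / s * (cmod w)\<^sup>2"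
proof (cases "s * p + q = 0")
  case True
  then show ?thesis using assms by auto
next
  case False
  define a b where "a = cmod z" and "b = cmod w"
  have D: "s * p + q > 0" using False assms by (simp add: order_less_le)
  have "cmod (z + w) \<le> a + b" by (simp add: a_def b_def norm_triangle_ineq)
  then have "(cmod (z + w))\<^sup>2 * (p * q / (s * p + q)) \<le> (a + b)\<^sup>2 * (p * q / (s * p + q))"
    using assms by (intro mult_right_mono power_mono) auto
  also have "\<dots> \<le> p * a\<^sup>2 + q / s * b\<^sup>2"
  proof -
    have "p * a\<^sup>2 + q / s * b\<^sup>2 - (a + b)\<^sup>2 * (p * q / (s * p + q)) = (s * p * a - q * b)\<^sup>2 / (s * (s * p + q))"
      using D \<open>s > 0\<close> by (simp add: field_simps power2_eq_square)
    also have "\<dots> \<ge> 0" using D \<open>s > 0\<close> by simp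
    finally show ?thesis by simp
  qed
  finally show ?thesis by (simp add: a_def b_def)
qed

text \<open>The matrix entry of \<open>X\<close> between \<open>u i\<close> and \<open>f j\<close>
  is a scalar multiple of \<open>hip V (u i) (f j)\<close>. Expanding the first norm along
  \<open>f\<close> and the second along \<open>u\<close> therefore decouples the pairs
  \<open>(i, j)\<close>, and each pair attains its scalar minimum. Hypotheses \<open>F\<close> and
  \<open>G\<close> ask for domination of quadratic forms only, so that a larger operator, such as a
  multiple of a memory state, can stand in for the actual one.\<close>

lemma optX_bound:
  fixes F :: "'r \<Rightarrow> 'v \<Rightarrow> complex" and G :: "'q \<Rightarrow> 'v \<Rightarrow> complex"
  assumes u: "orthobasis V I u" and f: "orthobasis V J f"
    and r: "\<And>i. i \<in> I \<Longrightarrow> r i \<ge> 0" and t: "\<And>j. j \<in> J \<Longrightarrow> t j \<ge> 0" and s: "s > 0"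
    and F: "\<And>y. (\<Sum>z\<in>R. (cmod (hip V y (F z)))\<^sup>2) \<le> (\<Sum>i\<in>I. r i * (cmod (hip V y (u i)))\<^sup>2)"
    and G: "\<And>y. (\<Sum>z\<in>Q. (cmod (hip V y (G z)))\<^sup>2) \<le> (\<Sum>j\<in>J. t j * (cmod (hip V y (f j)))\<^sup>2)"
  defines "X \<equiv> optX V I u J f r t s"
  shows "(\<Sum>z\<in>R. nsq V (\<lambda>x. F z x - app V (adj X) (F z) x)) + (\<Sum>z\<in>Q. nsq V (app V X (G z))) / s
    \<le> (\<Sum>i\<in>I. \<Sum>j\<in>J. (cmod (hip V (u i) (f j)))\<^sup>2 * (r i * t j / (s * r i + t j)))"
proof -
  define x where "x i j = s * r i / (s * r i + t j)" for i j
  define w where "w i j = (cmod (hip V (u i) (f j)))\<^sup>2" for i j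
  have fin: "finite I" "finite J" and on: "orthonormal V I u" "orthonormal V J f"
    using u f by (auto simp: orthobasis_def)
  have Xf: "app V X (f j) = (\<lambda>y. \<Sum>i\<in>I. (of_real (x i j) * hip V (u i) (f j)) * u i y)" if "j \<in> J" for j
    unfolding X_def x_def using app_optX[OF on(2) fin(2) that] .
  have uX: "hip V (u i) (app V X (f j)) = of_real (x i j) * hip V (u i) (f j)" if "i \<in> I" "j \<in> J" for i j
    unfolding Xf[OF that(2)] hip_sum_right
    using that fin by (simp add: orthonormalD[OF on(1)] if_distrib cong: if_cong)
  have "(\<Sum>z\<in>R. nsq V (\<lambda>x. F z x - app V (adj X) (F z) x)) =
      (\<Sum>z\<in>R. \<Sum>j\<in>J. (cmod (hip V (\<lambda>y. f j y - app V X (f j) y) (F z)))\<^sup>2)"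
  proof (intro sum.cong refl)
    fix z
    have "hip V (f j) (\<lambda>x. F z x - app V (adj X) (F z) x) = hip V (\<lambda>y. f j y - app V X (f j) y) (F z)" for j
      unfolding hip_diff_left hip_diff_right by (metis hip_adj hip_cnj)
    then show "nsq V (\<lambda>x. F z x - app V (adj X) (F z) x) =
        (\<Sum>j\<in>J. (cmod (hip V (\<lambda>y. f j y - app V X (f j) y) (F z)))\<^sup>2)"
      using parseval[OF f, symmetric] by simp
  qed
  also have "\<dots> = (\<Sum>j\<in>J. \<Sum>z\<in>R. (cmod (hip V (\<lambda>y. f j y - app V X (f j) y) (F z)))\<^sup>2)"
    by (rule sum.swap)
  also have "\<dots> \<le> (\<Sum>j\<in>J. \<Sum>i\<in>I. r i * (cmod (hip V (\<lambda>y. f j y - app V X (f j) y) (u i)))\<^sup>2)"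
    by (intro sum_mono F)
  also have "\<dots> = (\<Sum>j\<in>J. \<Sum>i\<in>I. r i * ((1 - x i j)\<^sup>2 * w i j))"
  proof (intro sum.cong refl)
    fix i j assume ij: "i \<in> I" "j \<in> J"
    have "cmod (hip V (\<lambda>y. f j y - app V X (f j) y) (u i)) = cmod (hip V (u i) (\<lambda>y. f j y - app V X (f j) y))"
      by (rule hip_cmod_commute)
    also have "hip V (u i) (\<lambda>y. f j y - app V X (f j) y) = of_real (1 - x i j) * hip V (u i) (f j)"
      by (simp add: hip_diff_right uX ij algebra_simps)
    finally show "r i * (cmod (hip V (\<lambda>y. f j y - app V X (f j) y) (u i)))\<^sup>2 = r i * ((1 - x i j)\<^sup>2 * w i j)"
      by (simp add: norm_mult power_mult_distrib w_def del: of_real_diff)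
  qed
  also have "\<dots> = (\<Sum>i\<in>I. \<Sum>j\<in>J. w i j * (r i * (1 - x i j)\<^sup>2))"
    by (subst sum.swap) (simp add: mult_ac)
  finally have 1: "(\<Sum>z\<in>R. nsq V (\<lambda>x. F z x - app V (adj X) (F z) x)) \<le> \<dots>" .
  have "(\<Sum>z\<in>Q. nsq V (app V X (G z))) = (\<Sum>z\<in>Q. \<Sum>i\<in>I. (cmod (hip V (app V (adj X) (u i)) (G z)))\<^sup>2)"
    by (simp add: hip_adj parseval[OF u])
  also have "\<dots> = (\<Sum>i\<in>I. \<Sum>z\<in>Q. (cmod (hip V (app V (adj X) (u i)) (G z)))\<^sup>2)"
    by (rule sum.swap)
  also have "\<dots> \<le> (\<Sum>i\<in>I. \<Sum>j\<in>J. t j * (cmod (hip V (app V (adj X) (u i)) (f j)))\<^sup>2)"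
    by (intro sum_mono G)
  also have "\<dots> = (\<Sum>i\<in>I. \<Sum>j\<in>J. w i j * (t j * (x i j)\<^sup>2))"
    by (intro sum.cong refl)
       (simp add: hip_adj uX norm_mult power_mult_distrib w_def mult_ac del: of_real_mult)
  finally have "(\<Sum>z\<in>Q. nsq V (app V X (G z))) / s \<le> (\<Sum>i\<in>I. \<Sum>j\<in>J. w i j * (t j * (x i j)\<^sup>2)) / s"
    by (rule divide_right_mono) (use s in simp)
  also have "\<dots> = (\<Sum>i\<in>I. \<Sum>j\<in>J. w i j * (t j * (x i j)\<^sup>2 / s))"
    by (simp add: sum_divide_distrib)
  finally have "(\<Sum>z\<in>Q. nsq V (app V X (G z))) / s \<le> \<dots>" .
  with 1 have "(\<Sum>z\<in>R. nsq V (\<lambda>x. F z x - app V (adj X) (F z) x)) + (\<Sum>z\<in>Q. nsq V (app V X (G z))) / s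
    \<le> (\<Sum>i\<in>I. \<Sum>j\<in>J. w i j * (r i * (1 - x i j)\<^sup>2 + t j * (x i j)\<^sup>2 / s))"
    by (simp add: distrib_left sum.distrib)
  also have "\<dots> = (\<Sum>i\<in>I. \<Sum>j\<in>J. w i j * (r i * t j / (s * r i + t j)))"
    using parallel_sum_attained r t s by (intro sum.cong refl) (simp add: x_def)
  finally show ?thesis by (simp add: w_def)
qed

subsection \<open>Comparison of logarithmic sums\<close>

text \<open>Hypothesis \<open>nest\<close> expresses that the support of the first operator lies in
  that of the second. Terms with \<open>W z * p z = 0\<close> drop out, and on the rest
  \<open>q z / p z\<close> is a positive number, so neither a division by 0 nor \<open>ln 0\<close>
  ever contributes.\<close>

lemma restrict_pos:
  fixes W p q :: "'z \<Rightarrow> real"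
  assumes fin: "finite Z" and nn: "\<forall>z\<in>Z. p z \<ge> 0 \<and> q z \<ge> 0"
    and nest: "\<forall>z\<in>Z. q z = 0 \<longrightarrow> W z * p z = 0"
  defines "Z0 \<equiv> {z\<in>Z. W z * p z \<noteq> 0}"
  shows "\<And>z. z \<in> Z0 \<Longrightarrow> p z > 0 \<and> q z > 0"
    and "(\<Sum>z\<in>Z. W z * p z) = (\<Sum>z\<in>Z0. W z * p z)"
    and "(\<Sum>z\<in>Z. W z * p z * (ln (q z) - ln (p z))) = (\<Sum>z\<in>Z0. W z * p z * ln (q z / p z))"
    and "s > 0 \<Longrightarrow> (\<Sum>z\<in>Z. W z * (p z * q z / (s * p z + q z))) =
      (\<Sum>z\<in>Z0. W z * p z * (q z / p z) / (s + q z / p z))"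
proof -
  show pos: "p z > 0 \<and> q z > 0" if "z \<in> Z0" for z
    using that nn nest by (fastforce simp: Z0_def order_less_le)
  have Z0: "sum h Z0 = sum h Z" if "\<And>z. z \<in> Z \<Longrightarrow> W z * p z = 0 \<Longrightarrow> h z = 0" for h :: "'z \<Rightarrow> real"
    unfolding Z0_def by (intro sum.mono_neutral_left fin) (use that in auto)
  show "(\<Sum>z\<in>Z. W z * p z) = (\<Sum>z\<in>Z0. W z * p z)"
    by (rule Z0[symmetric])
  show "(\<Sum>z\<in>Z. W z * p z * (ln (q z) - ln (p z))) = (\<Sum>z\<in>Z0. W z * p z * ln (q z / p z))"
  proof (subst Z0[symmetric])
    show "(\<Sum>z\<in>Z0. W z * p z * (ln (q z) - ln (p z))) = (\<Sum>z\<in>Z0. W z * p z * ln (q z / p z))"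
      using pos by (intro sum.cong refl) (metis ln_divide_pos)
  qed auto
  show "(\<Sum>z\<in>Z. W z * (p z * q z / (s * p z + q z))) =
      (\<Sum>z\<in>Z0. W z * p z * (q z / p z) / (s + q z / p z))" if "s > 0"
  proof (subst Z0[symmetric])
    show "(\<Sum>z\<in>Z0. W z * (p z * q z / (s * p z + q z))) =
      (\<Sum>z\<in>Z0. W z * p z * (q z / p z) / (s + q z / p z))"
    proof (intro sum.cong refl)
      fix z assume "z \<in> Z0"
      then have "p z > 0" using pos by auto
      then have "s + q z / p z = (s * p z + q z) / p z" by (simp add: field_simps)
      then show "W z * (p z * q z / (s * p z + q z)) = W z * p z * (q z / p z) / (s + q z / p z)"
        using \<open>p z > 0\<close> by simp
    qed
  qed auto
qed

lemma log_sum_mono: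
  fixes W p q :: "'z \<Rightarrow> real" and W' p' q' :: "'y \<Rightarrow> real"
  assumes "finite Z" "finite Y"
    and nn: "\<forall>z\<in>Z. p z \<ge> 0 \<and> q z \<ge> 0" "\<forall>z\<in>Y. p' z \<ge> 0 \<and> q' z \<ge> 0"
    and nest: "\<forall>z\<in>Z. q z = 0 \<longrightarrow> W z * p z = 0" "\<forall>z\<in>Y. q' z = 0 \<longrightarrow> W' z * p' z = 0"
    and eq: "(\<Sum>z\<in>Z. W z * p z) = (\<Sum>z\<in>Y. W' z * p' z)"
    and le: "\<And>s. s > 0 \<Longrightarrow> (\<Sum>z\<in>Z. W z * (p z * q z / (s * p z + q z)))
      \<le> (\<Sum>z\<in>Y. W' z * (p' z * q' z / (s * p' z + q' z)))"
  shows "(\<Sum>z\<in>Z. W z * p z * (ln (q z) - ln (p z))) \<le> (\<Sum>z\<in>Y. W' z * p' z * (ln (q' z) - ln (p' z)))"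
proof -
  note Z = restrict_pos[where p = p and q = q and W = W, OF \<open>finite Z\<close> nn(1) nest(1)]
  note Y = restrict_pos[where p = p' and q = q' and W = W', OF \<open>finite Y\<close> nn(2) nest(2)]
  let ?Z = "{z\<in>Z. W z * p z \<noteq> 0}" and ?Y = "{z\<in>Y. W' z * p' z \<noteq> 0}"
  have "(\<Sum>z\<in>?Z. W z * p z * ln (q z / p z)) \<le> (\<Sum>z\<in>?Y. W' z * p' z * ln (q' z / p' z))"
  proof (rule sum_ln_mono[where a = "\<lambda>z. W z * p z" and x = "\<lambda>z. q z / p z" and a' = "\<lambda>z. W' z * p' z" and x' = "\<lambda>z. q' z / p' z"])
    fix s :: real assume "s > 0"
    from le[OF this] show "(\<Sum>z\<in>?Z. W z * p z * (q z / p z) / (s + q z / p z))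
        \<le> (\<Sum>z\<in>?Y. W' z * p' z * (q' z / p' z) / (s + q' z / p' z))"
      unfolding Z(4)[OF \<open>s > 0\<close>] Y(4)[OF \<open>s > 0\<close>] .
  next
    show "(\<Sum>z\<in>?Z. W z * p z) = (\<Sum>z\<in>?Y. W' z * p' z)"
      using eq by (simp only: Z(2) Y(2))
  qed (use Z(1) Y(1) in auto)
  then show ?thesis by (simp only: Z(3) Y(3))
qed

text \<open>The second family enters \<open>sum_ln_mono\<close> with the inverted ratio
  \<open>x = p' / q'\<close>. Since \<open>x / (s + x) = 1 - (1 / x) / (1 / s + 1 / x)\<close>,
  inversion turns \<open>s\<close> into \<open>1 / s\<close> and changes the sign of the parallel
  sum; this is why \<open>le\<close> bounds the sum of both families from below by the common total
  weight.\<close>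

lemma log_sum_dual:
  fixes W p q :: "'z \<Rightarrow> real" and W' p' q' :: "'y \<Rightarrow> real"
  assumes "finite Z" "finite Y"
    and nn: "\<forall>z\<in>Z. p z \<ge> 0 \<and> q z \<ge> 0" "\<forall>z\<in>Y. p' z \<ge> 0 \<and> q' z \<ge> 0"
    and nest: "\<forall>z\<in>Z. q z = 0 \<longrightarrow> W z * p z = 0" "\<forall>z\<in>Y. q' z = 0 \<longrightarrow> W' z * p' z = 0"
    and eq: "(\<Sum>z\<in>Z. W z * p z) = (\<Sum>z\<in>Y. W' z * p' z)"
    and le: "\<And>s. s > 0 \<Longrightarrow> (\<Sum>z\<in>Z. W z * p z) \<le> (\<Sum>z\<in>Z. W z * (p z * q z / (s * p z + q z)))
      + (\<Sum>z\<in>Y. W' z * (p' z * q' z / (1 / s * p' z + q' z)))"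
  shows "0 \<le> (\<Sum>z\<in>Z. W z * p z * (ln (q z) - ln (p z))) + (\<Sum>z\<in>Y. W' z * p' z * (ln (q' z) - ln (p' z)))"
proof -
  note Z = restrict_pos[where p = p and q = q and W = W, OF \<open>finite Z\<close> nn(1) nest(1)]
  note Y = restrict_pos[where p = p' and q = q' and W = W', OF \<open>finite Y\<close> nn(2) nest(2)]
  let ?Z = "{z\<in>Z. W z * p z \<noteq> 0}" and ?Y = "{z\<in>Y. W' z * p' z \<noteq> 0}"
  have "(\<Sum>z\<in>?Y. W' z * p' z * ln (p' z / q' z)) \<le> (\<Sum>z\<in>?Z. W z * p z * ln (q z / p z))"
  proof (rule sum_ln_mono[where a = "\<lambda>z. W' z * p' z" and x = "\<lambda>z. p' z / q' z" and a' = "\<lambda>z. W z * p z" and x' = "\<lambda>z. q z / p z"])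
    fix s :: real assume s: "s > 0"
    have "(\<Sum>z\<in>?Y. W' z * p' z * (p' z / q' z) / (s + p' z / q' z)) =
      (\<Sum>z\<in>?Y. W' z * p' z - W' z * p' z * (q' z / p' z) / (1 / s + q' z / p' z))"
    proof (intro sum.cong refl)
      fix z assume "z \<in> ?Y"
      then have pos: "p' z > 0" "q' z > 0" using Y(1) by blast+
      have "a * (x / y) / (s + x / y) = a - a * (y / x) / (1 / s + y / x)"
        if "x > 0" "y > 0" for a x y :: real
      proof -
        have "s + x / y = (s * y + x) / y" "1 / s + y / x = (s * y + x) / (s * x)"
          using that s by (simp_all add: field_simps)
        moreover have "s * y + x > 0" using that s by (simp add: add_pos_pos)
        ultimately show ?thesis using that s by (simp add: field_simps)
      qed
      with pos show "W' z * p' z * (p' z / q' z) / (s + p' z / q' z) =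
        W' z * p' z - W' z * p' z * (q' z / p' z) / (1 / s + q' z / p' z)" by blast
    qed
    also have "\<dots> = (\<Sum>z\<in>Y. W' z * p' z) - (\<Sum>z\<in>Y. W' z * (p' z * q' z / (1 / s * p' z + q' z)))"
      using Y(4)[of "1 / s"] s by (simp only: sum_subtractf Y(2)) simp
    also have "\<dots> \<le> (\<Sum>z\<in>?Z. W z * p z * (q z / p z) / (s + q z / p z))"
      using le[OF s] eq unfolding Z(4)[OF s] by linarith
    finally show "(\<Sum>z\<in>?Y. W' z * p' z * (p' z / q' z) / (s + p' z / q' z)) \<le> \<dots>" .
  qed (use Z(1) Y(1) eq in \<open>auto simp: Z(2) Y(2)\<close>)
  moreover have "(\<Sum>z\<in>?Y. W' z * p' z * ln (p' z / q' z)) = - (\<Sum>z\<in>?Y. W' z * p' z * ln (q' z / p' z))"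
    using Y(1) by (auto simp: ln_div algebra_simps simp flip: sum_negf intro!: sum.cong)
  ultimately show ?thesis by (simp add: Z(3) Y(3))
qed

lemma nsq_times: "nsq (K \<times> B) f = (\<Sum>k\<in>K. nsq B (\<lambda>b. f (k, b)))"
  by (simp add: nsq_def sum.cartesian_product)

lemma hip_times: "hip (K \<times> B) f g = (\<Sum>k\<in>K. hip B (\<lambda>b. f (k, b)) (\<lambda>b. g (k, b)))"
  by (simp add: hip_def sum.cartesian_product)

subsection \<open>Monotonicity under block-diagonal pinching\<close>

text \<open>A block-diagonal operator that is optimal in each block is a competitor for the whole
  space. The overlap of \<open>e i\<close> and \<open>g j\<close> splits into that of
  \<open>ee i\<close> with \<open>g j\<close> and that of \<open>e i\<close> with
  \<open>Xg j\<close>. After \<open>parallel_sum_le\<close> each term carries only one of the two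
  eigenvalues, so Bessel's inequality removes the sum over the other basis, and the remaining norms
  split over the blocks.\<close>

lemma block_parallel_sum:
  fixes e :: "'i \<Rightarrow> 'k \<times> 'b \<Rightarrow> complex" and g :: "'j \<Rightarrow> 'k \<times> 'b \<Rightarrow> complex"
  assumes e: "finite I" "orthonormal (K \<times> B) I e" and g: "finite J" "orthonormal (K \<times> B) J g"
    and p: "\<And>i. i \<in> I \<Longrightarrow> p i \<ge> 0" and q: "\<And>j. j \<in> J \<Longrightarrow> q j \<ge> 0"
    and u: "\<And>k. k \<in> K \<Longrightarrow> orthobasis B B (u k)" and f: "\<And>k. k \<in> K \<Longrightarrow> orthobasis B B (f k)"
    and r: "\<And>k b. k \<in> K \<Longrightarrow> b \<in> B \<Longrightarrow> r k b \<ge> 0" and t: "\<And>k b. k \<in> K \<Longrightarrow> b \<in> B \<Longrightarrow> t k b \<ge> 0"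
    and s: "s > 0"
    and er: "\<And>k y. k \<in> K \<Longrightarrow> (\<Sum>i\<in>I. p i * (cmod (hip B y (\<lambda>b. e i (k, b))))\<^sup>2)
      \<le> (\<Sum>b\<in>B. r k b * (cmod (hip B y (u k b)))\<^sup>2)"
    and gt: "\<And>k y. k \<in> K \<Longrightarrow> (\<Sum>j\<in>J. q j * (cmod (hip B y (\<lambda>b. g j (k, b))))\<^sup>2)
      \<le> (\<Sum>b\<in>B. t k b * (cmod (hip B y (f k b)))\<^sup>2)"
  shows "(\<Sum>i\<in>I. \<Sum>j\<in>J. (cmod (hip (K \<times> B) (e i) (g j)))\<^sup>2 * (p i * q j / (s * p i + q j)))
    \<le> (\<Sum>k\<in>K. \<Sum>a\<in>B. \<Sum>b\<in>B. (cmod (hip B (u k a) (f k b)))\<^sup>2 * (r k a * t k b / (s * r k a + t k b)))"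
proof -
  define X where "X k = optX B B (u k) B (f k) (r k) (t k) s" for k
  define Xe where "Xe i = (\<lambda>(k, b). app B (adj (X k)) (\<lambda>b. e i (k, b)) b)" for i
  define Xg where "Xg j = (\<lambda>(k, b). app B (X k) (\<lambda>b. g j (k, b)) b)" for j
  define ee where "ee i = (\<lambda>x. e i x - Xe i x)" for i
  have adj: "hip (K \<times> B) (Xe i) (g j) = hip (K \<times> B) (e i) (Xg j)" for i j
    by (simp add: hip_times Xe_def Xg_def hip_adj)
  have "(\<Sum>i\<in>I. \<Sum>j\<in>J. (cmod (hip (K \<times> B) (e i) (g j)))\<^sup>2 * (p i * q j / (s * p i + q j)))
    \<le> (\<Sum>i\<in>I. \<Sum>j\<in>J. p i * (cmod (hip (K \<times> B) (ee i) (g j)))\<^sup>2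
        + q j / s * (cmod (hip (K \<times> B) (e i) (Xg j)))\<^sup>2)"
  proof (intro sum_mono)
    fix i j assume "i \<in> I" "j \<in> J"
    moreover have "hip (K \<times> B) (e i) (g j) = hip (K \<times> B) (ee i) (g j) + hip (K \<times> B) (e i) (Xg j)"
      by (simp add: ee_def hip_diff_left adj)
    ultimately show "(cmod (hip (K \<times> B) (e i) (g j)))\<^sup>2 * (p i * q j / (s * p i + q j))
      \<le> p i * (cmod (hip (K \<times> B) (ee i) (g j)))\<^sup>2 + q j / s * (cmod (hip (K \<times> B) (e i) (Xg j)))\<^sup>2"
      using parallel_sum_le[OF p q s] by simp
  qed
  also have "\<dots> = (\<Sum>i\<in>I. p i * (\<Sum>j\<in>J. (cmod (hip (K \<times> B) (g j) (ee i)))\<^sup>2))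
      + (\<Sum>j\<in>J. q j / s * (\<Sum>i\<in>I. (cmod (hip (K \<times> B) (e i) (Xg j)))\<^sup>2))"
    unfolding sum.distrib sum_distrib_left
    by (subst (2) sum.swap) (simp add: hip_cmod_commute[of _ "ee _"])
  also have "\<dots> \<le> (\<Sum>i\<in>I. p i * nsq (K \<times> B) (ee i)) + (\<Sum>j\<in>J. q j / s * nsq (K \<times> B) (Xg j))"
    using p q s by (intro add_mono sum_mono mult_left_mono bessel e g) auto
  also have "\<dots> = (\<Sum>k\<in>K. (\<Sum>i\<in>I. p i * nsq B (\<lambda>b. e i (k, b) - app B (adj (X k)) (\<lambda>b. e i (k, b)) b))
      + (\<Sum>j\<in>J. q j * nsq B (app B (X k) (\<lambda>b. g j (k, b)))) / s)"
    unfolding nsq_times sum.distrib sum_distrib_left sum_divide_distrib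
    by (subst (1 2) sum.swap) (simp add: ee_def Xe_def Xg_def)
  also have "\<dots> \<le> (\<Sum>k\<in>K. \<Sum>a\<in>B. \<Sum>b\<in>B. (cmod (hip B (u k a) (f k b)))\<^sup>2 * (r k a * t k b / (s * r k a + t k b)))"
  proof (intro sum_mono)
    fix k assume k: "k \<in> K"
    \<comment> \<open>Square roots of the eigenvalues are moved into the vectors, which turns the
      weighted sums into the unweighted families of \<open>optX_bound\<close>.\<close>
    let ?F = "\<lambda>i b. of_real (sqrt (p i)) * e i (k, b)" and ?G = "\<lambda>j b. of_real (sqrt (q j)) * g j (k, b)"
    have "(\<Sum>i\<in>I. p i * nsq B (\<lambda>b. e i (k, b) - app B (adj (X k)) (\<lambda>b. e i (k, b)) b))
      + (\<Sum>j\<in>J. q j * nsq B (app B (X k) (\<lambda>b. g j (k, b)))) / s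
      = (\<Sum>i\<in>I. nsq B (\<lambda>b. ?F i b - app B (adj (X k)) (?F i) b)) + (\<Sum>j\<in>J. nsq B (app B (X k) (?G j))) / s"
    proof -
      have "nsq B (\<lambda>b. ?F i b - app B (adj (X k)) (?F i) b) =
          p i * nsq B (\<lambda>b. e i (k, b) - app B (adj (X k)) (\<lambda>b. e i (k, b)) b)" if "i \<in> I" for i
        unfolding app_scale right_diff_distrib[symmetric] nsq_scale using p[OF that] by simp
      moreover have "nsq B (app B (X k) (?G j)) = q j * nsq B (app B (X k) (\<lambda>b. g j (k, b)))" if "j \<in> J" for j
        unfolding app_scale nsq_scale using q[OF that] by simp
      ultimately show ?thesis by simp
    qed
    also have "\<dots> \<le> (\<Sum>a\<in>B. \<Sum>b\<in>B. (cmod (hip B (u k a) (f k b)))\<^sup>2 * (r k a * t k b / (s * r k a + t k b)))"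
      unfolding X_def
    proof (rule optX_bound[OF u[OF k] f[OF k] r[OF k] t[OF k] s])
      fix y
      show "(\<Sum>z\<in>I. (cmod (hip B y (?F z)))\<^sup>2) \<le> (\<Sum>i\<in>B. r k i * (cmod (hip B y (u k i)))\<^sup>2)"
        using er[OF k, of y] p by (simp add: hip_scale_right norm_mult power_mult_distrib)
      show "(\<Sum>z\<in>J. (cmod (hip B y (?G z)))\<^sup>2) \<le> (\<Sum>i\<in>B. t k i * (cmod (hip B y (f k i)))\<^sup>2)"
        using gt[OF k, of y] q by (simp add: hip_scale_right norm_mult power_mult_distrib)
    qed
    finally show "(\<Sum>i\<in>I. p i * nsq B (\<lambda>b. e i (k, b) - app B (adj (X k)) (\<lambda>b. e i (k, b)) b))
      + (\<Sum>j\<in>J. q j * nsq B (app B (X k) (\<lambda>b. g j (k, b)))) / s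
      \<le> (\<Sum>a\<in>B. \<Sum>b\<in>B. (cmod (hip B (u k a) (f k b)))\<^sup>2 * (r k a * t k b / (s * r k a + t k b)))" .
  qed
  finally show ?thesis .
qed

lemma weights_sum1:
  assumes "orthobasis V J g" "orthonormal V I e" "i \<in> I"
  shows "(\<Sum>j\<in>J. (cmod (hip V (e i) (g j)))\<^sup>2) = 1"
proof -
  have "of_real (nsq V (e i)) = (1::complex)"
    using orthonormalD[OF assms(2) assms(3) assms(3)] by (simp add: hip_self)
  then show ?thesis
    using parseval[OF assms(1), of "e i"] by (simp add: hip_cmod_commute[of V "e i"])
qed

text \<open>The squared overlaps of \<open>e i\<close> sum to 1 over \<open>j\<close>, which leaves
  the entropy term of \<open>p\<close>. The other term is the trace of the first operator times the
  logarithm of the second.\<close>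

lemma log_sum_expand:
  fixes p q :: "_ \<Rightarrow> real"
  assumes "orthobasis V J g" "orthonormal V I e"
  shows "(\<Sum>i\<in>I. \<Sum>j\<in>J. (cmod (hip V (e i) (g j)))\<^sup>2 * p i * (ln (q j) - ln (p i))) =
    (\<Sum>j\<in>J. (\<Sum>i\<in>I. p i * (cmod (hip V (e i) (g j)))\<^sup>2) * ln (q j)) - (\<Sum>i\<in>I. p i * ln (p i))"
proof -
  have "(\<Sum>i\<in>I. \<Sum>j\<in>J. (cmod (hip V (e i) (g j)))\<^sup>2 * p i * ln (p i)) = (\<Sum>i\<in>I. p i * ln (p i))"
    using weights_sum1[OF assms] by (simp add: mult.assoc flip: sum_distrib_right)
  moreover have "(\<Sum>i\<in>I. \<Sum>j\<in>J. (cmod (hip V (e i) (g j)))\<^sup>2 * p i * ln (q j)) =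
      (\<Sum>j\<in>J. (\<Sum>i\<in>I. p i * (cmod (hip V (e i) (g j)))\<^sup>2) * ln (q j))"
    unfolding sum_distrib_right by (subst sum.swap) (simp add: mult_ac)
  ultimately show ?thesis by (simp add: right_diff_distrib sum_subtractf)
qed

text \<open>The left side is minus the relative entropy of the operators with spectral data
  \<open>(p, e)\<close> and \<open>(q, g)\<close>; the right side is minus a sum of relative
  entropies over the blocks. Thus the lemma combines monotonicity under pinching with antitonicity
  in the second argument: \<open>t k\<close> and \<open>f k\<close> may describe any operator above
  the corresponding block.\<close>

lemma block_entropy:
  fixes e :: "'i \<Rightarrow> 'k \<times> 'b \<Rightarrow> complex" and g :: "'j \<Rightarrow> 'k \<times> 'b \<Rightarrow> complex"
  assumes K: "finite K" "finite B"
    and e: "finite I" "orthonormal (K \<times> B) I e" and g: "orthobasis (K \<times> B) J g"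
    and p: "\<And>i. i \<in> I \<Longrightarrow> p i \<ge> 0" and q: "\<And>j. j \<in> J \<Longrightarrow> q j \<ge> 0"
    and u: "\<And>k. k \<in> K \<Longrightarrow> orthobasis B B (u k)" and f: "\<And>k. k \<in> K \<Longrightarrow> orthobasis B B (f k)"
    and r: "\<And>k b. k \<in> K \<Longrightarrow> b \<in> B \<Longrightarrow> r k b \<ge> 0" and t: "\<And>k b. k \<in> K \<Longrightarrow> b \<in> B \<Longrightarrow> t k b \<ge> 0"
    and er: "\<And>k y. k \<in> K \<Longrightarrow> (\<Sum>i\<in>I. p i * (cmod (hip B y (\<lambda>b. e i (k, b))))\<^sup>2)
      \<le> (\<Sum>b\<in>B. r k b * (cmod (hip B y (u k b)))\<^sup>2)"
    and gt: "\<And>k y. k \<in> K \<Longrightarrow> (\<Sum>j\<in>J. q j * (cmod (hip B y (\<lambda>b. g j (k, b))))\<^sup>2)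
      \<le> (\<Sum>b\<in>B. t k b * (cmod (hip B y (f k b)))\<^sup>2)"
    and tr: "(\<Sum>i\<in>I. p i) = (\<Sum>k\<in>K. \<Sum>b\<in>B. r k b)"
    and nest: "\<And>i j. i \<in> I \<Longrightarrow> j \<in> J \<Longrightarrow> q j = 0 \<Longrightarrow> (cmod (hip (K \<times> B) (e i) (g j)))\<^sup>2 * p i = 0"
    and nest': "\<And>k a b. k \<in> K \<Longrightarrow> a \<in> B \<Longrightarrow> b \<in> B \<Longrightarrow> t k b = 0 \<Longrightarrow> (cmod (hip B (u k a) (f k b)))\<^sup>2 * r k a = 0"
  shows "(\<Sum>j\<in>J. (\<Sum>i\<in>I. p i * (cmod (hip (K \<times> B) (e i) (g j)))\<^sup>2) * ln (q j)) - (\<Sum>i\<in>I. p i * ln (p i))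
    \<le> (\<Sum>k\<in>K. (\<Sum>b\<in>B. (\<Sum>a\<in>B. r k a * (cmod (hip B (u k a) (f k b)))\<^sup>2) * ln (t k b)) - (\<Sum>a\<in>B. r k a * ln (r k a)))"
proof -
  have finJ: "finite J" and og: "orthonormal (K \<times> B) J g" using g by (auto simp: orthobasis_def)
  have onu: "orthonormal B B (u k)" if "k \<in> K" for k using u[OF that] by (auto simp: orthobasis_def)
  let ?W = "\<lambda>i j. (cmod (hip (K \<times> B) (e i) (g j)))\<^sup>2" and ?w = "\<lambda>k a b. (cmod (hip B (u k a) (f k b)))\<^sup>2"
  have tr1: "(\<Sum>i\<in>I. \<Sum>j\<in>J. ?W i j * p i) = (\<Sum>i\<in>I. p i)"
    using weights_sum1[OF g e(2)] by (simp flip: sum_distrib_right)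
  have tr2: "(\<Sum>k\<in>K. \<Sum>a\<in>B. \<Sum>b\<in>B. ?w k a b * r k a) = (\<Sum>k\<in>K. \<Sum>a\<in>B. r k a)"
    using weights_sum1[OF f onu] by (simp flip: sum_distrib_right)
  have "(\<Sum>i\<in>I. \<Sum>j\<in>J. ?W i j * p i * (ln (q j) - ln (p i)))
    \<le> (\<Sum>k\<in>K. \<Sum>a\<in>B. \<Sum>b\<in>B. ?w k a b * r k a * (ln (t k b) - ln (r k a)))"
    using log_sum_mono[of "I \<times> J" "K \<times> B \<times> B" "\<lambda>(i, j). p i" "\<lambda>(i, j). q j" "\<lambda>(k, a, b). r k a" "\<lambda>(k, a, b). t k b"
        "\<lambda>(i, j). ?W i j" "\<lambda>(k, a, b). ?w k a b"]
      block_parallel_sum[OF e finJ og p q u f r t _ er gt] K e(1) finJ p q r t nest nest' tr tr1 tr2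
    by (auto simp: sum.cartesian_product split_beta)
  also have "(\<Sum>i\<in>I. \<Sum>j\<in>J. ?W i j * p i * (ln (q j) - ln (p i))) =
      (\<Sum>j\<in>J. (\<Sum>i\<in>I. p i * ?W i j) * ln (q j)) - (\<Sum>i\<in>I. p i * ln (p i))"
    by (rule log_sum_expand[OF g e(2)])
  also have "(\<Sum>k\<in>K. \<Sum>a\<in>B. \<Sum>b\<in>B. ?w k a b * r k a * (ln (t k b) - ln (r k a))) =
      (\<Sum>k\<in>K. (\<Sum>b\<in>B. (\<Sum>a\<in>B. r k a * ?w k a b) * ln (t k b)) - (\<Sum>a\<in>B. r k a * ln (r k a)))"
    by (intro sum.cong refl log_sum_expand f onu)
  finally show ?thesis .
qed

section \<open>Operators acting on two different tensor factors\<close>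

definition app1 :: "'b set \<Rightarrow> ('b \<Rightarrow> 'b \<Rightarrow> complex) \<Rightarrow> ('b \<times> 'c \<times> 'r \<Rightarrow> complex) \<Rightarrow> 'b \<times> 'c \<times> 'r \<Rightarrow> complex" where
  "app1 B X f = (\<lambda>(b, c, r). app B X (\<lambda>b. f (b, c, r)) b)"

definition app2 :: "'c set \<Rightarrow> ('c \<Rightarrow> 'c \<Rightarrow> complex) \<Rightarrow> ('b \<times> 'c \<times> 'r \<Rightarrow> complex) \<Rightarrow> 'b \<times> 'c \<times> 'r \<Rightarrow> complex" where
  "app2 C Y f = (\<lambda>(b, c, r). app C Y (\<lambda>c. f (b, c, r)) c)"

text \<open>Both sides are the form of \<open>f\<close> and \<open>g\<close> with \<open>X\<close>
  on the first factor and the adjoint of \<open>Y\<close> on the second. They differ in the order of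
  these two operators, which commute because they act on different factors.\<close>

lemma hip_app1_app2:
  "hip (B \<times> C \<times> R) (app1 B (adj X) f) (app2 C (adj Y) g) = hip (B \<times> C \<times> R) (app2 C Y f) (app1 B X g)"
proof -
  let ?S = "\<lambda>b c b' c' r. X b' b * cnj (f (b', c, r)) * (cnj (Y c' c) * g (b, c', r))"
  have "hip (B \<times> C \<times> R) (app1 B (adj X) f) (app2 C (adj Y) g) =
      (\<Sum>b\<in>B. \<Sum>c\<in>C. \<Sum>r\<in>R. \<Sum>b'\<in>B. \<Sum>c'\<in>C. ?S b c b' c' r)"
    by (simp add: hip_def app1_def app2_def app_def adj_def sum_product mult.assoc sum.cartesian_product' split_beta)
  also have "\<dots> = (\<Sum>b\<in>B. \<Sum>b'\<in>B. \<Sum>c\<in>C. \<Sum>c'\<in>C. \<Sum>r\<in>R. ?S b c b' c' r)"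
  proof (rule sum.cong[OF refl])
    fix b
    have "(\<Sum>c\<in>C. \<Sum>r\<in>R. \<Sum>b'\<in>B. \<Sum>c'\<in>C. ?S b c b' c' r) = (\<Sum>c\<in>C. \<Sum>b'\<in>B. \<Sum>c'\<in>C. \<Sum>r\<in>R. ?S b c b' c' r)"
      by (intro sum.cong[OF refl]) (subst sum.swap, intro sum.cong[OF refl], rule sum.swap)
    then show "(\<Sum>c\<in>C. \<Sum>r\<in>R. \<Sum>b'\<in>B. \<Sum>c'\<in>C. ?S b c b' c' r) = (\<Sum>b'\<in>B. \<Sum>c\<in>C. \<Sum>c'\<in>C. \<Sum>r\<in>R. ?S b c b' c' r)"
      by (simp add: sum.swap[of _ C B])
  qed
  \<comment> \<open>Exchanging primed and unprimed labels makes each operator act on the other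
    argument of the inner product.\<close>
  also have "\<dots> = (\<Sum>b\<in>B. \<Sum>b'\<in>B. \<Sum>c\<in>C. \<Sum>c'\<in>C. \<Sum>r\<in>R. ?S b' c' b c r)"
    by (rule trans[OF sum.swap], rule sum.cong[OF refl], rule sum.cong[OF refl], rule sum.swap)
  also have "\<dots> = (\<Sum>b\<in>B. \<Sum>c\<in>C. \<Sum>r\<in>R. \<Sum>b'\<in>B. \<Sum>c'\<in>C. ?S b' c' b c r)"
  proof (rule sum.cong[OF refl])
    fix b
    have "(\<Sum>c\<in>C. \<Sum>r\<in>R. \<Sum>b'\<in>B. \<Sum>c'\<in>C. ?S b' c' b c r) = (\<Sum>c\<in>C. \<Sum>b'\<in>B. \<Sum>c'\<in>C. \<Sum>r\<in>R. ?S b' c' b c r)"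
    proof (intro sum.cong[OF refl])
      fix c
      show "(\<Sum>r\<in>R. \<Sum>b'\<in>B. \<Sum>c'\<in>C. ?S b' c' b c r) = (\<Sum>b'\<in>B. \<Sum>c'\<in>C. \<Sum>r\<in>R. ?S b' c' b c r)"
        by (subst sum.swap, intro sum.cong[OF refl], rule sum.swap)
    qed
    then show "(\<Sum>b'\<in>B. \<Sum>c\<in>C. \<Sum>c'\<in>C. \<Sum>r\<in>R. ?S b' c' b c r) = (\<Sum>c\<in>C. \<Sum>r\<in>R. \<Sum>b'\<in>B. \<Sum>c'\<in>C. ?S b' c' b c r)"
      by (simp add: sum.swap[of _ C B])
  qed
  also have "\<dots> = hip (B \<times> C \<times> R) (app2 C Y f) (app1 B X g)"
    by (simp add: hip_def app1_def app2_def app_def sum_product mult_ac sum.cartesian_product' split_beta)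
  finally show ?thesis .
qed

lemma nsq_isometry:
  assumes "finite L" "orthonormal K L (\<lambda>l k. U k l)"
  shows "(\<Sum>k\<in>K. nsq W (\<lambda>w. \<Sum>l\<in>L. U k l * h l w)) = (\<Sum>l\<in>L. nsq W (h l))"
proof -
  have "(\<Sum>k\<in>K. nsq W (\<lambda>w. \<Sum>l\<in>L. U k l * h l w)) = (\<Sum>w\<in>W. nsq K (\<lambda>k. \<Sum>l\<in>L. h l w * U k l))"
    unfolding nsq_def by (subst sum.swap) (simp add: mult.commute)
  also have "\<dots> = (\<Sum>w\<in>W. \<Sum>l\<in>L. (cmod (h l w))\<^sup>2)"
    by (simp add: nsq_orthonormal_combination[OF assms])
  also have "\<dots> = (\<Sum>l\<in>L. nsq W (h l))"
    unfolding nsq_def by (rule sum.swap)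
  finally show ?thesis .
qed

text \<open>Weighted inequality between arithmetic and geometric mean in every coordinate. Through
  this estimate the bound \<open>c\<close> on the overlaps enters the tripartite relation.\<close>

lemma two_Re_hip_le:
  assumes "(cmod U)\<^sup>2 \<le> c" "s > 0"
  shows "2 * Re (U * hip W f g) \<le> s * nsq W f + c / s * nsq W g"
proof -
  have "2 * Re (U * (cnj a * b)) \<le> s * (cmod a)\<^sup>2 + c / s * (cmod b)\<^sup>2" for a b
  proof -
    have "2 * Re (U * (cnj a * b)) \<le> 2 * (cmod U * cmod a * cmod b)"
      using complex_Re_le_cmod[of "U * (cnj a * b)"] by (simp add: norm_mult)
    also have "\<dots> \<le> s * (cmod a)\<^sup>2 + (cmod U)\<^sup>2 / s * (cmod b)\<^sup>2"
    proof -
      have "s * (cmod a)\<^sup>2 + (cmod U)\<^sup>2 / s * (cmod b)\<^sup>2 - 2 * (cmod U * cmod a * cmod b) =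
          (s * cmod a - cmod U * cmod b)\<^sup>2 / s"
        using assms(2) by (simp add: field_simps power2_eq_square)
      also have "\<dots> \<ge> 0" using assms(2) by simp
      finally show ?thesis by simp
    qed
    also have "\<dots> \<le> s * (cmod a)\<^sup>2 + c / s * (cmod b)\<^sup>2"
      using assms by (intro add_left_mono mult_right_mono divide_right_mono) auto
    finally show ?thesis .
  qed
  then have "(\<Sum>w\<in>W. 2 * Re (U * (cnj (f w) * g w))) \<le> (\<Sum>w\<in>W. s * (cmod (f w))\<^sup>2 + c / s * (cmod (g w))\<^sup>2)"
    by (rule sum_mono)
  then show ?thesis
    by (simp only: hip_def nsq_def sum_distrib_left Re_sum sum.distrib)
qed

subsection \<open>The tripartite inequality\<close>

text \<open>With \<open>\<alpha> = X\<^sup>* \<Omega>\<close> and \<open>\<beta> = Y\<^sup>* \<Omega>\<close>, this is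
  \<open>\<parallel>\<Omega> - \<alpha>\<parallel>\<^sup>2 + \<parallel>\<Omega> - \<beta>\<parallel>\<^sup>2 + 2 Re \<langle>\<alpha>, \<beta>\<rangle> = \<parallel>\<Omega>\<parallel>\<^sup>2 + \<parallel>\<Omega> - \<alpha> - \<beta>\<parallel>\<^sup>2\<close>, where
  \<open>\<langle>\<alpha>, \<beta>\<rangle>\<close> is estimated by moving the commuting adjoints across.\<close>
lemma tensor_quadratic_bound:
  fixes P :: "'k \<Rightarrow> 'b \<times> 'c \<times> 'r \<Rightarrow> complex" and Q :: "'l \<Rightarrow> 'b \<times> 'c \<times> 'r \<Rightarrow> complex"
  assumes fin: "finite K" "finite L" and W: "W = B \<times> C \<times> R"
    and U: "orthonormal K L (\<lambda>l k. U k l)"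
    and PQ: "\<And>k w. k \<in> K \<Longrightarrow> w \<in> W \<Longrightarrow> P k w = (\<Sum>l\<in>L. U k l * Q l w)"
    and c: "\<And>k l. k \<in> K \<Longrightarrow> l \<in> L \<Longrightarrow> (cmod (U k l))\<^sup>2 \<le> c" and s: "s > 0"
  shows "(\<Sum>k\<in>K. nsq W (P k)) \<le>
      (\<Sum>k\<in>K. nsq W (\<lambda>w. P k w - app1 B (adj (X k)) (P k) w) + (\<Sum>l\<in>L. nsq W (app1 B (X k) (Q l))) * c / s)
    + (\<Sum>l\<in>L. nsq W (\<lambda>w. Q l w - app2 C (adj (Y l)) (Q l) w) + (\<Sum>k\<in>K. nsq W (app2 C (Y l) (P k))) * s)"
proof -
  define \<alpha> where "\<alpha> k = app1 B (adj (X k)) (P k)" for k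
  define \<beta>' where "\<beta>' l = app2 C (adj (Y l)) (Q l)" for l
  \<comment> \<open>The operators \<open>Y l\<close> act on the components \<open>Q l\<close> along
    the second basis; \<open>U\<close> carries the result over to the components along the first
    one. As \<open>U\<close> is isometric, the total defect is the same in both
    descriptions.\<close>
  define \<beta> where "\<beta> k = (\<lambda>w. \<Sum>l\<in>L. U k l * \<beta>' l w)" for k
  have "(\<Sum>k\<in>K. nsq W (\<lambda>w. P k w - \<beta> k w)) = (\<Sum>k\<in>K. nsq W (\<lambda>w. \<Sum>l\<in>L. U k l * (Q l w - \<beta>' l w)))"
    by (intro sum.cong refl nsq_cong) (simp add: PQ \<beta>_def sum_subtractf right_diff_distrib)
  also have "\<dots> = (\<Sum>l\<in>L. nsq W (\<lambda>w. Q l w - \<beta>' l w))"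
    by (rule nsq_isometry[OF fin(2) U])
  finally have 1: "(\<Sum>k\<in>K. nsq W (\<lambda>w. P k w - \<beta> k w)) = (\<Sum>l\<in>L. nsq W (\<lambda>w. Q l w - \<beta>' l w))" .
  have 2: "nsq W (P k) \<le> nsq W (\<lambda>w. P k w - \<alpha> k w) + nsq W (\<lambda>w. P k w - \<beta> k w) + 2 * Re (hip W (\<alpha> k) (\<beta> k))" for k
  proof -
    have "(cmod z)\<^sup>2 \<le> (cmod (z - a))\<^sup>2 + (cmod (z - b))\<^sup>2 + 2 * Re (cnj a * b)" for z a b
    proof -
      have "(cmod (z - a))\<^sup>2 + (cmod (z - b))\<^sup>2 + 2 * Re (cnj a * b) = (cmod z)\<^sup>2 + (cmod (z - a - b))\<^sup>2"
        by (simp add: cmod_power2) (simp add: power2_eq_square algebra_simps)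
      then show ?thesis by simp
    qed
    then have "nsq W (P k) \<le> (\<Sum>w\<in>W. (cmod (P k w - \<alpha> k w))\<^sup>2 + (cmod (P k w - \<beta> k w))\<^sup>2 + 2 * Re (cnj (\<alpha> k w) * \<beta> k w))"
      unfolding nsq_def by (rule sum_mono)
    then show ?thesis
      by (simp only: nsq_def hip_def sum.distrib Re_sum sum_distrib_left)
  qed
  have 3: "2 * Re (hip W (\<alpha> k) (\<beta> k)) \<le> (\<Sum>l\<in>L. s * nsq W (app2 C (Y l) (P k)) + c / s * nsq W (app1 B (X k) (Q l)))"
    if k: "k \<in> K" for k
  proof -
    have "hip W (\<alpha> k) (\<beta> k) = (\<Sum>l\<in>L. U k l * hip W (app2 C (Y l) (P k)) (app1 B (X k) (Q l)))"
      unfolding \<beta>_def hip_sum_right by (simp add: \<alpha>_def \<beta>'_def W hip_app1_app2)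
    then have "2 * Re (hip W (\<alpha> k) (\<beta> k)) = (\<Sum>l\<in>L. 2 * Re (U k l * hip W (app2 C (Y l) (P k)) (app1 B (X k) (Q l))))"
      by (simp only: Re_sum sum_distrib_left)
    also have "\<dots> \<le> (\<Sum>l\<in>L. s * nsq W (app2 C (Y l) (P k)) + c / s * nsq W (app1 B (X k) (Q l)))"
      by (intro sum_mono two_Re_hip_le c k s)
    finally show ?thesis .
  qed
  have "(\<Sum>k\<in>K. nsq W (P k)) \<le> (\<Sum>k\<in>K. nsq W (\<lambda>w. P k w - \<alpha> k w) + nsq W (\<lambda>w. P k w - \<beta> k w) +
      (\<Sum>l\<in>L. s * nsq W (app2 C (Y l) (P k)) + c / s * nsq W (app1 B (X k) (Q l))))"
    by (intro sum_mono order_trans[OF 2] add_mono 3) auto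
  also have "\<dots> = (\<Sum>k\<in>K. nsq W (\<lambda>w. P k w - \<alpha> k w) + (\<Sum>l\<in>L. nsq W (app1 B (X k) (Q l))) * c / s)
    + (\<Sum>l\<in>L. nsq W (\<lambda>w. Q l w - \<beta>' l w) + (\<Sum>k\<in>K. nsq W (app2 C (Y l) (P k))) * s)"
    unfolding sum.distrib 1 sum_distrib_right sum_divide_distrib
    by (subst (3) sum.swap) (simp add: mult_ac)
  finally show ?thesis by (simp add: \<alpha>_def \<beta>'_def)
qed

lemma nsq_fst: "nsq (B \<times> C \<times> R) f = (\<Sum>z\<in>C \<times> R. nsq B (\<lambda>b. f (b, z)))"
  unfolding nsq_times[of B "C \<times> R"] unfolding nsq_def by (rule sum.swap)

lemma nsq_snd: "nsq (B \<times> C \<times> R) f = (\<Sum>z\<in>B \<times> R. nsq C (\<lambda>c. f (fst z, c, snd z)))"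
proof -
  have "nsq (B \<times> C \<times> R) f = (\<Sum>b\<in>B. \<Sum>c\<in>C. \<Sum>r\<in>R. (cmod (f (b, c, r)))\<^sup>2)"
    by (simp add: nsq_def sum.cartesian_product')
  also have "\<dots> = (\<Sum>b\<in>B. \<Sum>r\<in>R. \<Sum>c\<in>C. (cmod (f (b, c, r)))\<^sup>2)"
    by (intro sum.cong[OF refl], rule sum.swap)
  finally show ?thesis by (simp only: nsq_def sum.cartesian_product' fst_conv snd_conv)
qed

text \<open>The right side is minus a sum of relative entropies: those of the conditional states of
  \<open>B\<close> against \<open>c\<close> times the state of \<open>B\<close>, and those of the
  conditional states of \<open>C\<close> against the state of \<open>C\<close>. The corresponding
  parallel sums at \<open>s\<close> and \<open>1 / s\<close> together reach the squared norm of the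
  vector, which is the input that \<open>log_sum_dual\<close> requires.\<close>

lemma tripartite_entropy:
  fixes P :: "'k \<Rightarrow> 'b \<times> 'c \<times> 'r \<Rightarrow> complex" and Q :: "'l \<Rightarrow> 'b \<times> 'c \<times> 'r \<Rightarrow> complex"
  assumes fin: "finite K" "finite L" "finite B" "finite C" "finite R" and W: "W = B \<times> C \<times> R"
    and U: "orthonormal K L (\<lambda>l k. U k l)"
    and PQ: "\<And>k w. k \<in> K \<Longrightarrow> w \<in> W \<Longrightarrow> P k w = (\<Sum>l\<in>L. U k l * Q l w)"
    and c: "\<And>k l. k \<in> K \<Longrightarrow> l \<in> L \<Longrightarrow> (cmod (U k l))\<^sup>2 \<le> c" and c0: "c > 0"
    and u: "\<And>k. k \<in> K \<Longrightarrow> orthobasis B B (u k)" and f: "orthobasis B B f"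
    and v: "\<And>l. l \<in> L \<Longrightarrow> orthobasis C C (v l)" and g: "orthobasis C C g"
    and r: "\<And>k b. k \<in> K \<Longrightarrow> b \<in> B \<Longrightarrow> r k b \<ge> 0" and t: "\<And>b. b \<in> B \<Longrightarrow> t b \<ge> 0"
    and r': "\<And>l b. l \<in> L \<Longrightarrow> b \<in> C \<Longrightarrow> r' l b \<ge> 0" and t': "\<And>b. b \<in> C \<Longrightarrow> t' b \<ge> 0"
    and Pr: "\<And>k y. k \<in> K \<Longrightarrow> (\<Sum>z\<in>C \<times> R. (cmod (hip B y (\<lambda>b. P k (b, z))))\<^sup>2)
      \<le> (\<Sum>b\<in>B. r k b * (cmod (hip B y (u k b)))\<^sup>2)"
    and Qt: "\<And>y. (\<Sum>l\<in>L. \<Sum>z\<in>C \<times> R. (cmod (hip B y (\<lambda>b. Q l (b, z))))\<^sup>2)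
      \<le> (\<Sum>b\<in>B. t b * (cmod (hip B y (f b)))\<^sup>2)"
    and Qr: "\<And>l y. l \<in> L \<Longrightarrow> (\<Sum>z\<in>B \<times> R. (cmod (hip C y (\<lambda>c. Q l (fst z, c, snd z))))\<^sup>2)
      \<le> (\<Sum>b\<in>C. r' l b * (cmod (hip C y (v l b)))\<^sup>2)"
    and Pt: "\<And>y. (\<Sum>k\<in>K. \<Sum>z\<in>B \<times> R. (cmod (hip C y (\<lambda>c. P k (fst z, c, snd z))))\<^sup>2)
      \<le> (\<Sum>b\<in>C. t' b * (cmod (hip C y (g b)))\<^sup>2)"
    and tr: "(\<Sum>k\<in>K. \<Sum>b\<in>B. r k b) = (\<Sum>k\<in>K. nsq W (P k))" "(\<Sum>l\<in>L. \<Sum>b\<in>C. r' l b) = (\<Sum>k\<in>K. nsq W (P k))"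
    and nest: "\<And>k a b. k \<in> K \<Longrightarrow> a \<in> B \<Longrightarrow> b \<in> B \<Longrightarrow> t b = 0 \<Longrightarrow> (cmod (hip B (u k a) (f b)))\<^sup>2 * r k a = 0"
    and nest': "\<And>l a b. l \<in> L \<Longrightarrow> a \<in> C \<Longrightarrow> b \<in> C \<Longrightarrow> t' b = 0 \<Longrightarrow> (cmod (hip C (v l a) (g b)))\<^sup>2 * r' l a = 0"
  shows "0 \<le> (\<Sum>k\<in>K. (\<Sum>b\<in>B. (\<Sum>a\<in>B. r k a * (cmod (hip B (u k a) (f b)))\<^sup>2) * ln (c * t b)) - (\<Sum>a\<in>B. r k a * ln (r k a)))
     + (\<Sum>l\<in>L. (\<Sum>b\<in>C. (\<Sum>a\<in>C. r' l a * (cmod (hip C (v l a) (g b)))\<^sup>2) * ln (t' b)) - (\<Sum>a\<in>C. r' l a * ln (r' l a)))"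
proof -
  let ?w = "\<lambda>k a b. (cmod (hip B (u k a) (f b)))\<^sup>2" and ?v = "\<lambda>l a b. (cmod (hip C (v l a) (g b)))\<^sup>2"
  have onu: "orthonormal B B (u k)" if "k \<in> K" for k using u[OF that] by (auto simp: orthobasis_def)
  have onv: "orthonormal C C (v l)" if "l \<in> L" for l using v[OF that] by (auto simp: orthobasis_def)
  have tr1: "(\<Sum>k\<in>K. \<Sum>a\<in>B. \<Sum>b\<in>B. ?w k a b * r k a) = (\<Sum>k\<in>K. nsq W (P k))"
    using weights_sum1[OF f onu] tr(1) by (simp flip: sum_distrib_right)
  have tr2: "(\<Sum>l\<in>L. \<Sum>a\<in>C. \<Sum>b\<in>C. ?v l a b * r' l a) = (\<Sum>k\<in>K. nsq W (P k))"
    using weights_sum1[OF g onv] tr(2) by (simp flip: sum_distrib_right)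
  have main: "(\<Sum>k\<in>K. nsq W (P k)) \<le> (\<Sum>k\<in>K. \<Sum>a\<in>B. \<Sum>b\<in>B. ?w k a b * (r k a * (c * t b) / (s * r k a + c * t b)))
    + (\<Sum>l\<in>L. \<Sum>a\<in>C. \<Sum>b\<in>C. ?v l a b * (r' l a * t' b / (1 / s * r' l a + t' b)))" if s: "s > 0" for s
  proof -
    \<comment> \<open>In \<open>tensor_quadratic_bound\<close> the quadratic terms in
      \<open>X\<close> and \<open>Y\<close> carry the factors \<open>c / s\<close> and
      \<open>s\<close>; the optimal parameters are the reciprocals \<open>s / c\<close> and
      \<open>1 / s\<close>. Afterwards \<open>c\<close> is moved into the eigenvalues
      \<open>c * t b\<close>.\<close>
    define X where "X k = optX B B (u k) B f (r k) t (s / c)" for k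
    define Y where "Y l = optX C C (v l) C g (r' l) t' (1 / s)" for l
    have "(\<Sum>k\<in>K. nsq W (P k)) \<le>
      (\<Sum>k\<in>K. nsq W (\<lambda>w. P k w - app1 B (adj (X k)) (P k) w) + (\<Sum>l\<in>L. nsq W (app1 B (X k) (Q l))) * c / s)
    + (\<Sum>l\<in>L. nsq W (\<lambda>w. Q l w - app2 C (adj (Y l)) (Q l) w) + (\<Sum>k\<in>K. nsq W (app2 C (Y l) (P k))) * s)"
      by (rule tensor_quadratic_bound[OF fin(1,2) W U PQ c s])
    also have "\<dots> \<le> (\<Sum>k\<in>K. \<Sum>a\<in>B. \<Sum>b\<in>B. ?w k a b * (r k a * (c * t b) / (s * r k a + c * t b)))
      + (\<Sum>l\<in>L. \<Sum>a\<in>C. \<Sum>b\<in>C. ?v l a b * (r' l a * t' b / (1 / s * r' l a + t' b)))"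
    proof (intro add_mono sum_mono)
      fix k assume k: "k \<in> K"
      have "nsq W (\<lambda>w. P k w - app1 B (adj (X k)) (P k) w) + (\<Sum>l\<in>L. nsq W (app1 B (X k) (Q l))) * c / s =
          (\<Sum>z\<in>C \<times> R. nsq B (\<lambda>b. P k (b, z) - app B (adj (X k)) (\<lambda>b. P k (b, z)) b))
          + (\<Sum>z\<in>L \<times> (C \<times> R). nsq B (app B (X k) (\<lambda>b. Q (fst z) (b, snd z)))) / (s / c)"
        unfolding W nsq_fst by (simp add: app1_def split_beta sum.cartesian_product)
      also have "\<dots> \<le> (\<Sum>a\<in>B. \<Sum>b\<in>B. ?w k a b * (r k a * t b / (s / c * r k a + t b)))"
        unfolding X_def
        by (rule optX_bound[OF u[OF k] f r[OF k] t])
           (use s c0 Pr[OF k] Qt in \<open>auto simp: sum.cartesian_product split_beta\<close>)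
      also have "\<dots> = (\<Sum>a\<in>B. \<Sum>b\<in>B. ?w k a b * (r k a * (c * t b) / (s * r k a + c * t b)))"
      proof (intro sum.cong refl)
        fix a b
        have "s / c * r k a + t b = (s * r k a + c * t b) / c" using c0 by (simp add: field_simps)
        then show "?w k a b * (r k a * t b / (s / c * r k a + t b)) = ?w k a b * (r k a * (c * t b) / (s * r k a + c * t b))"
          by simp
      qed
      finally show "nsq W (\<lambda>w. P k w - app1 B (adj (X k)) (P k) w) + (\<Sum>l\<in>L. nsq W (app1 B (X k) (Q l))) * c / s
        \<le> (\<Sum>a\<in>B. \<Sum>b\<in>B. ?w k a b * (r k a * (c * t b) / (s * r k a + c * t b)))" .
    next
      fix l assume l: "l \<in> L"
      have "nsq W (\<lambda>w. Q l w - app2 C (adj (Y l)) (Q l) w) + (\<Sum>k\<in>K. nsq W (app2 C (Y l) (P k))) * s =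
          (\<Sum>z\<in>B \<times> R. nsq C (\<lambda>c. Q l (fst z, c, snd z) - app C (adj (Y l)) (\<lambda>c. Q l (fst z, c, snd z)) c))
          + (\<Sum>z\<in>K \<times> (B \<times> R). nsq C (app C (Y l) (\<lambda>c. P (fst z) (fst (snd z), c, snd (snd z))))) / (1 / s)"
        unfolding W nsq_snd by (simp add: app2_def split_beta sum.cartesian_product)
      also have "\<dots> \<le> (\<Sum>a\<in>C. \<Sum>b\<in>C. ?v l a b * (r' l a * t' b / (1 / s * r' l a + t' b)))"
        unfolding Y_def
        by (rule optX_bound[OF v[OF l] g r'[OF l] t'])
           (use s Qr[OF l] Pt in \<open>auto simp: sum.cartesian_product split_beta\<close>)
      finally show "nsq W (\<lambda>w. Q l w - app2 C (adj (Y l)) (Q l) w) + (\<Sum>k\<in>K. nsq W (app2 C (Y l) (P k))) * s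
        \<le> (\<Sum>a\<in>C. \<Sum>b\<in>C. ?v l a b * (r' l a * t' b / (1 / s * r' l a + t' b)))" .
    qed
    finally show ?thesis .
  qed
  have "0 \<le> (\<Sum>(k, a, b)\<in>K \<times> B \<times> B. ?w k a b * r k a * (ln (c * t b) - ln (r k a)))
      + (\<Sum>(l, a, b)\<in>L \<times> C \<times> C. ?v l a b * r' l a * (ln (t' b) - ln (r' l a)))"
    using log_sum_dual[of "K \<times> B \<times> B" "L \<times> C \<times> C" "\<lambda>(k, a, b). r k a" "\<lambda>(k, a, b). c * t b"
        "\<lambda>(l, a, b). r' l a" "\<lambda>(l, a, b). t' b" "\<lambda>(k, a, b). ?w k a b" "\<lambda>(l, a, b). ?v l a b"]
      fin r t r' t' nest nest' tr1 tr2 main c0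
    by (auto simp: sum.cartesian_product split_beta)
  also have "(\<Sum>(k, a, b)\<in>K \<times> B \<times> B. ?w k a b * r k a * (ln (c * t b) - ln (r k a))) =
      (\<Sum>k\<in>K. (\<Sum>b\<in>B. (\<Sum>a\<in>B. r k a * ?w k a b) * ln (c * t b)) - (\<Sum>a\<in>B. r k a * ln (r k a)))"
    using log_sum_expand[OF f onu, where q = "\<lambda>b. c * t b"] by (simp flip: sum.cartesian_product)
  also have "(\<Sum>(l, a, b)\<in>L \<times> C \<times> C. ?v l a b * r' l a * (ln (t' b) - ln (r' l a))) =
      (\<Sum>l\<in>L. (\<Sum>b\<in>C. (\<Sum>a\<in>C. r' l a * ?v l a b) * ln (t' b)) - (\<Sum>a\<in>C. r' l a * ln (r' l a)))"
    using log_sum_expand[OF g onv] by (simp flip: sum.cartesian_product)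
  finally show ?thesis .
qed

subsection \<open>Spectral resolutions and entropy\<close>

definition resol :: "'v set \<Rightarrow> ('v \<Rightarrow> 'v \<Rightarrow> complex) \<Rightarrow> 'i set \<Rightarrow> ('i \<Rightarrow> 'v \<Rightarrow> complex) \<Rightarrow> ('i \<Rightarrow> real) \<Rightarrow> bool" where
  "resol V \<sigma> I e p \<longleftrightarrow> orthobasis V I e \<and>
     (\<forall>x\<in>V. \<forall>y\<in>V. \<sigma> x y = (\<Sum>i\<in>I. of_real (p i) * e i x * cnj (e i y)))"

text \<open>The entropy of \<open>ent\<close> for kernels on an arbitrary finite set, so that
  products of index sets can replace sets of configurations.\<close>

definition kent :: "'v set \<Rightarrow> ('v \<Rightarrow> 'v \<Rightarrow> complex) \<Rightarrow> real" where
  "kent V \<sigma> = vN_entropy (mat (card V) (card V) (\<lambda>(i, j). \<sigma> (enum_of V i) (enum_of V j)))"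

lemma ent_eq_kent: "ent D X \<sigma> = kent (cfg D X) \<sigma>"
  by (simp add: ent_def op_mat_def kent_def)

lemma enum_of_bij: "finite C \<Longrightarrow> bij_betw (enum_of C) {0..<card C} C"
  unfolding enum_of_def by (rule someI_ex[OF ex_bij_betw_nat_finite])

lemma kent_cong:
  assumes "finite V" "\<And>x y. x \<in> V \<Longrightarrow> y \<in> V \<Longrightarrow> \<sigma> x y = \<tau> x y"
  shows "kent V \<sigma> = kent V \<tau>"
proof -
  have "enum_of V i \<in> V" if "i < card V" for i
    using enum_of_bij[OF assms(1)] that by (auto simp: bij_betw_def)
  then show ?thesis
    unfolding kent_def by (intro arg_cong[where f = vN_entropy]) (auto simp: assms(2))
qed

text \<open>Passes from distinct roots with multiplicities to a list of eigenvalues. The sum runs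
  over any finite superset of the roots because in the induction a root may disappear together with
  its last factor.\<close>

lemma sum_order_linear_factors:
  fixes as :: "complex list" and f :: "complex \<Rightarrow> real"
  assumes "finite S" "set as \<subseteq> S"
  shows "(\<Sum>a\<in>S. real (order a (\<Prod>b\<leftarrow>as. [:- b, 1:])) * f a) = (\<Sum>b\<leftarrow>as. f b)"
  using assms(2)
proof (induction as)
  case (Cons b as)
  have nz: "(\<Prod>b\<leftarrow>as. [:- b, 1:]) \<noteq> (0 :: complex poly)"
    by (auto simp: prod_list_zero_iff)
  have "order a (\<Prod>b\<leftarrow>b # as. [:- b, 1:]) = (if a = b then 1 else 0) + order a (\<Prod>b\<leftarrow>as. [:- b, 1:])" for a
  proof -
    have "order a (\<Prod>b\<leftarrow>b # as. [:- b, 1:]) = order a [:- b, 1:] + order a (\<Prod>b\<leftarrow>as. [:- b, 1:])"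
      using nz unfolding list.map prod_list.Cons by (intro order_mult) (metis no_zero_divisors pCons_eq_0_iff one_neq_zero)
    moreover have "order a [:- b, 1:] = (if a = b then 1 else 0)"
    proof (cases "a = b")
      case True
      then show ?thesis using order_power_n_n[of b 1] by simp
    next
      case False
      then show ?thesis by (simp add: order_0I)
    qed
    ultimately show ?thesis by simp
  qed
  then have "(\<Sum>a\<in>S. real (order a (\<Prod>b\<leftarrow>b # as. [:- b, 1:])) * f a) =
      (\<Sum>a\<in>S. (if a = b then f b else 0) + real (order a (\<Prod>b\<leftarrow>as. [:- b, 1:])) * f a)"
    by (intro sum.cong refl) (auto simp: algebra_simps)
  also have "\<dots> = (\<Sum>b\<leftarrow>b # as. f b)"
    using Cons assms(1) by (simp add: sum.distrib)
  finally show ?case .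
qed simp

lemma vN_entropy_linear_factors:
  assumes "char_poly M = (\<Prod>a\<leftarrow>as. [:- a, 1:])"
  shows "vN_entropy M = (\<Sum>a\<leftarrow>as. eta (Re a))"
proof -
  have "{a. poly (char_poly M) a = 0} = set as"
    unfolding assms poly_prod_list by (auto simp: prod_list_zero_iff)
  then show ?thesis
    unfolding vN_entropy_def using sum_order_linear_factors[of "set as" as "\<lambda>a. eta (Re a)"] by (simp add: assms)
qed

text \<open>The trace of the identity, evaluated along the basis and along the coordinates.\<close>

lemma orthobasis_card:
  assumes "orthobasis V I e"
  shows "card I = card V"
proof -
  have "(of_nat (card I) :: complex) = (\<Sum>i\<in>I. \<Sum>x\<in>V. e i x * cnj (e i x))"
    using assms by (simp add: orthobasis_def orthonormal_def hip_def mult.commute)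
  also have "\<dots> = (\<Sum>x\<in>V. \<Sum>i\<in>I. e i x * cnj (e i x))"
    by (rule sum.swap)
  also have "\<dots> = of_nat (card V)"
    using assms by (simp add: orthobasis_def)
  finally show ?thesis by (simp only: of_nat_eq_iff)
qed

text \<open>The basis vectors form an invertible matrix \<open>P\<close> that conjugates the
  diagonal matrix of the \<open>p i\<close> into the given one, and similar matrices have the same
  characteristic polynomial. Since \<open>I\<close> may differ from \<open>V\<close>, eigenbases can
  be labelled by pairs of an outcome and a memory index.\<close>

lemma kent_resol:
  assumes "resol V \<sigma> I e p"
  shows "kent V \<sigma> = (\<Sum>i\<in>I. eta (p i))"
proof -
  define N where "N = card V"
  define h where "h = enum_of V"
  define k where "k = enum_of I"
  have ob: "orthobasis V I e" using assms by (simp add: resol_def)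
  have fin: "finite V" "finite I" using ob by (auto simp: orthobasis_def)
  have h: "bij_betw h {0..<N} V" using enum_of_bij[OF fin(1)] by (simp add: h_def N_def)
  have k: "bij_betw k {0..<N} I"
    using enum_of_bij[OF fin(2)] orthobasis_card[OF ob] by (simp add: k_def N_def)
  have hV: "h a \<in> V" if "a < N" for a using h that by (auto simp: bij_betw_def)
  have kI: "k a \<in> I" if "a < N" for a using k that by (auto simp: bij_betw_def)
  have heq: "h a = h b \<longleftrightarrow> a = b" if "a < N" "b < N" for a b
    using h that by (auto simp: bij_betw_def inj_on_def)
  have keq: "k a = k b \<longleftrightarrow> a = b" if "a < N" "b < N" for a b
    using k that by (auto simp: bij_betw_def inj_on_def)
  define M where "M = mat N N (\<lambda>(a, b). \<sigma> (h a) (h b))"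
  define P where "P = mat N N (\<lambda>(a, b). e (k b) (h a))"
  define Q where "Q = mat N N (\<lambda>(a, b). cnj (e (k a) (h b)))"
  define E where "E = mat N N (\<lambda>(a, b). if a = b then of_real (p (k a)) else (0::complex))"
  have sumI: "(\<Sum>c = 0..<N. g (k c)) = sum g I" for g :: "_ \<Rightarrow> complex"
    using sum.reindex_bij_betw[OF k] .
  have sumV: "(\<Sum>c = 0..<N. g (h c)) = sum g V" for g :: "_ \<Rightarrow> complex"
    using sum.reindex_bij_betw[OF h] .
  have PQ: "P * Q = 1\<^sub>m N"
  proof (rule eq_matI)
    fix a b assume "a < dim_row (1\<^sub>m N)" "b < dim_col (1\<^sub>m N)"
    then have ab: "a < N" "b < N" by auto
    then have "(P * Q) $$ (a, b) = (\<Sum>i\<in>I. e i (h a) * cnj (e i (h b)))"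
      by (simp add: P_def Q_def scalar_prod_def sumI[of "\<lambda>i. e i (h a) * cnj (e i (h b))"])
    then show "(P * Q) $$ (a, b) = 1\<^sub>m N $$ (a, b)"
      using ob ab hV heq by (simp add: orthobasis_def)
  qed (auto simp: P_def Q_def)
  have QP: "Q * P = 1\<^sub>m N"
    by (rule mat_mult_left_right_inverse[OF _ _ PQ]) (auto simp: P_def Q_def)
  have M: "M = P * E * Q"
  proof (rule eq_matI)
    fix a b assume "a < dim_row (P * E * Q)" "b < dim_col (P * E * Q)"
    then have ab: "a < N" "b < N" by (auto simp: P_def Q_def)
    have PE: "(P * E) $$ (a, c) = e (k c) (h a) * of_real (p (k c))" if "c < N" for c
      using that ab by (simp add: P_def E_def scalar_prod_def if_distrib cong: if_cong)
    have "(P * E * Q) $$ (a, b) = (\<Sum>c = 0..<N. (P * E) $$ (a, c) * Q $$ (c, b))"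
      using ab by (simp add: P_def E_def Q_def scalar_prod_def)
    also have "\<dots> = (\<Sum>c = 0..<N. of_real (p (k c)) * e (k c) (h a) * cnj (e (k c) (h b)))"
      using ab by (intro sum.cong refl) (simp add: PE, simp add: Q_def)
    also have "\<dots> = \<sigma> (h a) (h b)"
      using assms hV ab by (simp add: sumI[of "\<lambda>i. of_real (p i) * e i (h a) * cnj (e i (h b))"] resol_def)
    finally show "M $$ (a, b) = (P * E * Q) $$ (a, b)"
      using ab by (simp add: M_def)
  qed (auto simp: M_def P_def Q_def)
  have "similar_mat M E"
    unfolding similar_mat_def
    by (intro exI[of _ P] exI[of _ Q] similar_mat_witI[OF PQ QP M])
       (auto simp: M_def E_def P_def Q_def)
  then have "char_poly M = char_poly E" by (rule char_poly_similar)
  also have "\<dots> = (\<Prod>a\<leftarrow>diag_mat E. [:- a, 1:])"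
    by (rule char_poly_upper_triangular[of _ N]) (auto simp: E_def)
  finally have "vN_entropy M = (\<Sum>a\<leftarrow>diag_mat E. eta (Re a))"
    by (rule vN_entropy_linear_factors)
  also have "diag_mat E = map (\<lambda>a. of_real (p (k a))) [0..<N]"
    by (simp add: diag_mat_def E_def)
  also have "(\<Sum>a\<leftarrow>map (\<lambda>a. complex_of_real (p (k a))) [0..<N]. eta (Re a)) = (\<Sum>a = 0..<N. eta (p (k a)))"
    by (simp add: o_def interv_sum_list_conv_sum_set_nat)
  also have "\<dots> = (\<Sum>i\<in>I. eta (p i))"
    using sum.reindex_bij_betw[OF k] .
  finally show ?thesis by (simp add: kent_def M_def N_def h_def)
qed

lemma resolI:
  assumes ob: "orthobasis V I e"
    and diag: "\<And>i j. i \<in> I \<Longrightarrow> j \<in> I \<Longrightarrow> hip V (e i) (app V \<sigma> (e j)) = (if i = j then of_real (p i) else 0)"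
  shows "resol V \<sigma> I e p"
proof -
  have fin: "finite V" "finite I" using ob by (auto simp: orthobasis_def)
  have "\<sigma> x y = (\<Sum>i\<in>I. of_real (p i) * e i x * cnj (e i y))" if xy: "x \<in> V" "y \<in> V" for x y
  proof -
    have eig: "app V \<sigma> (e j) x = of_real (p j) * e j x" if "j \<in> I" for j
    proof -
      have "app V \<sigma> (e j) x = (\<Sum>i\<in>I. hip V (e i) (app V \<sigma> (e j)) * e i x)"
        by (rule orthobasis_expand[OF ob xy(1)])
      also have "\<dots> = (\<Sum>i\<in>I. if i = j then of_real (p j) * e j x else 0)"
        using that by (intro sum.cong refl) (auto simp: diag)
      finally show ?thesis using that fin by simp
    qed
    have "(\<Sum>i\<in>I. of_real (p i) * e i x * cnj (e i y)) = (\<Sum>i\<in>I. app V \<sigma> (e i) x * cnj (e i y))"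
      by (simp add: eig)
    also have "\<dots> = (\<Sum>z\<in>V. \<sigma> x z * (\<Sum>i\<in>I. e i z * cnj (e i y)))"
      unfolding app_def sum_distrib_right sum_distrib_left by (subst sum.swap) (simp add: mult_ac)
    also have "\<dots> = (\<Sum>z\<in>V. if z = y then \<sigma> x y else 0)"
      using ob xy by (intro sum.cong refl) (auto simp: orthobasis_def)
    finally show ?thesis using fin xy by simp
  qed
  then show ?thesis using ob by (simp add: resol_def)
qed

text \<open>A root of the characteristic polynomial gives an eigenvector, and a phase factor makes
  \<open>v x0\<close> real. The reflection used in the spectral theorem requires this: it sends the
  coordinate vector of \<open>x0\<close> to \<open>v\<close> only if their inner product is
  real.\<close>

lemma eigenvector_exists:
  fixes \<sigma> :: "'v \<Rightarrow> 'v \<Rightarrow> complex"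
  assumes fin: "finite V" and x0: "x0 \<in> V"
  obtains l v where "nsq V v = 1" "v x0 \<in> \<real>" "\<And>x. x \<in> V \<Longrightarrow> app V \<sigma> v x = l * v x"
proof -
  define N where "N = card V"
  define h where "h = enum_of V"
  have N: "N > 0" using fin x0 by (auto simp: N_def card_gt_0_iff)
  have h: "bij_betw h {0..<N} V" using enum_of_bij[OF fin] by (simp add: h_def N_def)
  define M where "M = mat N N (\<lambda>(a, b). \<sigma> (h a) (h b))"
  have M: "M \<in> carrier_mat N N" by (simp add: M_def)
  have "\<not> constant (poly (char_poly M))"
    using degree_monic_char_poly[OF M] N by (simp add: constant_degree)
  then obtain l where "poly (char_poly M) l = 0"
    using fundamental_theorem_of_algebra by blast
  then obtain y where y: "y \<in> carrier_vec N" "y \<noteq> 0\<^sub>v N" "M *\<^sub>v y = l \<cdot>\<^sub>v y"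
    using eigenvalue_root_char_poly[OF M] M by (auto simp: eigenvalue_def eigenvector_def)
  define g where "g = the_inv_into {0..<N} h"
  have gh: "g (h a) = a" if "a < N" for a
    using h that unfolding g_def by (intro the_inv_into_f_f) (auto simp: bij_betw_def)
  have hg: "h (g x) = x \<and> g x < N" if "x \<in> V" for x
    using h that gh by (auto simp: bij_betw_def image_iff)
  define w where "w x = y $ g x" for x
  have w: "app V \<sigma> w x = l * w x" if "x \<in> V" for x
  proof -
    have "app V \<sigma> w x = (\<Sum>a = 0..<N. \<sigma> x (h a) * w (h a))"
      unfolding app_def by (rule sum.reindex_bij_betw[OF h, symmetric])
    also have "\<dots> = (M *\<^sub>v y) $ g x"
      using hg[OF that] y(1) by (auto simp: M_def scalar_prod_def w_def gh intro!: sum.cong)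
    finally show ?thesis using y hg[OF that] by (simp add: w_def)
  qed
  have "nsq V w \<noteq> 0"
  proof
    assume "nsq V w = 0"
    then have "w x = 0" if "x \<in> V" for x using that fin by (simp add: nsq_def sum_nonneg_eq_0_iff)
    moreover have "h a \<in> V" if "a < N" for a using h that by (auto simp: bij_betw_def)
    ultimately have "y $ a = 0" if "a < N" for a using that gh[OF that] unfolding w_def by metis
    then show False using y by (auto simp: vec_eq_iff)
  qed
  then have pos: "nsq V w > 0" using nsq_nonneg[of V w] by linarith
  define \<theta> where "\<theta> = (if w x0 = 0 then 1 else cnj (w x0) / of_real (cmod (w x0)))"
  have \<theta>: "cmod \<theta> = 1" by (simp add: \<theta>_def norm_divide)
  have \<theta>': "\<theta> * w x0 \<in> \<real>"
  proof (cases "w x0 = 0")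
    case False
    have "\<theta> * w x0 = of_real ((cmod (w x0))\<^sup>2) / of_real (cmod (w x0))"
      using False by (simp add: \<theta>_def cmod_sq del: of_real_power)
    then show ?thesis by (simp add: Reals_divide del: of_real_power)
  qed simp
  let ?c = "\<theta> / of_real (sqrt (nsq V w))"
  show ?thesis
  proof (rule that[of "\<lambda>x. ?c * w x" l])
    have "nsq V (\<lambda>x. ?c * w x) = (cmod ?c)\<^sup>2 * nsq V w"
      by (rule nsq_scale)
    also have "(cmod ?c)\<^sup>2 = 1 / nsq V w"
      using \<theta> pos by (simp add: norm_divide power_divide)
    finally show "nsq V (\<lambda>x. ?c * w x) = 1" using pos by simp
    show "?c * w x0 \<in> \<real>"
      using Reals_divide[OF \<theta>' Reals_of_real[of "sqrt (nsq V w)"]] by simp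
    fix x assume "x \<in> V"
    have "app V \<sigma> (\<lambda>x. ?c * w x) x = ?c * app V \<sigma> w x"
      by (simp add: app_def sum_distrib_left mult_ac)
    then show "app V \<sigma> (\<lambda>x. ?c * w x) x = l * (?c * w x)"
      using w[OF \<open>x \<in> V\<close>] by simp
  qed
qed

lemma hip_app_hermitian:
  assumes "\<And>x y. x \<in> V \<Longrightarrow> y \<in> V \<Longrightarrow> \<sigma> x y = cnj (\<sigma> y x)"
  shows "hip V (app V \<sigma> f) g = hip V f (app V \<sigma> g)"
proof -
  have "hip V (app V \<sigma> f) g = hip V (app V (adj \<sigma>) f) g"
    by (intro hip_cong) (auto simp: app_def adj_def assms[symmetric] intro!: sum.cong)
  then show ?thesis by (simp add: hip_adj)
qed

text \<open>The Householder reflection along \<open>v - \<delta>\<^sub>x\<close> exchanges a unit eigenvector \<open>v\<close> with the coordinate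
  vector \<open>\<delta>\<^sub>x\<close>, so the operator is block diagonal in the reflected coordinates.\<close>
lemma spectral_theorem:
  fixes \<sigma> :: "'v \<Rightarrow> 'v \<Rightarrow> complex"
  assumes "finite V" "\<And>x y. x \<in> V \<Longrightarrow> y \<in> V \<Longrightarrow> \<sigma> x y = cnj (\<sigma> y x)"
  shows "\<exists>e p. resol V \<sigma> V e p"
  using assms
proof (induction V arbitrary: \<sigma> rule: finite_induct)
  case empty
  show ?case by (auto simp: resol_def orthobasis_def orthonormal_def)
next
  case (insert x0 F)
  define V where "V = insert x0 F"
  have V: "finite V" "x0 \<in> V" "F \<subseteq> V" "finite F" "x0 \<notin> F" using insert.hyps by (auto simp: V_def)
  have herm: "\<sigma> x y = cnj (\<sigma> y x)" if "x \<in> V" "y \<in> V" for x y using insert.prems that unfolding V_def by blast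
  obtain l v where v: "nsq V v = 1" "v x0 \<in> \<real>" and eig: "\<And>x. x \<in> V \<Longrightarrow> app V \<sigma> v x = l * v x"
    using eigenvector_exists[OF V(1,2), of \<sigma>] by blast
  define \<delta> where "\<delta> z = (\<lambda>x. if x = z then 1 else (0::complex))" for z :: 'v
  have \<delta>: "hip V f (\<delta> z) = cnj (f z)" "hip V (\<delta> z) f = f z" if "z \<in> V" for f z
    using nsq_delta(2)[OF V(1) that, of f] hip_cnj[of V f "\<delta> z"] by (simp_all add: \<delta>_def) 
  define w where "w = (\<lambda>x. v x - \<delta> x0 x)"
  \<comment> \<open>If \<open>v\<close> already is the coordinate vector, then \<open>w\<close>
    vanishes and the reflection must be the identity, hence the value 0.\<close>
  define c where "c = (if nsq V w = 0 then 0 else 2 / complex_of_real (nsq V w))"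
  define H where "H f = (\<lambda>x. f x - c * hip V w f * w x)" for f
  have cw: "c * hip V w w = (if nsq V w = 0 then 0 else 2)" by (simp add: c_def hip_self)
  have cc: "c * (c * hip V w w) = c * 2" by (simp add: cw) (simp add: c_def)
  have cr: "cnj c = c" by (simp add: c_def)
  have H_iso: "hip V (H f) (H g) = hip V f g" for f g
  proof -
    have r: "hip V f (\<lambda>x. a * w x) = a * hip V f w" "hip V (\<lambda>x. a * w x) f = cnj a * hip V w f" for f a
      by (simp_all add: hip_def sum_distrib_left mult_ac)
    have "hip V (H f) (H g) = hip V f g - c * (hip V w g * hip V f w) - c * (hip V f w * hip V w g)
        + c * (c * hip V w w) * (hip V f w * hip V w g)"
      unfolding H_def hip_diff_left hip_diff_right r complex_cnj_mult cr hip_cnj by (simp add: algebra_simps)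
    then show ?thesis unfolding cc by (simp add: algebra_simps)
  qed
  have H\<delta>: "H (\<delta> x0) x = v x" if "x \<in> V" for x
  proof (cases "nsq V w = 0")
    case True
    then have "w x = 0" using V(1) that by (simp add: nsq_def sum_nonneg_eq_0_iff)
    then show ?thesis by (simp add: H_def w_def)
  next
    case False
    have vr: "cnj (v x0) = v x0" using v(2) by (simp add: Reals_cnj_iff)
    have "hip V w w = 2 - 2 * v x0"
      unfolding w_def hip_diff_left hip_diff_right using \<delta>[OF V(2)] v(1) vr nsq_delta(1)[OF V(1,2)] by (simp add: hip_self \<delta>_def)
    moreover have "hip V w (\<delta> x0) = v x0 - 1"
      unfolding w_def hip_diff_left using \<delta>[OF V(2)] vr by (simp add: \<delta>_def)
    ultimately have "2 * hip V w (\<delta> x0) = - hip V w w" by (simp only:) (simp add: algebra_simps)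
    then have "2 * (c * hip V w (\<delta> x0)) = - (c * hip V w w)" by (metis mult.left_commute mult_minus_right)
    then have "c * hip V w (\<delta> x0) = -1" using cw False by simp
    then show ?thesis by (simp add: H_def w_def)
  qed
  have sa: "hip V (app V \<sigma> f) g = hip V f (app V \<sigma> g)" for f g
    by (rule hip_app_hermitian) (rule herm)
  \<comment> \<open>The compression of \<open>\<sigma>\<close> to the orthogonal complement of
    \<open>v\<close>, written in reflected coordinates. It is Hermitian on the smaller set
    \<open>F\<close>, so the induction hypothesis diagonalises it.\<close>
  define \<tau> where "\<tau> x y = hip V (H (\<delta> x)) (app V \<sigma> (H (\<delta> y)))" for x y
  have "\<tau> x y = cnj (\<tau> y x)" for x y
    unfolding \<tau>_def hip_cnj by (rule sa[symmetric])
  then obtain e p where ep: "resol F \<tau> F e p" using insert.IH by blast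
  have obe: "orthobasis F F e" using ep by (simp add: resol_def)
  \<comment> \<open>The eigenvectors on \<open>F\<close> are extended by 0 at \<open>x0\<close> and
    then reflected, which makes them orthogonal to \<open>v\<close>.\<close>
  define e0 where "e0 i = (\<lambda>x. \<Sum>z\<in>F. e i z * \<delta> z x)" for i
  define E where "E i = (if i = x0 then v else H (e0 i))" for i
  have e0F: "e0 i x = (if x \<in> F then e i x else 0)" for i x
    using V(4) by (simp add: e0_def \<delta>_def if_distrib cong: if_cong)
  have HE: "H (e0 i) = (\<lambda>x. \<Sum>z\<in>F. e i z * H (\<delta> z) x)" for i
    unfolding H_def e0_def hip_sum_right
    by (rule ext) (simp only: right_diff_distrib sum_subtractf sum_distrib_left sum_distrib_right mult_ac)
  have e0: "hip V (e0 i) (e0 j) = hip F (e i) (e j)" for i j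
  proof -
    have "hip V (e0 i) (e0 j) = (\<Sum>x\<in>F. cnj (e0 i x) * e0 j x)"
      unfolding hip_def using V by (intro sum.mono_neutral_right) (auto simp: e0F)
    then show ?thesis by (simp add: hip_def e0F)
  qed
  have vE: "hip V v (H (e0 i)) = 0" for i
  proof -
    have "hip V v (H (e0 i)) = hip V (H (\<delta> x0)) (H (e0 i))"
      by (intro hip_cong) (simp_all add: H\<delta>)
    then show ?thesis using \<delta>(2)[OF V(2)] V(5) by (simp add: H_iso e0F)
  qed
  have Ev: "hip V (H (e0 i)) v = 0" for i
    using vE[of i] by (metis hip_cnj complex_cnj_zero)
  have mem: "i \<in> V \<longleftrightarrow> i = x0 \<or> i \<in> F" for i by (auto simp: V_def)
  have vv: "hip V v v = 1" using v(1) by (simp add: hip_self)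
  have onE: "orthonormal V V E"
    unfolding orthonormal_def
  proof (intro ballI)
    fix i j assume "i \<in> V" "j \<in> V"
    then show "hip V (E i) (E j) = (if i = j then 1 else 0)"
      using obe vE Ev vv by (auto simp: E_def mem H_iso e0 orthobasis_def orthonormal_def)
  qed
  have obE: "orthobasis V V E"
    by (rule orthonormal_imp_orthobasis[OF V(1) V(1) onE refl])
  have av: "hip V f (app V \<sigma> v) = l * hip V f v" for f
    by (simp add: hip_def eig sum_distrib_left mult_ac)
  have "l = hip V v (app V \<sigma> v)" using v(1) by (simp add: av hip_self)
  also have "\<dots> = cnj l"
    using sa[of v v] hip_cnj[of V v "app V \<sigma> v"] av[of v] v(1) by (simp add: hip_self)
  finally have lr: "l = of_real (Re l)" by (simp add: complex_eq_iff)
  have block: "hip V (H (e0 i)) (app V \<sigma> (H (e0 j))) = (if i = j then of_real (p i) else 0)" if ij: "i \<in> F" "j \<in> F" for i j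
  proof -
    have A: "app V \<sigma> (H (e0 j)) = (\<lambda>x. \<Sum>z\<in>F. e j z * app V \<sigma> (H (\<delta> z)) x)"
      unfolding HE app_def sum_distrib_left by (rule ext, subst sum.swap) (simp add: mult_ac)
    have "hip V (H (e0 i)) (app V \<sigma> (H (e0 j))) = (\<Sum>z\<in>F. e j z * (\<Sum>y\<in>F. cnj (e i y) * \<tau> y z))"
      unfolding A hip_sum_right unfolding HE hip_sum_left \<tau>_def ..
    also have "\<dots> = hip F (e i) (app F \<tau> (e j))"
      unfolding hip_def app_def sum_distrib_left by (subst sum.swap) (simp add: mult_ac)
    also have "\<dots> = (\<Sum>k\<in>F. of_real (p k) * hip F (e i) (e k) * hip F (e k) (e j))"
    proof -
      have "app F \<tau> (e j) x = (\<Sum>k\<in>F. (of_real (p k) * hip F (e k) (e j)) * e k x)" if "x \<in> F" for x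
      proof -
        have "app F \<tau> (e j) x = (\<Sum>y\<in>F. \<Sum>k\<in>F. of_real (p k) * e k x * (cnj (e k y) * e j y))"
          using ep that by (simp add: app_def resol_def sum_distrib_left sum_distrib_right mult_ac)
        then show ?thesis
          unfolding hip_def sum_distrib_left sum_distrib_right by (subst (asm) sum.swap) (simp add: mult_ac)
      qed
      then have "hip F (e i) (app F \<tau> (e j)) = hip F (e i) (\<lambda>x. \<Sum>k\<in>F. (of_real (p k) * hip F (e k) (e j)) * e k x)"
        by (intro hip_cong) auto
      then show ?thesis by (simp only: hip_sum_right) (simp add: mult_ac)
    qed
    also have "\<dots> = (\<Sum>k\<in>F. if k = j then (if i = j then of_real (p i) else 0) else 0)"
      using obe ij by (intro sum.cong refl) (auto simp: orthobasis_def orthonormal_def)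
    finally show ?thesis using ij V(4) by simp
  qed
  have "resol V \<sigma> V E (p(x0 := Re l))"
  proof (rule resolI[OF obE])
    fix i j assume ij: "i \<in> V" "j \<in> V"
    have "hip V v (app V \<sigma> (H (e0 j))) = 0" for j
      using sa[of v "H (e0 j)"] av[of "H (e0 j)"] Ev[of j]
      by (metis hip_cnj complex_cnj_zero mult_zero_right)
    then show "hip V (E i) (app V \<sigma> (E j)) = (if i = j then of_real ((p(x0 := Re l)) i) else 0)"
      using ij block lr[symmetric] vv V(5) by (auto simp: E_def mem av Ev)
  qed
  then show ?case by (auto simp: V_def)
qed

lemma resol_transport:
  assumes h: "bij_betw h V' V" and r: "resol V \<sigma> I e p"
  shows "resol V' (\<lambda>x y. \<sigma> (h x) (h y)) I (\<lambda>i x. e i (h x)) p"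
proof -
  have inj: "h x = h y \<longleftrightarrow> x = y" and mem: "h x \<in> V" if "x \<in> V'" "y \<in> V'" for x y
    using h that by (auto simp: bij_betw_def inj_on_def)
  have "finite V'" using r bij_betw_finite[OF h] by (simp add: resol_def orthobasis_def)
  moreover have "hip V' (\<lambda>x. e i (h x)) (\<lambda>x. e j (h x)) = hip V (e i) (e j)" for i j
    unfolding hip_def by (rule sum.reindex_bij_betw[OF h])
  ultimately show ?thesis
    using r inj mem by (simp add: resol_def orthobasis_def orthonormal_def)
qed

text \<open>A spectral resolution can be transported along \<open>h\<close> with the same
  eigenvalues; hermiticity guarantees that there is one.\<close>

lemma kent_bij:
  assumes "bij_betw h V' V" "finite V" "\<And>x y. x \<in> V \<Longrightarrow> y \<in> V \<Longrightarrow> \<sigma> x y = cnj (\<sigma> y x)"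
  shows "kent V' (\<lambda>x y. \<sigma> (h x) (h y)) = kent V \<sigma>"
proof -
  have "\<exists>e p. resol V \<sigma> V e p"
    by (rule spectral_theorem[OF assms(2)]) (rule assms(3))
  then obtain e p where r: "resol V \<sigma> V e p" by blast
  show ?thesis using kent_resol[OF r] kent_resol[OF resol_transport[OF assms(1) r]] by simp
qed

subsection \<open>Gram kernels\<close>

text \<open>The sum of the rank-one operators of the vectors \<open>F z\<close>, that is, the state
  left after tracing out a system with basis \<open>Z\<close>. In this form a state is positive by
  construction.\<close>

definition gram :: "'z set \<Rightarrow> ('z \<Rightarrow> 'v \<Rightarrow> complex) \<Rightarrow> 'v \<Rightarrow> 'v \<Rightarrow> complex" where
  "gram Z F = (\<lambda>x y. \<Sum>z\<in>Z. F z x * cnj (F z y))"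

lemma gram_hermitian: "gram Z F x y = cnj (gram Z F y x)"
  by (simp add: gram_def mult.commute)

lemma gram_form:
  assumes "resol V (gram Z F) I e p"
  shows "(\<Sum>z\<in>Z. (cmod (hip V y (F z)))\<^sup>2) = (\<Sum>i\<in>I. p i * (cmod (hip V y (e i)))\<^sup>2)"
proof -
  have form: "(\<Sum>x\<in>V. \<Sum>x'\<in>V. cnj (y x) * (\<Sum>k\<in>K. c k * (G k x * cnj (G k x'))) * y x') =
      (\<Sum>k\<in>K. c k * of_real ((cmod (hip V y (G k)))\<^sup>2))" for K :: "'k set" and c G
  proof -
    have "(\<Sum>k\<in>K. c k * of_real ((cmod (hip V y (G k)))\<^sup>2)) = (\<Sum>k\<in>K. c k * (hip V y (G k) * hip V (G k) y))"
      by (simp add: cmod_sq hip_cnj mult.commute del: of_real_power)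
    also have "\<dots> = (\<Sum>k\<in>K. \<Sum>x\<in>V. \<Sum>x'\<in>V. cnj (y x) * (c k * (G k x * cnj (G k x'))) * y x')"
      by (simp add: hip_def sum_product sum_distrib_left mult_ac)
    also have "\<dots> = (\<Sum>x\<in>V. \<Sum>x'\<in>V. \<Sum>k\<in>K. cnj (y x) * (c k * (G k x * cnj (G k x'))) * y x')"
      by (subst sum.swap, rule sum.cong[OF refl], rule sum.swap)
    finally show ?thesis by (simp add: sum_distrib_left sum_distrib_right)
  qed
  have "complex_of_real (\<Sum>z\<in>Z. (cmod (hip V y (F z)))\<^sup>2) = (\<Sum>x\<in>V. \<Sum>x'\<in>V. cnj (y x) * gram Z F x x' * y x')"
    using form[where K1 = Z and c1 = "\<lambda>_. 1" and G1 = F] by (simp add: gram_def)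
  also have "\<dots> = (\<Sum>x\<in>V. \<Sum>x'\<in>V. cnj (y x) * (\<Sum>i\<in>I. of_real (p i) * (e i x * cnj (e i x'))) * y x')"
    using assms by (intro sum.cong refl) (simp add: resol_def mult.assoc)
  also have "\<dots> = complex_of_real (\<Sum>i\<in>I. p i * (cmod (hip V y (e i)))\<^sup>2)"
    using form[where K1 = I and c1 = "\<lambda>i. of_real (p i)" and G1 = e] by simp
  finally show ?thesis unfolding of_real_eq_iff .
qed

lemma gram_eigenvalue:
  assumes "resol V (gram Z F) I e p" "i \<in> I"
  shows "p i = (\<Sum>z\<in>Z. (cmod (hip V (e i) (F z)))\<^sup>2)"
proof -
  have "(\<Sum>j\<in>I. p j * (cmod (hip V (e i) (e j)))\<^sup>2) = (\<Sum>j\<in>I. if j = i then p i else 0)"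
    using assms by (intro sum.cong refl) (auto simp: resol_def orthobasis_def orthonormal_def)
  also have "\<dots> = p i" using assms by (simp add: resol_def orthobasis_def)
  finally show ?thesis using gram_form[OF assms(1), of "e i"] by simp
qed

lemma gram_trace:
  assumes "resol V (gram Z F) I e p"
  shows "(\<Sum>i\<in>I. p i) = (\<Sum>z\<in>Z. nsq V (F z))"
proof -
  have ob: "orthobasis V I e" using assms by (simp add: resol_def)
  have "(\<Sum>i\<in>I. p i) = (\<Sum>i\<in>I. \<Sum>z\<in>Z. (cmod (hip V (e i) (F z)))\<^sup>2)"
    by (simp add: gram_eigenvalue[OF assms])
  also have "\<dots> = (\<Sum>z\<in>Z. nsq V (F z))"
    by (subst sum.swap) (simp add: parseval[OF ob])
  finally show ?thesis .
qed

lemma gram_resol: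
  assumes "finite V"
  obtains e p where "resol V (gram Z F) V e p" "\<And>i. i \<in> V \<Longrightarrow> p i \<ge> 0"
proof -
  obtain e p where r: "resol V (gram Z F) V e p"
    using spectral_theorem[OF assms, of "gram Z F"] gram_hermitian[of Z F] by blast
  moreover have "p i \<ge> 0" if "i \<in> V" for i
    using gram_eigenvalue[OF r that] by (simp add: sum_nonneg)
  ultimately show ?thesis by (rule that)
qed

subsection \<open>Uncertainty relations for Gram kernels\<close>

text \<open>The partial inner product with \<open>y\<close> on the factor \<open>A\<close>. For a
  basis vector of a measurement it is the unnormalised amplitude that remains after the
  corresponding outcome.\<close>

definition par :: "'a set \<Rightarrow> ('a \<Rightarrow> complex) \<Rightarrow> ('a \<times> 'w \<Rightarrow> complex) \<Rightarrow> 'w \<Rightarrow> complex" where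
  "par A y g = (\<lambda>w. hip A y (\<lambda>a. g (a, w)))"

lemma hip_par_swap: "hip B y (par A x g) = hip A x (\<lambda>a. hip B y (\<lambda>b. g (a, b)))"
  unfolding par_def hip_def sum_distrib_left by (subst sum.swap) (simp add: mult_ac)

lemma hip_tensor: "hip (A \<times> B) (\<lambda>(a, b). x a * y b) g = hip B y (par A x g)"
  unfolding hip_par_swap hip_times by (simp add: hip_def sum_distrib_left mult_ac)

lemma hip_tensor_tensor:
  "hip (A \<times> B) (\<lambda>(a, b). x a * y b) (\<lambda>(a, b). x' a * y' b) = hip A x x' * hip B y y'"
  unfolding hip_tensor by (simp add: par_def hip_def sum_distrib_left sum_distrib_right mult_ac)

text \<open>Parseval's identity on \<open>A\<close>: the conditional states add up to the reduced
  state, whichever basis is measured.\<close>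

lemma sum_par:
  assumes "orthobasis A K \<psi>"
  shows "(\<Sum>k\<in>K. (cmod (hip B y (par A (\<psi> k) g)))\<^sup>2) = (\<Sum>a\<in>A. (cmod (hip B y (\<lambda>b. g (a, b))))\<^sup>2)"
  unfolding hip_par_swap parseval[OF assms] by (simp add: nsq_def)

text \<open>Replacing coordinates on \<open>A\<close> by outcome labels in \<open>K\<close> is
  unitary. In the new coordinates, measuring \<open>\<psi>\<close> is pinching to the blocks
  labelled by \<open>k\<close>.\<close>

lemma hip_rotate:
  assumes "orthobasis A K \<psi>"
  shows "hip (K \<times> B) (\<lambda>(k, b). par A (\<psi> k) f b) (\<lambda>(k, b). par A (\<psi> k) g b) = hip (A \<times> B) f g"
proof -
  have "hip (K \<times> B) (\<lambda>(k, b). par A (\<psi> k) f b) (\<lambda>(k, b). par A (\<psi> k) g b) =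
      (\<Sum>b\<in>B. \<Sum>k\<in>K. hip A (\<lambda>a. f (a, b)) (\<psi> k) * hip A (\<psi> k) (\<lambda>a. g (a, b)))"
    unfolding hip_times by (subst sum.swap[symmetric]) (simp add: hip_def[of B] par_def hip_cnj)
  also have "\<dots> = (\<Sum>b\<in>B. hip A (\<lambda>a. f (a, b)) (\<lambda>a. g (a, b)))"
    by (intro sum.cong refl hip_parseval[OF assms, symmetric])
  also have "\<dots> = hip (A \<times> B) f g"
    unfolding hip_times[of A B] unfolding hip_def by (rule sum.swap)
  finally show ?thesis .
qed

lemma nsq_rotate:
  assumes "orthobasis A K \<psi>"
  shows "(\<Sum>k\<in>K. nsq B (par A (\<psi> k) g)) = nsq (A \<times> B) g"
proof -
  have "complex_of_real (nsq (K \<times> B) (\<lambda>(k, b). par A (\<psi> k) g b)) = of_real (nsq (A \<times> B) g)"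
    using hip_rotate[OF assms, of B g g] by (simp only: hip_self)
  then show ?thesis unfolding of_real_eq_iff by (simp add: nsq_times[of K])
qed

lemma eta_ln: "x \<ge> 0 \<Longrightarrow> eta x = - (x * ln x) / ln 2"
  by (simp add: eta_def log_def)

lemma gram_resol_family:
  assumes "finite V"
  obtains e p where "\<And>k. resol V (gram Z (F k)) V (e k) (p k)" "\<And>k i. i \<in> V \<Longrightarrow> p k i \<ge> 0"
proof -
  have "\<forall>k. \<exists>ep. resol V (gram Z (F k)) V (fst ep) (snd ep) \<and> (\<forall>i\<in>V. snd ep i \<ge> 0)"
  proof
    fix k
    obtain e p where "resol V (gram Z (F k)) V e p" "\<And>i. i \<in> V \<Longrightarrow> p i \<ge> 0"
      using gram_resol[OF assms, of Z "F k"] by blast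
    then show "\<exists>ep. resol V (gram Z (F k)) V (fst ep) (snd ep) \<and> (\<forall>i\<in>V. snd ep i \<ge> 0)"
      by (intro exI[of _ "(e, p)"]) simp
  qed
  from choice[OF this] obtain ep where
    "\<forall>k. resol V (gram Z (F k)) V (fst (ep k)) (snd (ep k)) \<and> (\<forall>i\<in>V. snd (ep k) i \<ge> 0)" ..
  then show ?thesis using that[of "\<lambda>k. fst (ep k)" "\<lambda>k. snd (ep k)"] by blast
qed

text \<open>Monotonicity of relative entropy under the pinching by \<open>\<psi>\<close>, applied to
  the joint state and to the state obtained from it by measuring \<open>\<phi>\<close>. Block
  \<open>k\<close> of the latter is the mixture of the conditional states of outcomes
  \<open>l\<close> with the overlaps as coefficients, hence at most \<open>c\<close> times the
  memory state.\<close>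

lemma bipartite_uncertainty:
  fixes \<Omega> :: "'z \<Rightarrow> 'a \<times> 'b \<Rightarrow> complex"
  assumes B: "finite B" and \<psi>: "orthobasis A K \<psi>" and \<phi>: "orthobasis A L \<phi>"
    and c: "\<And>k l. k \<in> K \<Longrightarrow> l \<in> L \<Longrightarrow> (cmod (hip A (\<psi> k) (\<phi> l)))\<^sup>2 \<le> c" and c0: "c > 0"
    and unit: "(\<Sum>z\<in>Z. nsq (A \<times> B) (\<Omega> z)) = 1"
  shows "- log 2 c + kent (A \<times> B) (gram Z \<Omega>) + kent B (gram (A \<times> Z) (\<lambda>(a, z) b. \<Omega> z (a, b)))
    \<le> (\<Sum>k\<in>K. kent B (gram Z (\<lambda>z. par A (\<psi> k) (\<Omega> z)))) + (\<Sum>l\<in>L. kent B (gram Z (\<lambda>z. par A (\<phi> l) (\<Omega> z))))"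
proof -
  have fin: "finite A" "finite K" "finite L" using \<psi> \<phi> by (auto simp: orthobasis_def)
  obtain E p where E: "resol (A \<times> B) (gram Z \<Omega>) (A \<times> B) E p" and p: "\<And>i. i \<in> A \<times> B \<Longrightarrow> p i \<ge> 0"
    using gram_resol[of "A \<times> B" Z \<Omega>] fin B by blast
  obtain f t where f: "resol B (gram (A \<times> Z) (\<lambda>(a, z) b. \<Omega> z (a, b))) B f t" and t: "\<And>i. i \<in> B \<Longrightarrow> t i \<ge> 0"
    using gram_resol[of B "A \<times> Z" "\<lambda>(a, z) b. \<Omega> z (a, b)"] B by blast
  obtain u r where u: "\<And>k. resol B (gram Z (\<lambda>z. par A (\<psi> k) (\<Omega> z))) B (u k) (r k)" and r: "\<And>k i. i \<in> B \<Longrightarrow> r k i \<ge> 0"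
    using gram_resol_family[of B Z "\<lambda>k z. par A (\<psi> k) (\<Omega> z)"] B by blast
  obtain v q where v: "\<And>l. resol B (gram Z (\<lambda>z. par A (\<phi> l) (\<Omega> z))) B (v l) (q l)" and q: "\<And>k i. i \<in> B \<Longrightarrow> q k i \<ge> 0"
    using gram_resol_family[of B Z "\<lambda>k z. par A (\<phi> k) (\<Omega> z)"] B by blast
  \<comment> \<open>Eigenvectors of the state measured by \<open>\<phi>\<close>: an outcome vector
    on \<open>A\<close> tensored with an eigenvector of the conditional memory state, with
    eigenvalue \<open>q l b\<close>.\<close>
  define T where "T j = (\<lambda>(a, b). \<phi> (fst j) a * v (fst j) (snd j) b)" for j
  define rot where "rot g = (\<lambda>(k, b). par A (\<psi> k) g b)" for g :: "'a \<times> 'b \<Rightarrow> complex"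
  have rot: "hip (K \<times> B) (rot g) (rot h) = hip (A \<times> B) g h" for g h
    unfolding rot_def by (rule hip_rotate[OF \<psi>])
  have obE: "orthobasis (A \<times> B) (A \<times> B) E" and obf: "orthobasis B B f"
    and obu: "orthobasis B B (u k)" and obv: "orthobasis B B (v l)" for k l
    using E f u v by (auto simp: resol_def)
  have onE: "orthonormal (K \<times> B) (A \<times> B) (\<lambda>i. rot (E i))"
    using obE by (simp add: orthonormal_def orthobasis_def rot)
  have onT: "orthonormal (K \<times> B) (L \<times> B) (\<lambda>j. rot (T j))"
    using \<phi> obv by (auto simp: orthonormal_def orthobasis_def rot T_def hip_tensor_tensor)
  have obT: "orthobasis (K \<times> B) (L \<times> B) (\<lambda>j. rot (T j))"
    using orthobasis_card[OF \<psi>] orthobasis_card[OF \<phi>] fin B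
    by (intro orthonormal_imp_orthobasis onT) (auto simp: card_cartesian_product)
  have rotT: "rot (T j) (k, b) = hip A (\<psi> k) (\<phi> (fst j)) * v (fst j) (snd j) b" for j k b
    by (simp add: rot_def T_def par_def hip_def sum_distrib_left sum_distrib_right mult_ac)
  have hip_rotT: "hip B y (\<lambda>b. rot (T j) (k, b)) = hip A (\<psi> k) (\<phi> (fst j)) * hip B y (v (fst j) (snd j))" for y j k
    by (simp only: rotT hip_scale_right)
  have pE: "(\<Sum>i\<in>A \<times> B. p i * (cmod (hip (A \<times> B) y (E i)))\<^sup>2) = (\<Sum>z\<in>Z. (cmod (hip (A \<times> B) y (\<Omega> z)))\<^sup>2)" for y
    using gram_form[OF E] by simp
  have t_eq: "t b = (\<Sum>k\<in>K. \<Sum>a\<in>B. r k a * (cmod (hip B (u k a) (f b)))\<^sup>2)" if "b \<in> B" for b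
  proof -
    have "(\<Sum>k\<in>K. \<Sum>a\<in>B. r k a * (cmod (hip B (u k a) (f b)))\<^sup>2) =
        (\<Sum>k\<in>K. \<Sum>z\<in>Z. (cmod (hip B (f b) (par A (\<psi> k) (\<Omega> z))))\<^sup>2)"
      by (simp add: gram_form[OF u] hip_cmod_commute[of B _ "f b"])
    also have "\<dots> = (\<Sum>z\<in>Z. \<Sum>a\<in>A. (cmod (hip B (f b) (\<lambda>b. \<Omega> z (a, b))))\<^sup>2)"
      by (subst sum.swap) (simp add: sum_par[OF \<psi>])
    also have "\<dots> = t b"
      unfolding gram_eigenvalue[OF f that] by (subst sum.swap) (simp add: sum.cartesian_product split_beta)
    finally show ?thesis ..
  qed
  \<comment> \<open>The measured state is a pinching of the joint state, so the two agree on the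
    diagonal of its eigenbasis. Hence the cross term of the relative entropy reduces to the entropy
    of the measured state.\<close>
  have q_eq: "(\<Sum>i\<in>A \<times> B. p i * (cmod (hip (K \<times> B) (rot (E i)) (rot (T (l, b)))))\<^sup>2) = q l b"
    if "b \<in> B" for l b
    unfolding rot hip_cmod_commute[of _ "E _"] pE gram_eigenvalue[OF v that] by (simp add: T_def hip_tensor)
  have "(\<Sum>j\<in>L \<times> B. (\<Sum>i\<in>A \<times> B. p i * (cmod (hip (K \<times> B) (rot (E i)) (rot (T j))))\<^sup>2) * ln (q (fst j) (snd j)))
      - (\<Sum>i\<in>A \<times> B. p i * ln (p i))
    \<le> (\<Sum>k\<in>K. (\<Sum>b\<in>B. (\<Sum>a\<in>B. r k a * (cmod (hip B (u k a) (f b)))\<^sup>2) * ln (c * t b)) - (\<Sum>a\<in>B. r k a * ln (r k a)))"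
  proof (rule block_entropy[OF fin(2) B _ onE obT p _ obu obf])
    fix k y assume k: "k \<in> K"
    have "(\<Sum>i\<in>A \<times> B. p i * (cmod (hip B y (\<lambda>b. rot (E i) (k, b))))\<^sup>2) =
        (\<Sum>i\<in>A \<times> B. p i * (cmod (hip (A \<times> B) (\<lambda>(a, b). \<psi> k a * y b) (E i)))\<^sup>2)"
      by (simp add: rot_def hip_tensor)
    also have "\<dots> = (\<Sum>b\<in>B. r k b * (cmod (hip B y (u k b)))\<^sup>2)"
      unfolding pE by (simp add: hip_tensor gram_form[OF u])
    finally show "(\<Sum>i\<in>A \<times> B. p i * (cmod (hip B y (\<lambda>b. rot (E i) (k, b))))\<^sup>2)
        \<le> (\<Sum>b\<in>B. r k b * (cmod (hip B y (u k b)))\<^sup>2)" by simp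
    have "(\<Sum>j\<in>L \<times> B. q (fst j) (snd j) * (cmod (hip B y (\<lambda>b. rot (T j) (k, b))))\<^sup>2) =
        (\<Sum>l\<in>L. (cmod (hip A (\<psi> k) (\<phi> l)))\<^sup>2 * (\<Sum>b\<in>B. q l b * (cmod (hip B y (v l b)))\<^sup>2))"
      by (simp add: hip_rotT norm_mult power_mult_distrib sum.cartesian_product' sum_distrib_left mult_ac)
    \<comment> \<open>Bounding all overlaps by \<open>c\<close> makes the sum over \<open>l\<close>
      complete, and a complete sum of conditional states is the memory state.\<close>
    also have "\<dots> \<le> (\<Sum>l\<in>L. c * (\<Sum>b\<in>B. q l b * (cmod (hip B y (v l b)))\<^sup>2))"
      using c[OF k] q by (intro sum_mono mult_right_mono sum_nonneg) auto
    also have "\<dots> = c * (\<Sum>l\<in>L. \<Sum>z\<in>Z. (cmod (hip B y (par A (\<phi> l) (\<Omega> z))))\<^sup>2)"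
      by (simp add: gram_form[OF v] sum_distrib_left)
    also have "(\<Sum>l\<in>L. \<Sum>z\<in>Z. (cmod (hip B y (par A (\<phi> l) (\<Omega> z))))\<^sup>2) =
        (\<Sum>z\<in>Z. \<Sum>a\<in>A. (cmod (hip B y (\<lambda>b. \<Omega> z (a, b))))\<^sup>2)"
      by (subst sum.swap) (simp add: sum_par[OF \<phi>])
    also have "\<dots> = (\<Sum>b\<in>B. t b * (cmod (hip B y (f b)))\<^sup>2)"
      unfolding gram_form[OF f, symmetric] by (subst sum.swap) (simp add: sum.cartesian_product split_beta)
    finally show "(\<Sum>j\<in>L \<times> B. q (fst j) (snd j) * (cmod (hip B y (\<lambda>b. rot (T j) (k, b))))\<^sup>2)
        \<le> (\<Sum>b\<in>B. c * t b * (cmod (hip B y (f b)))\<^sup>2)" by (simp add: sum_distrib_left mult.assoc)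
  next
    show "(\<Sum>i\<in>A \<times> B. p i) = (\<Sum>k\<in>K. \<Sum>b\<in>B. r k b)"
      unfolding gram_trace[OF E] gram_trace[OF u]
      by (subst sum.swap) (simp add: nsq_rotate[OF \<psi>])
  next
    fix i j assume ij: "i \<in> A \<times> B" "j \<in> L \<times> B" "q (fst j) (snd j) = 0"
    have "(\<Sum>i\<in>A \<times> B. p i * (cmod (hip (K \<times> B) (rot (E i)) (rot (T j))))\<^sup>2) = 0"
      using q_eq[of "snd j" "fst j"] ij by auto
    then show "(cmod (hip (K \<times> B) (rot (E i)) (rot (T j))))\<^sup>2 * p i = 0"
      using fin B p ij(1) by (subst (asm) sum_nonneg_eq_0_iff) auto
  next
    fix k a b assume kab: "k \<in> K" "a \<in> B" "b \<in> B" "c * t b = 0"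
    then have "(\<Sum>k\<in>K. \<Sum>a\<in>B. r k a * (cmod (hip B (u k a) (f b)))\<^sup>2) = 0"
      using t_eq c0 by simp
    then have "(\<Sum>a\<in>B. r k a * (cmod (hip B (u k a) (f b)))\<^sup>2) = 0"
      using fin kab(1) r by (subst (asm) sum_nonneg_eq_0_iff) (auto intro!: sum_nonneg)
    then show "(cmod (hip B (u k a) (f b)))\<^sup>2 * r k a = 0"
      using B kab(2) r by (subst (asm) sum_nonneg_eq_0_iff) auto
  qed (use fin B r q t c0 in auto)
  also have "(\<Sum>j\<in>L \<times> B. (\<Sum>i\<in>A \<times> B. p i * (cmod (hip (K \<times> B) (rot (E i)) (rot (T j))))\<^sup>2) * ln (q (fst j) (snd j)))
      = (\<Sum>l\<in>L. \<Sum>b\<in>B. q l b * ln (q l b))"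
    by (simp add: q_eq sum.cartesian_product'[of _ L B])
  also have "(\<Sum>k\<in>K. (\<Sum>b\<in>B. (\<Sum>a\<in>B. r k a * (cmod (hip B (u k a) (f b)))\<^sup>2) * ln (c * t b)) - (\<Sum>a\<in>B. r k a * ln (r k a)))
      = (\<Sum>b\<in>B. t b * ln (c * t b)) - (\<Sum>k\<in>K. \<Sum>a\<in>B. r k a * ln (r k a))"
    unfolding sum_subtractf by (subst sum.swap) (simp add: t_eq sum_distrib_right)
  also have "(\<Sum>b\<in>B. t b * ln (c * t b)) = (\<Sum>b\<in>B. t b) * ln c + (\<Sum>b\<in>B. t b * ln (t b))"
  proof -
    have "t b * ln (c * t b) = t b * ln c + t b * ln (t b)" if "b \<in> B" for b
      using t[OF that] c0 by (cases "t b = 0") (auto simp: ln_mult_pos distrib_left)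
    then show ?thesis by (simp add: sum.distrib sum_distrib_right)
  qed
  also have "(\<Sum>b\<in>B. t b) = 1"
  proof -
    have "(\<Sum>b\<in>B. t b) = (\<Sum>a\<in>A. \<Sum>z\<in>Z. nsq B (\<lambda>b. \<Omega> z (a, b)))"
      unfolding gram_trace[OF f] by (simp add: sum.cartesian_product split_beta)
    also have "\<dots> = 1" unfolding unit[symmetric] nsq_times by (rule sum.swap)
    finally show ?thesis .
  qed
  finally have main: "(\<Sum>l\<in>L. \<Sum>b\<in>B. q l b * ln (q l b)) - (\<Sum>i\<in>A \<times> B. p i * ln (p i))
    \<le> ln c + (\<Sum>b\<in>B. t b * ln (t b)) - (\<Sum>k\<in>K. \<Sum>a\<in>B. r k a * ln (r k a))" by simp
  have "kent (A \<times> B) (gram Z \<Omega>) = - (\<Sum>i\<in>A \<times> B. p i * ln (p i)) / ln 2"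
    using p by (simp add: kent_resol[OF E] eta_ln sum_divide_distrib flip: sum_negf)
  moreover have "kent B (gram (A \<times> Z) (\<lambda>(a, z) b. \<Omega> z (a, b))) = - (\<Sum>b\<in>B. t b * ln (t b)) / ln 2"
    using t by (simp add: kent_resol[OF f] eta_ln sum_divide_distrib flip: sum_negf)
  moreover have "(\<Sum>k\<in>K. kent B (gram Z (\<lambda>z. par A (\<psi> k) (\<Omega> z)))) = - (\<Sum>k\<in>K. \<Sum>a\<in>B. r k a * ln (r k a)) / ln 2"
    using r by (simp add: kent_resol[OF u] eta_ln sum_divide_distrib flip: sum_negf)
  moreover have "(\<Sum>l\<in>L. kent B (gram Z (\<lambda>z. par A (\<phi> l) (\<Omega> z)))) = - (\<Sum>l\<in>L. \<Sum>b\<in>B. q l b * ln (q l b)) / ln 2"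
    using q by (simp add: kent_resol[OF v] eta_ln sum_divide_distrib flip: sum_negf)
  ultimately show ?thesis
    using divide_right_mono[OF main, of "ln 2"] by (simp add: log_def add_divide_distrib diff_divide_distrib)
qed

text \<open>One link of the bound without memory: \<open>block_entropy\<close> with a
  one-dimensional memory \<open>U\<close>, applied to the state of \<open>A\<close> and to the
  positive operator that is diagonal in \<open>\<phi>\<close> with eigenvalues
  \<open>\<beta>\<close>. Hypothesis \<open>le\<close> bounds the diagonal of that operator in the
  basis \<open>\<psi>\<close> by \<open>\<beta>'\<close>, which then serves as
  \<open>\<beta>\<close> of the next link.\<close>

lemma chain_step:
  fixes \<Omega> :: "'z \<Rightarrow> 'a \<Rightarrow> complex"
  assumes \<phi>: "orthobasis A L \<phi>" and \<psi>: "orthobasis A K \<psi>"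
    and \<beta>: "\<And>l. l \<in> L \<Longrightarrow> \<beta> l \<ge> 0" and \<beta>': "\<And>k. k \<in> K \<Longrightarrow> \<beta>' k > 0"
    and nest: "\<And>l. l \<in> L \<Longrightarrow> \<beta> l = 0 \<Longrightarrow> (\<Sum>z\<in>Z. (cmod (hip A (\<phi> l) (\<Omega> z)))\<^sup>2) = 0"
    and le: "\<And>k. k \<in> K \<Longrightarrow> (\<Sum>l\<in>L. \<beta> l * (cmod (hip A (\<psi> k) (\<phi> l)))\<^sup>2) \<le> \<beta>' k"
  shows "(\<Sum>l\<in>L. (\<Sum>z\<in>Z. (cmod (hip A (\<phi> l) (\<Omega> z)))\<^sup>2) * log 2 (\<beta> l)) + kent A (gram Z \<Omega>)
    \<le> (\<Sum>k\<in>K. (\<Sum>z\<in>Z. (cmod (hip A (\<psi> k) (\<Omega> z)))\<^sup>2) * log 2 (\<beta>' k))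
      + (\<Sum>k\<in>K. eta (\<Sum>z\<in>Z. (cmod (hip A (\<psi> k) (\<Omega> z)))\<^sup>2))"
proof -
  define U where "U = {()}"
  have fin: "finite A" "finite K" "finite L" using \<psi> \<phi> by (auto simp: orthobasis_def)
  define pr where "pr k = (\<Sum>z\<in>Z. (cmod (hip A (\<psi> k) (\<Omega> z)))\<^sup>2)" for k
  define pl where "pl l = (\<Sum>z\<in>Z. (cmod (hip A (\<phi> l) (\<Omega> z)))\<^sup>2)" for l
  have pr0: "pr k \<ge> 0" for k by (simp add: pr_def sum_nonneg)
  obtain E p where E: "resol A (gram Z \<Omega>) A E p" and p: "\<And>i. i \<in> A \<Longrightarrow> p i \<ge> 0"
    using gram_resol[of A Z \<Omega>] fin by blast
  have obE: "orthobasis A A E" using E by (simp add: resol_def)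
  define rot where "rot g = (\<lambda>(k, b::unit). hip A (\<psi> k) g)" for g :: "'a \<Rightarrow> complex"
  have rot: "hip (K \<times> U) (rot g) (rot h) = hip A g h" for g h
    unfolding hip_times hip_parseval[OF \<psi>, of g h] by (simp add: U_def hip_def[of "{()}"] rot_def hip_cnj)
  have onE: "orthonormal (K \<times> U) A (\<lambda>i. rot (E i))"
    using obE by (simp add: orthonormal_def orthobasis_def rot)
  have onT: "orthonormal (K \<times> U) L (\<lambda>j. rot (\<phi> j))"
    using \<phi> by (auto simp: orthonormal_def orthobasis_def rot)
  have obT: "orthobasis (K \<times> U) L (\<lambda>j. rot (\<phi> j))"
    using orthobasis_card[OF \<psi>] orthobasis_card[OF \<phi>] fin
    by (intro orthonormal_imp_orthobasis onT) (auto simp: U_def card_cartesian_product)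
  have ob1: "orthobasis U U (\<lambda>_ _. 1)"
    by (simp add: orthobasis_def orthonormal_def hip_def U_def)
  have pE: "(\<Sum>i\<in>A. p i * (cmod (hip A y (E i)))\<^sup>2) = (\<Sum>z\<in>Z. (cmod (hip A y (\<Omega> z)))\<^sup>2)" for y
    using gram_form[OF E] by simp
  have pl_eq: "(\<Sum>i\<in>A. p i * (cmod (hip (K \<times> U) (rot (E i)) (rot (\<phi> l))))\<^sup>2) = pl l" for l
    unfolding rot hip_cmod_commute[of _ "E _"] pE by (simp add: pl_def)
  have h1: "hip U y (\<lambda>b. 1) = cnj (y ())" "hip U y (\<lambda>b. rot g (k, b)) = cnj (y ()) * hip A (\<psi> k) g" for y g k
    by (simp_all add: U_def hip_def[of "{()}"] rot_def)
  have "(\<Sum>j\<in>L. (\<Sum>i\<in>A. p i * (cmod (hip (K \<times> U) (rot (E i)) (rot (\<phi> j))))\<^sup>2) * ln (\<beta> j))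
      - (\<Sum>i\<in>A. p i * ln (p i))
    \<le> (\<Sum>k\<in>K. (\<Sum>b\<in>U. (\<Sum>a\<in>U. pr k * (cmod (hip U (\<lambda>_. 1) (\<lambda>_. 1)))\<^sup>2) * ln (\<beta>' k)) - (\<Sum>a\<in>U. pr k * ln (pr k)))"
  proof (rule block_entropy[OF fin(2) _ fin(1) onE obT p \<beta> ob1 ob1])
    fix k y assume k: "k \<in> K"
    have "(\<Sum>i\<in>A. p i * (cmod (hip U y (\<lambda>b. rot (E i) (k, b))))\<^sup>2) = (cmod (y ()))\<^sup>2 * (\<Sum>i\<in>A. p i * (cmod (hip A (\<psi> k) (E i)))\<^sup>2)"
      unfolding h1 by (simp add: norm_mult power_mult_distrib sum_distrib_left mult_ac)
    then show "(\<Sum>i\<in>A. p i * (cmod (hip U y (\<lambda>b. rot (E i) (k, b))))\<^sup>2) \<le> (\<Sum>b\<in>U. pr k * (cmod (hip U y (\<lambda>_. 1)))\<^sup>2)"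
      unfolding pE h1 by (simp add: U_def pr_def mult.commute)
    have "(\<Sum>j\<in>L. \<beta> j * (cmod (hip U y (\<lambda>b. rot (\<phi> j) (k, b))))\<^sup>2) = (cmod (y ()))\<^sup>2 * (\<Sum>j\<in>L. \<beta> j * (cmod (hip A (\<psi> k) (\<phi> j)))\<^sup>2)"
      unfolding h1 by (simp add: norm_mult power_mult_distrib sum_distrib_left mult_ac)
    also have "\<dots> \<le> (cmod (y ()))\<^sup>2 * \<beta>' k"
      by (intro mult_left_mono le k) auto
    finally show "(\<Sum>j\<in>L. \<beta> j * (cmod (hip U y (\<lambda>b. rot (\<phi> j) (k, b))))\<^sup>2) \<le> (\<Sum>b\<in>U. \<beta>' k * (cmod (hip U y (\<lambda>_. 1)))\<^sup>2)"
      unfolding h1 by (simp add: U_def mult.commute)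
  next
    have "sum p A = (\<Sum>k\<in>K. pr k)"
      unfolding gram_trace[OF E] pr_def by (subst sum.swap) (simp add: parseval[OF \<psi>])
    then show "sum p A = (\<Sum>k\<in>K. \<Sum>b\<in>U. pr k)" by (simp add: U_def)
  next
    fix i l assume il: "i \<in> A" "l \<in> L" "\<beta> l = 0"
    have "(\<Sum>i\<in>A. p i * (cmod (hip (K \<times> U) (rot (E i)) (rot (\<phi> l))))\<^sup>2) = 0"
      using nest[OF il(2,3)] unfolding pl_eq by (simp add: pl_def)
    then show "(cmod (hip (K \<times> U) (rot (E i)) (rot (\<phi> l))))\<^sup>2 * p i = 0"
      using fin p il(1) by (subst (asm) sum_nonneg_eq_0_iff) auto
  next
    fix k assume "k \<in> K" "\<beta>' k = 0"
    then show "(cmod (hip U (\<lambda>_. 1) (\<lambda>_. 1)))\<^sup>2 * pr k = 0" using \<beta>' by fastforce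
  qed (use pr0 \<beta>' in \<open>auto simp: U_def less_imp_le\<close>)
  then have main: "(\<Sum>l\<in>L. pl l * ln (\<beta> l)) - (\<Sum>i\<in>A. p i * ln (p i)) \<le> (\<Sum>k\<in>K. pr k * ln (\<beta>' k)) - (\<Sum>k\<in>K. pr k * ln (pr k))"
    unfolding pl_eq h1 by (simp add: U_def sum_subtractf)
  have "kent A (gram Z \<Omega>) = - (\<Sum>i\<in>A. p i * ln (p i)) / ln 2"
    using p by (simp add: kent_resol[OF E] eta_ln sum_divide_distrib flip: sum_negf)
  moreover have "(\<Sum>k\<in>K. eta (pr k)) = - (\<Sum>k\<in>K. pr k * ln (pr k)) / ln 2"
    by (simp add: eta_ln pr0 sum_divide_distrib flip: sum_negf)
  moreover have "(\<Sum>l\<in>L. pl l * log 2 (\<beta> l)) = (\<Sum>l\<in>L. pl l * ln (\<beta> l)) / ln 2"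
    "(\<Sum>k\<in>K. pr k * log 2 (\<beta>' k)) = (\<Sum>k\<in>K. pr k * ln (\<beta>' k)) / ln 2"
    by (simp_all add: log_def sum_divide_distrib)
  ultimately show ?thesis
    using divide_right_mono[OF main, of "ln 2"] unfolding pr_def[symmetric] pl_def[symmetric]
    by (simp add: diff_divide_distrib)
qed

text \<open>The joint state is a single vector on \<open>A\<close>, both memories and a remainder
  \<open>R\<close>, so that measuring \<open>\<psi>\<close> or \<open>\<phi>\<close> gives two
  expansions of the same vector, related by the matrix of overlaps. Each memory state arises by
  summing over all other factors.\<close>

lemma tripartite_uncertainty:
  fixes \<Omega> :: "'a \<times> 'b \<times> 'c \<times> 'r \<Rightarrow> complex"
  assumes fin: "finite B" "finite C" "finite R" and \<psi>: "orthobasis A K \<psi>" and \<phi>: "orthobasis A L \<phi>"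
    and c: "\<And>k l. k \<in> K \<Longrightarrow> l \<in> L \<Longrightarrow> (cmod (hip A (\<psi> k) (\<phi> l)))\<^sup>2 \<le> c" and c0: "c > 0"
    and unit: "nsq (A \<times> B \<times> C \<times> R) \<Omega> = 1"
  shows "- log 2 c + kent B (gram (A \<times> C \<times> R) (\<lambda>(a, z) b. \<Omega> (a, b, z)))
      + kent C (gram (A \<times> B \<times> R) (\<lambda>(a, b, z) c. \<Omega> (a, b, c, z)))
    \<le> (\<Sum>k\<in>K. kent B (gram (C \<times> R) (\<lambda>z b. par A (\<psi> k) \<Omega> (b, z))))
      + (\<Sum>l\<in>L. kent C (gram (B \<times> R) (\<lambda>(b, z) c. par A (\<phi> l) \<Omega> (b, c, z))))"
proof -
  define W where "W = B \<times> C \<times> R"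
  have finA: "finite A" "finite K" "finite L" using \<psi> \<phi> by (auto simp: orthobasis_def)
  define P where "P k = par A (\<psi> k) \<Omega>" for k
  define Q where "Q l = par A (\<phi> l) \<Omega>" for l
  define FB where "FB = (\<lambda>(a, z) b. \<Omega> (a, b, z))"
  define FC where "FC = (\<lambda>(a, b, z) c. \<Omega> (a, b, c, z))"
  define GB where "GB k = (\<lambda>z b. P k (b, z))" for k
  define GC where "GC l = (\<lambda>(b, z) c. Q l (b, c, z))" for l
  obtain f t where f: "resol B (gram (A \<times> C \<times> R) FB) B f t" and t: "\<And>i. i \<in> B \<Longrightarrow> t i \<ge> 0"
    using gram_resol[of B "A \<times> C \<times> R" FB] fin by blast
  obtain g t' where g: "resol C (gram (A \<times> B \<times> R) FC) C g t'" and t': "\<And>i. i \<in> C \<Longrightarrow> t' i \<ge> 0"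
    using gram_resol[of C "A \<times> B \<times> R" FC] fin by blast
  obtain u r where u: "\<And>k. resol B (gram (C \<times> R) (GB k)) B (u k) (r k)" and r: "\<And>k i. i \<in> B \<Longrightarrow> r k i \<ge> 0"
    using gram_resol_family[of B "C \<times> R" GB] fin by blast
  obtain v q where v: "\<And>l. resol C (gram (B \<times> R) (GC l)) C (v l) (q l)" and q: "\<And>k i. i \<in> C \<Longrightarrow> q k i \<ge> 0"
    using gram_resol_family[of C "B \<times> R" GC] fin by blast
  have obf: "orthobasis B B f" and obg: "orthobasis C C g"
    and obu: "orthobasis B B (u k)" and obv: "orthobasis C C (v l)" for k l
    using g f u v by (auto simp: resol_def)
  have swapB: "hip B y (\<lambda>b. par A x \<Omega> (b, z)) = hip A x (\<lambda>a. hip B y (\<lambda>b. \<Omega> (a, b, z)))" for x y z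
    using hip_par_swap[of B y A x "\<lambda>(a, b). \<Omega> (a, b, z)"] by (simp add: par_def)
  have swapC: "hip C y (\<lambda>c. par A x \<Omega> (b, c, z)) = hip A x (\<lambda>a. hip C y (\<lambda>c. \<Omega> (a, b, c, z)))" for x y b z
    using hip_par_swap[of C y A x "\<lambda>(a, c). \<Omega> (a, b, c, z)"] by (simp add: par_def)
  \<comment> \<open>Parseval on \<open>A\<close> shows that the conditional states of
    \<open>B\<close> add up to its reduced state for any measured basis. It is needed for
    \<open>\<psi>\<close>, which is paired with \<open>B\<close>, and also for
    \<open>\<phi>\<close>, which is paired with \<open>C\<close>.\<close>
  have totB: "(\<Sum>k\<in>M. \<Sum>z\<in>C \<times> R. (cmod (hip B y (\<lambda>b. par A (\<chi> k) \<Omega> (b, z))))\<^sup>2) = (\<Sum>b\<in>B. t b * (cmod (hip B y (f b)))\<^sup>2)"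
    if \<chi>: "orthobasis A M \<chi>" for y \<chi> and M :: "'m set"
  proof -
    have "(\<Sum>k\<in>M. \<Sum>z\<in>C \<times> R. (cmod (hip B y (\<lambda>b. par A (\<chi> k) \<Omega> (b, z))))\<^sup>2) =
        (\<Sum>z\<in>C \<times> R. \<Sum>a\<in>A. (cmod (hip B y (\<lambda>b. \<Omega> (a, b, z))))\<^sup>2)"
      unfolding swapB by (subst sum.swap) (simp add: parseval[OF \<chi>] nsq_def)
    also have "\<dots> = (\<Sum>b\<in>B. t b * (cmod (hip B y (f b)))\<^sup>2)"
      unfolding gram_form[OF f, symmetric] by (subst sum.swap) (simp add: FB_def sum.cartesian_product split_beta)
    finally show ?thesis .
  qed
  have totC: "(\<Sum>k\<in>M. \<Sum>z\<in>B \<times> R. (cmod (hip C y (\<lambda>c. par A (\<chi> k) \<Omega> (fst z, c, snd z))))\<^sup>2) = (\<Sum>b\<in>C. t' b * (cmod (hip C y (g b)))\<^sup>2)"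
    if \<chi>: "orthobasis A M \<chi>" for y \<chi> and M :: "'m set"
  proof -
    have "(\<Sum>k\<in>M. \<Sum>z\<in>B \<times> R. (cmod (hip C y (\<lambda>c. par A (\<chi> k) \<Omega> (fst z, c, snd z))))\<^sup>2) =
        (\<Sum>z\<in>B \<times> R. \<Sum>a\<in>A. (cmod (hip C y (\<lambda>c. \<Omega> (a, fst z, c, snd z))))\<^sup>2)"
      unfolding swapC by (subst sum.swap) (simp add: parseval[OF \<chi>] nsq_def)
    also have "\<dots> = (\<Sum>b\<in>C. t' b * (cmod (hip C y (g b)))\<^sup>2)"
      unfolding gram_form[OF g, symmetric] by (subst sum.swap) (simp add: FC_def sum.cartesian_product split_beta)
    finally show ?thesis .
  qed
  have t_eq: "t b = (\<Sum>k\<in>K. \<Sum>a\<in>B. r k a * (cmod (hip B (u k a) (f b)))\<^sup>2)" if "b \<in> B" for b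
  proof -
    have "(\<Sum>k\<in>K. \<Sum>a\<in>B. r k a * (cmod (hip B (u k a) (f b)))\<^sup>2) =
        (\<Sum>k\<in>K. \<Sum>z\<in>C \<times> R. (cmod (hip B (f b) (GB k z)))\<^sup>2)"
      by (simp add: gram_form[OF u] hip_cmod_commute[of B _ "f b"])
    also have "\<dots> = (\<Sum>i\<in>B. t i * (cmod (hip B (f b) (f i)))\<^sup>2)"
      unfolding GB_def P_def by (rule totB[OF \<psi>])
    also have "\<dots> = t b"
      unfolding gram_form[OF f, symmetric] gram_eigenvalue[OF f that] ..
    finally show ?thesis ..
  qed
  have t'_eq: "t' b = (\<Sum>k\<in>L. \<Sum>a\<in>C. q k a * (cmod (hip C (v k a) (g b)))\<^sup>2)" if "b \<in> C" for b
  proof -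
    have "(\<Sum>k\<in>L. \<Sum>a\<in>C. q k a * (cmod (hip C (v k a) (g b)))\<^sup>2) =
        (\<Sum>k\<in>L. \<Sum>z\<in>B \<times> R. (cmod (hip C (g b) (GC k z)))\<^sup>2)"
      by (simp add: gram_form[OF v] hip_cmod_commute[of C _ "g b"])
    also have "\<dots> = (\<Sum>i\<in>C. t' i * (cmod (hip C (g b) (g i)))\<^sup>2)"
      using totC[OF \<phi>] by (simp add: GC_def Q_def split_beta)
    also have "\<dots> = t' b"
      unfolding gram_form[OF g, symmetric] gram_eigenvalue[OF g that] ..
    finally show ?thesis ..
  qed
  have nP: "(\<Sum>k\<in>K. nsq W (P k)) = 1"
    using nsq_rotate[OF \<psi>, of W \<Omega>] unit by (simp add: P_def W_def)
  have nQ: "(\<Sum>l\<in>L. nsq W (Q l)) = 1"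
    using nsq_rotate[OF \<phi>, of W \<Omega>] unit by (simp add: Q_def W_def)
  have trr: "(\<Sum>k\<in>K. \<Sum>b\<in>B. r k b) = 1"
    unfolding gram_trace[OF u] nP[symmetric] W_def nsq_fst GB_def ..
  have trq: "(\<Sum>l\<in>L. \<Sum>b\<in>C. q l b) = 1"
    unfolding gram_trace[OF v] nQ[symmetric] W_def nsq_snd by (simp add: GC_def split_beta)
  have trt: "(\<Sum>b\<in>B. t b) = 1"
  proof -
    have "(\<Sum>b\<in>B. t b) = (\<Sum>b\<in>B. \<Sum>k\<in>K. \<Sum>a\<in>B. r k a * (cmod (hip B (u k a) (f b)))\<^sup>2)"
      by (simp add: t_eq)
    also have "\<dots> = (\<Sum>k\<in>K. \<Sum>a\<in>B. r k a * (\<Sum>b\<in>B. (cmod (hip B (u k a) (f b)))\<^sup>2))"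
      unfolding sum_distrib_left by (subst sum.swap, rule sum.cong[OF refl], rule sum.swap)
    also have "\<dots> = (\<Sum>k\<in>K. \<Sum>a\<in>B. r k a)"
    proof -
      have onu: "orthonormal B B (u k)" for k using obu by (simp add: orthobasis_def)
      then show ?thesis by (simp add: weights_sum1[OF obf onu])
    qed
    finally show ?thesis using trr by simp
  qed
  have "0 \<le> (\<Sum>k\<in>K. (\<Sum>b\<in>B. (\<Sum>a\<in>B. r k a * (cmod (hip B (u k a) (f b)))\<^sup>2) * ln (c * t b)) - (\<Sum>a\<in>B. r k a * ln (r k a)))
     + (\<Sum>l\<in>L. (\<Sum>b\<in>C. (\<Sum>a\<in>C. q l a * (cmod (hip C (v l a) (g b)))\<^sup>2) * ln (t' b)) - (\<Sum>a\<in>C. q l a * ln (q l a)))"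
  proof (rule tripartite_entropy[where P = P and Q = Q and U = "\<lambda>k l. hip A (\<psi> k) (\<phi> l)", OF finA(2,3) fin W_def])
    have UU: "hip K (\<lambda>k. hip A (\<psi> k) x) (\<lambda>k. hip A (\<psi> k) y) = hip A x y" for x y
      by (simp add: hip_def[of K] hip_cnj hip_parseval[OF \<psi>, of x y])
    show "orthonormal K L (\<lambda>l k. hip A (\<psi> k) (\<phi> l))"
      using \<phi> by (simp add: orthonormal_def UU orthobasis_def)
    \<comment> \<open>Completeness of \<open>\<phi>\<close> makes the overlap matrix the transition
      matrix \<open>U\<close> of \<open>tripartite_entropy\<close>.\<close>
    show "P k w = (\<Sum>l\<in>L. hip A (\<psi> k) (\<phi> l) * Q l w)" for k w
      unfolding P_def Q_def par_def by (rule hip_parseval[OF \<phi>])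
    show "(\<Sum>z\<in>C \<times> R. (cmod (hip B y (\<lambda>b. P k (b, z))))\<^sup>2) \<le> (\<Sum>b\<in>B. r k b * (cmod (hip B y (u k b)))\<^sup>2)" for k y
      using gram_form[OF u, of y k] by (simp add: GB_def)
    show "(\<Sum>z\<in>B \<times> R. (cmod (hip C y (\<lambda>c. Q l (fst z, c, snd z))))\<^sup>2) \<le> (\<Sum>b\<in>C. q l b * (cmod (hip C y (v l b)))\<^sup>2)" for l y
      using gram_form[OF v, of y l] by (simp add: GC_def split_beta)
    show "(\<Sum>l\<in>L. \<Sum>z\<in>C \<times> R. (cmod (hip B y (\<lambda>b. Q l (b, z))))\<^sup>2) \<le> (\<Sum>b\<in>B. t b * (cmod (hip B y (f b)))\<^sup>2)" for y
      using totB[OF \<phi>] by (simp add: Q_def)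
    show "(\<Sum>k\<in>K. \<Sum>z\<in>B \<times> R. (cmod (hip C y (\<lambda>c. P k (fst z, c, snd z))))\<^sup>2) \<le> (\<Sum>b\<in>C. t' b * (cmod (hip C y (g b)))\<^sup>2)" for y
      using totC[OF \<psi>] by (simp add: P_def)
    show "(\<Sum>k\<in>K. \<Sum>b\<in>B. r k b) = (\<Sum>k\<in>K. nsq W (P k))" "(\<Sum>l\<in>L. \<Sum>b\<in>C. q l b) = (\<Sum>k\<in>K. nsq W (P k))"
      using trr trq nP by auto
  next
    fix k a b assume kab: "k \<in> K" "a \<in> B" "b \<in> B" "t b = 0"
    then have "(\<Sum>k\<in>K. \<Sum>a\<in>B. r k a * (cmod (hip B (u k a) (f b)))\<^sup>2) = 0"
      using t_eq by simp
    then have "(\<Sum>a\<in>B. r k a * (cmod (hip B (u k a) (f b)))\<^sup>2) = 0"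
      using finA kab(1) r by (subst (asm) sum_nonneg_eq_0_iff) (auto intro!: sum_nonneg)
    then show "(cmod (hip B (u k a) (f b)))\<^sup>2 * r k a = 0"
      using fin kab(2) r by (subst (asm) sum_nonneg_eq_0_iff) auto
  next
    fix k a b assume kab: "k \<in> L" "a \<in> C" "b \<in> C" "t' b = 0"
    then have "(\<Sum>k\<in>L. \<Sum>a\<in>C. q k a * (cmod (hip C (v k a) (g b)))\<^sup>2) = 0"
      using t'_eq by simp
    then have "(\<Sum>a\<in>C. q k a * (cmod (hip C (v k a) (g b)))\<^sup>2) = 0"
      using finA kab(1) q by (subst (asm) sum_nonneg_eq_0_iff) (auto intro!: sum_nonneg)
    then show "(cmod (hip C (v k a) (g b)))\<^sup>2 * q k a = 0"
      using fin kab(2) q by (subst (asm) sum_nonneg_eq_0_iff) auto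
  qed (use c c0 obu obf obv obg r t q t' in auto)
  also have "(\<Sum>k\<in>K. (\<Sum>b\<in>B. (\<Sum>a\<in>B. r k a * (cmod (hip B (u k a) (f b)))\<^sup>2) * ln (c * t b)) - (\<Sum>a\<in>B. r k a * ln (r k a)))
      = (\<Sum>b\<in>B. t b * ln (c * t b)) - (\<Sum>k\<in>K. \<Sum>a\<in>B. r k a * ln (r k a))"
    unfolding sum_subtractf by (subst sum.swap) (simp add: t_eq sum_distrib_right)
  also have "(\<Sum>k\<in>L. (\<Sum>b\<in>C. (\<Sum>a\<in>C. q k a * (cmod (hip C (v k a) (g b)))\<^sup>2) * ln (t' b)) - (\<Sum>a\<in>C. q k a * ln (q k a)))
      = (\<Sum>b\<in>C. t' b * ln (t' b)) - (\<Sum>k\<in>L. \<Sum>a\<in>C. q k a * ln (q k a))"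
    unfolding sum_subtractf by (subst sum.swap) (simp add: t'_eq sum_distrib_right)
  also have "(\<Sum>b\<in>B. t b * ln (c * t b)) = ln c + (\<Sum>b\<in>B. t b * ln (t b))"
  proof -
    have "t b * ln (c * t b) = t b * ln c + t b * ln (t b)" if "b \<in> B" for b
      using t[OF that] c0 by (cases "t b = 0") (auto simp: ln_mult_pos distrib_left)
    then show ?thesis using trt by (simp add: sum.distrib flip: sum_distrib_right)
  qed
  finally have main: "- ln c - (\<Sum>b\<in>B. t b * ln (t b)) - (\<Sum>b\<in>C. t' b * ln (t' b))
    \<le> - (\<Sum>k\<in>K. \<Sum>a\<in>B. r k a * ln (r k a)) - (\<Sum>l\<in>L. \<Sum>b\<in>C. q l b * ln (q l b))" by simp
  have "kent B (gram (A \<times> C \<times> R) FB) = - (\<Sum>b\<in>B. t b * ln (t b)) / ln 2"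
    using t by (simp add: kent_resol[OF f] eta_ln sum_divide_distrib flip: sum_negf)
  moreover have "kent C (gram (A \<times> B \<times> R) FC) = - (\<Sum>b\<in>C. t' b * ln (t' b)) / ln 2"
    using t' by (simp add: kent_resol[OF g] eta_ln sum_divide_distrib flip: sum_negf)
  moreover have "(\<Sum>k\<in>K. kent B (gram (C \<times> R) (GB k))) = - (\<Sum>k\<in>K. \<Sum>a\<in>B. r k a * ln (r k a)) / ln 2"
    using r by (simp add: kent_resol[OF u] eta_ln sum_divide_distrib flip: sum_negf)
  moreover have "(\<Sum>l\<in>L. kent C (gram (B \<times> R) (GC l))) = - (\<Sum>l\<in>L. \<Sum>b\<in>C. q l b * ln (q l b)) / ln 2"
    using q by (simp add: kent_resol[OF v] eta_ln sum_divide_distrib flip: sum_negf)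
  ultimately show ?thesis
    using divide_right_mono[OF main, of "ln 2"]
    unfolding FB_def FC_def GB_def GC_def P_def Q_def
    by (simp add: log_def diff_divide_distrib)
qed

subsection \<open>Configurations and reduced states\<close>

lemma cfg_empty: "cfg D {} = {\<lambda>_. 0}"
  by (auto simp: cfg_def)

lemma sum_cfg_insert:
  assumes "s \<notin> Y"
  shows "(\<Sum>z\<in>cfg D (insert s Y). g z) = (\<Sum>c<D s. \<Sum>z\<in>cfg D Y. g (z(s := c)))"
proof -
  have "(\<Sum>z\<in>cfg D (insert s Y). g z) = (\<Sum>(c, z)\<in>{..<D s} \<times> cfg D Y. g (z(s := c)))"
    by (rule sum.reindex_bij_witness[where i = "\<lambda>(c, z). z(s := c)" and j = "\<lambda>x. (x s, x(s := 0))"])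
       (use assms in \<open>auto simp: cfg_def fun_eq_iff\<close>)
  then show ?thesis by (simp add: sum.cartesian_product)
qed

lemma finite_cfg: "finite Y \<Longrightarrow> finite (cfg D Y)"
proof (induction Y rule: finite_induct)
  case (insert s Y)
  have "x \<in> (\<lambda>(c, z). z(s := c)) ` ({..<D s} \<times> cfg D Y)" if "x \<in> cfg D (insert s Y)" for x
    using that insert.hyps by (intro image_eqI[of _ _ "(x s, x(s := 0))"]) (auto simp: cfg_def)
  then have "cfg D (insert s Y) \<subseteq> (\<lambda>(c, z). z(s := c)) ` ({..<D s} \<times> cfg D Y)" by blast
  then show ?case by (rule finite_subset) (use insert.IH in simp)
qed (simp add: cfg_empty)

definition cfg1 :: "nat \<Rightarrow> nat \<Rightarrow> nat \<Rightarrow> nat" where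
  "cfg1 t b = (\<lambda>k. if k = t then b else 0)"

definition cfg2 :: "nat \<Rightarrow> nat \<times> nat \<Rightarrow> nat \<Rightarrow> nat" where
  "cfg2 t = (\<lambda>(a, b) k. if k = 0 then a else if k = t then b else 0)"

lemma cfg1_bij: "bij_betw (cfg1 t) {..<D t} (cfg D {t})"
  by (rule bij_betw_byWitness[where f' = "\<lambda>x. x t"]) (auto simp: cfg1_def cfg_def fun_eq_iff)

lemma cfg2_bij: "t \<noteq> 0 \<Longrightarrow> bij_betw (cfg2 t) ({..<D 0} \<times> {..<D t}) (cfg D {0, t})"
  by (rule bij_betw_byWitness[where f' = "\<lambda>x. (x 0, x t)"]) (auto simp: cfg2_def cfg_def fun_eq_iff)

lemma merge_cfg1: "merge {t} (cfg1 t b) z = z(t := b)"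
  by (auto simp: merge_def cfg1_def)

lemma merge_cfg2: "t \<noteq> 0 \<Longrightarrow> merge {0, t} (cfg2 t (a, b)) z = z(0 := a, t := b)"
  by (auto simp: merge_def cfg2_def)

text \<open>Tensoring each \<open>\<psi> k\<close> with an eigenbasis of \<open>\<tau> k\<close>
  diagonalises the kernel. So the entropy of a post-measurement state is the sum of the entropies of
  the unnormalised conditional states.\<close>

lemma kent_block_diagonal:
  assumes \<psi>: "orthobasis A K \<psi>" and B: "finite B"
    and \<tau>: "\<And>k x y. k \<in> K \<Longrightarrow> x \<in> B \<Longrightarrow> y \<in> B \<Longrightarrow> \<tau> k x y = cnj (\<tau> k y x)"
  shows "kent (A \<times> B) (\<lambda>(a, b) (a', b'). \<Sum>k\<in>K. \<psi> k a * cnj (\<psi> k a') * \<tau> k b b') = (\<Sum>k\<in>K. kent B (\<tau> k))"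
proof -
  have "\<forall>k\<in>K. \<exists>ep. resol B (\<tau> k) B (fst ep) (snd ep)"
  proof
    fix k assume "k \<in> K"
    then have "\<exists>e p. resol B (\<tau> k) B e p"
      by (intro spectral_theorem[OF B]) (rule \<tau>)
    then show "\<exists>ep. resol B (\<tau> k) B (fst ep) (snd ep)" by auto
  qed
  from bchoice[OF this] obtain ep where ep: "\<forall>k\<in>K. resol B (\<tau> k) B (fst (ep k)) (snd (ep k))" ..
  define u where "u k = fst (ep k)" for k
  define r where "r k = snd (ep k)" for k
  have u: "resol B (\<tau> k) B (u k) (r k)" if "k \<in> K" for k using ep that by (simp add: u_def r_def)
  have ob: "orthobasis B B (u k)" if "k \<in> K" for k using u[OF that] by (simp add: resol_def)
  have fin: "finite A" "finite K" using \<psi> by (auto simp: orthobasis_def)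
  define T where "T j = (\<lambda>(a, b). \<psi> (fst j) a * u (fst j) (snd j) b)" for j
  have "orthonormal (A \<times> B) (K \<times> B) T"
    using \<psi> ob by (auto simp: orthonormal_def orthobasis_def T_def hip_tensor_tensor)
  then have obT: "orthobasis (A \<times> B) (K \<times> B) T"
    using orthobasis_card[OF \<psi>] fin B by (intro orthonormal_imp_orthobasis) (auto simp: card_cartesian_product)
  have "resol (A \<times> B) (\<lambda>(a, b) (a', b'). \<Sum>k\<in>K. \<psi> k a * cnj (\<psi> k a') * \<tau> k b b') (K \<times> B) T (\<lambda>j. r (fst j) (snd j))"
    unfolding resol_def
  proof (intro conjI obT ballI)
    fix x y assume "x \<in> A \<times> B" "y \<in> A \<times> B"
    moreover obtain a b a' b' where "x = (a, b)" "y = (a', b')" by (cases x, cases y)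
    ultimately show "(\<lambda>(a, b) (a', b'). \<Sum>k\<in>K. \<psi> k a * cnj (\<psi> k a') * \<tau> k b b') x y =
        (\<Sum>j\<in>K \<times> B. complex_of_real (r (fst j) (snd j)) * T j x * cnj (T j y))"
      using u by (simp add: resol_def T_def sum.cartesian_product' sum_distrib_left mult_ac)
  qed
  then have "kent (A \<times> B) (\<lambda>(a, b) (a', b'). \<Sum>k\<in>K. \<psi> k a * cnj (\<psi> k a') * \<tau> k b b') = (\<Sum>k\<in>K. \<Sum>b\<in>B. eta (r k b))"
    by (simp add: kent_resol sum.cartesian_product')
  also have "\<dots> = (\<Sum>k\<in>K. kent B (\<tau> k))"
    by (simp add: kent_resol[OF u])
  finally show ?thesis .
qed

lemma kent_diagonal:
  assumes \<psi>: "orthobasis A K \<psi>"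
  shows "kent A (\<lambda>a a'. \<Sum>k\<in>K. \<psi> k a * cnj (\<psi> k a') * of_real (p k)) = (\<Sum>k\<in>K. eta (p k))"
  by (rule kent_resol) (use \<psi> in \<open>auto simp: resol_def mult_ac\<close>)

text \<open>The spectral theorem supplies \<open>\<Omega> i\<close> as the eigenvector
  \<open>e i\<close> times the square root of its eigenvalue; \<open>i\<close> then plays the role
  of a basis label of the purifying system.\<close>

lemma density_purification:
  assumes "is_density D {0..n} \<rho>"
  obtains \<Omega> :: "(nat \<Rightarrow> nat) \<Rightarrow> (nat \<Rightarrow> nat) \<Rightarrow> complex"
  where "\<And>x y. x \<in> cfg D {0..n} \<Longrightarrow> y \<in> cfg D {0..n} \<Longrightarrow>
      \<rho> x y = (\<Sum>i\<in>cfg D {0..n}. \<Omega> i x * cnj (\<Omega> i y))"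
    "(\<Sum>i\<in>cfg D {0..n}. nsq (cfg D {0..n}) (\<Omega> i)) = 1"
proof -
  define V where "V = cfg D {0..n}"
  have fin: "finite V" by (simp add: V_def finite_cfg)
  note dens = assms[unfolded is_density_def V_def[symmetric]]
  have herm: "\<rho> x y = cnj (\<rho> y x)" if "x \<in> V" "y \<in> V" for x y
    using bspec[OF bspec[OF conjunct1[OF dens] that(1)] that(2)] .
  have pos: "0 \<le> Re (hip V v (app V \<rho> v))" for v
    using spec[OF conjunct1[OF conjunct2[OF dens]], of v]
    unfolding hip_def app_def sum_distrib_left by (simp add: mult.assoc)
  have tr: "(\<Sum>x\<in>V. \<rho> x x) = 1"
    using conjunct2[OF conjunct2[OF dens]] .
  have "\<exists>e p. resol V \<rho> V e p" by (rule spectral_theorem[OF fin]) (rule herm)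
  then obtain e p where r: "resol V \<rho> V e p" by blast
  have ob: "orthobasis V V e" using r by (simp add: resol_def)
  have p: "p j \<ge> 0" if j: "j \<in> V" for j
  proof -
    have "app V \<rho> (e j) x = of_real (p j) * e j x" if "x \<in> V" for x
    proof -
      have "app V \<rho> (e j) x = (\<Sum>y\<in>V. \<Sum>i\<in>V. of_real (p i) * e i x * (cnj (e i y) * e j y))"
        using r that by (simp add: app_def resol_def sum_distrib_left sum_distrib_right mult_ac)
      also have "\<dots> = (\<Sum>i\<in>V. of_real (p i) * e i x * hip V (e i) (e j))"
        unfolding hip_def sum_distrib_left by (rule sum.swap)
      also have "\<dots> = (\<Sum>i\<in>V. if i = j then of_real (p j) * e j x else 0)"
        using ob j by (intro sum.cong refl) (auto simp: orthobasis_def orthonormal_def)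
      finally show ?thesis using fin j by simp
    qed
    then have "hip V (e j) (app V \<rho> (e j)) = hip V (e j) (\<lambda>x. of_real (p j) * e j x)"
      by (intro hip_cong) auto
    also have "\<dots> = of_real (p j)"
      using ob j by (simp add: hip_scale_right orthobasis_def orthonormal_def)
    finally show ?thesis using pos[of "e j"] by simp
  qed
  define \<Omega> where "\<Omega> i x = of_real (sqrt (p i)) * e i x" for i x
  have eq: "\<rho> x y = (\<Sum>i\<in>V. \<Omega> i x * cnj (\<Omega> i y))" if "x \<in> V" "y \<in> V" for x y
  proof -
    have "\<Omega> i x * cnj (\<Omega> i y) = of_real (p i) * e i x * cnj (e i y)" if "i \<in> V" for i
    proof -
      have "\<Omega> i x * cnj (\<Omega> i y) = of_real (sqrt (p i) * sqrt (p i)) * (e i x * cnj (e i y))"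
        by (simp add: \<Omega>_def mult_ac del: real_sqrt_mult_self)
      then show ?thesis using p[OF that] by (simp only: real_sqrt_mult_self abs_of_nonneg mult.assoc)
    qed
    then show ?thesis using r that by (simp add: resol_def)
  qed
  have "complex_of_real (\<Sum>i\<in>V. nsq V (\<Omega> i)) = (\<Sum>i\<in>V. \<Sum>x\<in>V. \<Omega> i x * cnj (\<Omega> i x))"
    by (simp add: nsq_def complex_norm_square del: of_real_power)
  also have "\<dots> = 1" unfolding tr[symmetric] by (subst sum.swap) (simp add: eq)
  finally have "(\<Sum>i\<in>V. nsq V (\<Omega> i)) = 1" by (simp only: of_real_eq_1_iff)
  with eq show ?thesis using that[of \<Omega>] by (simp add: V_def)
qed

section \<open>Marginals of the purified state and their entropies\<close>

locale purification =
  fixes D :: "nat \<Rightarrow> nat" and n :: nat and I :: "'i set" and \<Omega> :: "'i \<Rightarrow> (nat \<Rightarrow> nat) \<Rightarrow> complex" and \<rho> :: op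
  assumes fin: "finite I"
    and rho: "\<And>x y. x \<in> cfg D {0..n} \<Longrightarrow> y \<in> cfg D {0..n} \<Longrightarrow> \<rho> x y = (\<Sum>i\<in>I. \<Omega> i x * cnj (\<Omega> i y))"
    and unit: "(\<Sum>i\<in>I. nsq (cfg D {0..n}) (\<Omega> i)) = 1"
begin

abbreviation "A \<equiv> {..<D 0}"

definition bker :: "nat \<Rightarrow> nat \<Rightarrow> nat \<Rightarrow> complex" where
  "bker t b b' = (\<Sum>x\<in>cfg D ({0..n} - {t}). \<Sum>i\<in>I. \<Omega> i (x(t := b)) * cnj (\<Omega> i (x(t := b'))))"

definition abamp :: "nat \<Rightarrow> (nat \<Rightarrow> nat) \<times> 'i \<Rightarrow> nat \<times> nat \<Rightarrow> complex" where
  "abamp t = (\<lambda>(x, i) (a, b). \<Omega> i (x(0 := a, t := b)))"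

definition env :: "nat \<Rightarrow> ((nat \<Rightarrow> nat) \<times> 'i) set" where
  "env t = cfg D ({0..n} - {0, t}) \<times> I"

text \<open>The unnormalised state of memory \<open>t\<close> given the outcome
  \<open>\<phi>\<close> on \<open>A\<close>; its trace is the probability of that outcome.\<close>

definition mker :: "(nat \<Rightarrow> complex) \<Rightarrow> nat \<Rightarrow> nat \<Rightarrow> nat \<Rightarrow> complex" where
  "mker \<phi> t = gram (env t) (\<lambda>z. par A \<phi> (abamp t z))"

definition prob :: "(nat \<Rightarrow> complex) \<Rightarrow> real" where
  "prob \<phi> = (\<Sum>z\<in>cfg D ({0..n} - {0}) \<times> I. (cmod (hip A \<phi> (\<lambda>a. \<Omega> (snd z) ((fst z)(0 := a)))))\<^sup>2)"

lemma ptr_eq: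
  assumes "X \<subseteq> {0..n}" "x \<in> cfg D X" "y \<in> cfg D X"
  shows "ptr D {0..n} X \<rho> x y =
    (\<Sum>z\<in>cfg D ({0..n} - X). \<Sum>i\<in>I. \<Omega> i (merge X x z) * cnj (\<Omega> i (merge X y z)))"
proof -
  have "merge X w z \<in> cfg D {0..n}" if "w \<in> cfg D X" "z \<in> cfg D ({0..n} - X)" for w z
    using that assms(1) by (auto simp: cfg_def merge_def)
  then show ?thesis using assms unfolding ptr_def by (intro sum.cong refl) (simp add: rho)
qed

lemma ptr_hermitian:
  assumes "X \<subseteq> {0..n}" "x \<in> cfg D X" "y \<in> cfg D X"
  shows "ptr D {0..n} X \<rho> x y = cnj (ptr D {0..n} X \<rho> y x)"
  using assms by (simp add: ptr_eq mult.commute)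

lemma ent_B:
  assumes "t \<le> n"
  shows "ent D {t} (ptr D {0..n} {t} \<rho>) = kent {..<D t} (bker t)"
proof -
  have X: "{t} \<subseteq> {0..n}" using assms by auto
  have "ent D {t} (ptr D {0..n} {t} \<rho>) = kent {..<D t} (\<lambda>b b'. ptr D {0..n} {t} \<rho> (cfg1 t b) (cfg1 t b'))"
    unfolding ent_eq_kent
    by (rule kent_bij[OF cfg1_bij, symmetric]) (auto simp: finite_cfg intro: ptr_hermitian[OF X])
  also have "\<dots> = kent {..<D t} (bker t)"
  proof (rule kent_cong)
    fix b b' assume "b \<in> {..<D t}" "b' \<in> {..<D t}"
    then have "cfg1 t b \<in> cfg D {t}" "cfg1 t b' \<in> cfg D {t}" by (auto simp: cfg1_def cfg_def)
    then show "ptr D {0..n} {t} \<rho> (cfg1 t b) (cfg1 t b') = bker t b b'"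
      by (simp add: ptr_eq[OF X] merge_cfg1 bker_def)
  qed simp
  finally show ?thesis .
qed

lemma ptr_cfg2:
  assumes t: "1 \<le> t" "t \<le> n" and ab: "a < D 0" "b < D t" "a' < D 0" "b' < D t"
  shows "ptr D {0..n} {0, t} \<rho> (cfg2 t (a, b)) (cfg2 t (a', b')) = gram (env t) (abamp t) (a, b) (a', b')"
proof -
  have X: "{0, t} \<subseteq> {0..n}" using t by auto
  have "cfg2 t (a, b) \<in> cfg D {0, t}" "cfg2 t (a', b') \<in> cfg D {0, t}" using ab by (auto simp: cfg2_def cfg_def)
  then show ?thesis
    using t by (simp add: ptr_eq[OF X] merge_cfg2 gram_def env_def abamp_def sum.cartesian_product')
qed

lemma ent_AB:
  assumes t: "1 \<le> t" "t \<le> n"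
  shows "ent D {0, t} (ptr D {0..n} {0, t} \<rho>) = kent (A \<times> {..<D t}) (gram (env t) (abamp t))"
proof -
  have X: "{0, t} \<subseteq> {0..n}" using t by auto
  have t0: "t \<noteq> 0" using t by simp
  have "ent D {0, t} (ptr D {0..n} {0, t} \<rho>) =
      kent (A \<times> {..<D t}) (\<lambda>x y. ptr D {0..n} {0, t} \<rho> (cfg2 t x) (cfg2 t y))"
    unfolding ent_eq_kent
    by (rule kent_bij[OF cfg2_bij[OF t0], symmetric]) (auto simp: finite_cfg intro: ptr_hermitian[OF X])
  also have "\<dots> = kent (A \<times> {..<D t}) (gram (env t) (abamp t))"
    by (rule kent_cong) (auto simp: ptr_cfg2[OF t])
  finally show ?thesis .
qed

lemma meas_cfg2:
  assumes t: "1 \<le> t" "t \<le> n" and ab: "a < D 0" "b < D t" "a' < D 0" "b' < D t"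
  shows "meas (D 0) \<psi> (ptr D {0..n} {0, t} \<rho>) (cfg2 t (a, b)) (cfg2 t (a', b')) =
    (\<Sum>k\<in>{1..D 0}. \<psi> k a * cnj (\<psi> k a') * mker (\<psi> k) t b b')"
proof -
  have upd: "(cfg2 t (a, b))(0 := c) = cfg2 t (c, b)" for a b c using t by (auto simp: cfg2_def)
  have "(\<Sum>c<D 0. \<Sum>c'<D 0. cnj (\<psi> k c) * ptr D {0..n} {0, t} \<rho> (cfg2 t (c, b)) (cfg2 t (c', b')) * \<psi> k c')
      = mker (\<psi> k) t b b'" for k
  proof -
    have "mker (\<psi> k) t b b' = (\<Sum>z\<in>env t. \<Sum>c<D 0. \<Sum>c'<D 0. cnj (\<psi> k c) * (abamp t z (c, b) * cnj (abamp t z (c', b'))) * \<psi> k c')"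
      by (simp only: mker_def gram_def par_def hip_def cnj_sum complex_cnj_mult complex_cnj_cnj sum_product)
         (simp add: mult_ac)
    also have "\<dots> = (\<Sum>c<D 0. \<Sum>c'<D 0. \<Sum>z\<in>env t. cnj (\<psi> k c) * (abamp t z (c, b) * cnj (abamp t z (c', b'))) * \<psi> k c')"
      by (subst sum.swap, rule sum.cong[OF refl], rule sum.swap)
    also have "\<dots> = (\<Sum>c<D 0. \<Sum>c'<D 0. cnj (\<psi> k c) * gram (env t) (abamp t) (c, b) (c', b') * \<psi> k c')"
      by (simp add: gram_def sum_distrib_left sum_distrib_right)
    finally show ?thesis using ab by (simp add: ptr_cfg2[OF t])
  qed
  then show ?thesis
    using t unfolding meas_def upd by (simp add: cfg2_def)
qed

lemma meas_hermitian:
  assumes "X \<subseteq> {0..n}" "0 \<in> X" "x \<in> cfg D X" "y \<in> cfg D X"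
  shows "meas (D 0) \<psi> (ptr D {0..n} X \<rho>) x y = cnj (meas (D 0) \<psi> (ptr D {0..n} X \<rho>) y x)"
proof -
  have mem: "w(0 := a) \<in> cfg D X" if "w \<in> cfg D X" "a < D 0" for w a
    using that assms(2) by (auto simp: cfg_def)
  have "cnj (\<Sum>a<D 0. \<Sum>b<D 0. cnj (\<psi> k a) * ptr D {0..n} X \<rho> (y(0 := a)) (x(0 := b)) * \<psi> k b) =
      (\<Sum>a<D 0. \<Sum>b<D 0. cnj (\<psi> k a) * ptr D {0..n} X \<rho> (x(0 := a)) (y(0 := b)) * \<psi> k b)" for k
  proof -
    have "cnj (\<Sum>a<D 0. \<Sum>b<D 0. cnj (\<psi> k a) * ptr D {0..n} X \<rho> (y(0 := a)) (x(0 := b)) * \<psi> k b) =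
        (\<Sum>a<D 0. \<Sum>b<D 0. cnj (\<psi> k b) * ptr D {0..n} X \<rho> (x(0 := b)) (y(0 := a)) * \<psi> k a)"
      unfolding cnj_sum
    proof (intro sum.cong refl)
      fix a b assume "a \<in> A" "b \<in> A"
      then have "ptr D {0..n} X \<rho> (x(0 := b)) (y(0 := a)) = cnj (ptr D {0..n} X \<rho> (y(0 := a)) (x(0 := b)))"
        using assms by (intro ptr_hermitian mem) auto
      then show "cnj (cnj (\<psi> k a) * ptr D {0..n} X \<rho> (y(0 := a)) (x(0 := b)) * \<psi> k b) =
          cnj (\<psi> k b) * ptr D {0..n} X \<rho> (x(0 := b)) (y(0 := a)) * \<psi> k a" by simp
    qed
    then show ?thesis by (subst (asm) (2) sum.swap)
  qed
  note inner = this
  show ?thesis unfolding meas_def cnj_sum complex_cnj_mult inner[unfolded cnj_sum complex_cnj_mult]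
    by (intro sum.cong refl) (simp add: mult_ac)
qed

lemma ent_MB:
  assumes t: "1 \<le> t" "t \<le> n" and \<psi>: "orthobasis A {1..D 0} \<psi>"
  shows "ent D {0, t} (meas (D 0) \<psi> (ptr D {0..n} {0, t} \<rho>)) = (\<Sum>k\<in>{1..D 0}. kent {..<D t} (mker (\<psi> k) t))"
proof -
  have X: "{0, t} \<subseteq> {0..n}" using t by auto
  have t0: "t \<noteq> 0" using t by simp
  have "ent D {0, t} (meas (D 0) \<psi> (ptr D {0..n} {0, t} \<rho>)) =
      kent (A \<times> {..<D t}) (\<lambda>x y. meas (D 0) \<psi> (ptr D {0..n} {0, t} \<rho>) (cfg2 t x) (cfg2 t y))"
    unfolding ent_eq_kent
    by (rule kent_bij[OF cfg2_bij[OF t0], symmetric]) (auto simp: finite_cfg intro: meas_hermitian[OF X])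
  also have "\<dots> = kent (A \<times> {..<D t}) (\<lambda>(a, b) (a', b'). \<Sum>k\<in>{1..D 0}. \<psi> k a * cnj (\<psi> k a') * mker (\<psi> k) t b b')"
    by (rule kent_cong) (auto simp: meas_cfg2[OF t])
  also have "\<dots> = (\<Sum>k\<in>{1..D 0}. kent {..<D t} (mker (\<psi> k) t))"
    by (rule kent_block_diagonal[OF \<psi>]) (auto simp: mker_def intro: gram_hermitian)
  finally show ?thesis .
qed

text \<open>The left side does not mention \<open>t\<close>: the distribution of outcomes on
  \<open>A\<close>, and with it the entropy of the measured marginal, is the same whichever memory
  is kept. Splitting coordinate \<open>t\<close> off the traced-out configurations exhibits the
  trace.\<close>

lemma prob_eq:
  assumes t: "1 \<le> t" "t \<le> n"
  shows "of_real (prob \<phi>) = (\<Sum>b<D t. mker \<phi> t b b)"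
proof -
  have ins: "{0..n} - {0} = insert t ({0..n} - {0, t})" using t by auto
  have "complex_of_real (prob \<phi>) = (\<Sum>x\<in>cfg D ({0..n} - {0}). \<Sum>i\<in>I. of_real ((cmod (hip A \<phi> (\<lambda>a. \<Omega> i (x(0 := a)))))\<^sup>2))"
    by (simp add: prob_def sum.cartesian_product')
  also have "\<dots> = (\<Sum>b<D t. \<Sum>x\<in>cfg D ({0..n} - {0, t}). \<Sum>i\<in>I. of_real ((cmod (hip A \<phi> (\<lambda>a. \<Omega> i (x(t := b, 0 := a)))))\<^sup>2))"
    unfolding ins by (rule sum_cfg_insert) auto
  also have "\<dots> = (\<Sum>b<D t. mker \<phi> t b b)"
    using t by (simp add: mker_def gram_def env_def abamp_def par_def sum.cartesian_product' complex_norm_square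
        fun_upd_twist[of t 0] del: of_real_power)
  finally show ?thesis .
qed

lemma ent_M:
  assumes t: "1 \<le> t" "t \<le> n" and \<psi>: "orthobasis A {1..D 0} \<psi>"
  shows "ent D {0} (ptr D {0, t} {0} (meas (D 0) \<psi> (ptr D {0..n} {0, t} \<rho>))) = (\<Sum>k\<in>{1..D 0}. eta (prob (\<psi> k)))"
proof -
  let ?M = "meas (D 0) \<psi> (ptr D {0..n} {0, t} \<rho>)"
  have X: "{0, t} \<subseteq> {0..n}" using t by auto
  have t0: "t \<noteq> 0" using t by simp
  have df: "{0, t} - {0} = {t}" using t by auto
  have mem: "merge {0} x z \<in> cfg D {0, t}" if "x \<in> cfg D {0}" "z \<in> cfg D {t}" for x z
    using that by (auto simp: merge_def cfg_def)
  have "ent D {0} (ptr D {0, t} {0} ?M) = kent A (\<lambda>a a'. ptr D {0, t} {0} ?M (cfg1 0 a) (cfg1 0 a'))"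
    unfolding ent_eq_kent
  proof (rule kent_bij[OF cfg1_bij, symmetric])
    fix x y assume "x \<in> cfg D {0}" "y \<in> cfg D {0}"
    then show "ptr D {0, t} {0} ?M x y = cnj (ptr D {0, t} {0} ?M y x)"
      unfolding ptr_def[of D "{0, t}" "{0}"] df cnj_sum by (intro sum.cong refl meas_hermitian[OF X] mem) auto
  qed (simp add: finite_cfg)
  also have "\<dots> = kent A (\<lambda>a a'. \<Sum>k\<in>{1..D 0}. \<psi> k a * cnj (\<psi> k a') * of_real (prob (\<psi> k)))"
  proof (rule kent_cong)
    fix a a' assume aa: "a \<in> A" "a' \<in> A"
    have mt: "merge {0} (cfg1 0 a) (cfg1 t b) = cfg2 t (a, b)" for a b
      using t by (auto simp: merge_def cfg1_def cfg2_def)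
    have "ptr D {0, t} {0} ?M (cfg1 0 a) (cfg1 0 a') = (\<Sum>b<D t. ?M (cfg2 t (a, b)) (cfg2 t (a', b)))"
      unfolding ptr_def[of D "{0, t}" "{0}"] df mt[symmetric] by (rule sum.reindex_bij_betw[OF cfg1_bij, symmetric])
    also have "\<dots> = (\<Sum>b<D t. \<Sum>k\<in>{1..D 0}. \<psi> k a * cnj (\<psi> k a') * mker (\<psi> k) t b b)"
      using aa by (intro sum.cong refl meas_cfg2[OF t]) auto
    also have "\<dots> = (\<Sum>k\<in>{1..D 0}. \<psi> k a * cnj (\<psi> k a') * of_real (prob (\<psi> k)))"
      unfolding prob_eq[OF t] sum_distrib_left by (rule sum.swap)
    finally show "ptr D {0, t} {0} ?M (cfg1 0 a) (cfg1 0 a') = \<dots>" .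
  qed simp
  also have "\<dots> = (\<Sum>k\<in>{1..D 0}. eta (prob (\<psi> k)))"
    by (rule kent_diagonal[OF \<psi>])
  finally show ?thesis .
qed

lemma bker_gram:
  assumes t: "1 \<le> t" "t \<le> n"
  shows "bker t b b' = gram (A \<times> env t) (\<lambda>(a, z) b. abamp t z (a, b)) b b'"
proof -
  have ins: "{0..n} - {t} = insert 0 ({0..n} - {0, t})" using t by auto
  show ?thesis
    unfolding bker_def ins using t
    by (subst sum_cfg_insert) (auto simp: gram_def env_def abamp_def sum.cartesian_product' split_beta)
qed

lemma bipartite:
  assumes t: "1 \<le> t" "t \<le> n" and \<psi>: "orthobasis A {1..D 0} \<psi>" and \<phi>: "orthobasis A {1..D 0} \<phi>"
    and c: "\<And>k l. k \<in> {1..D 0} \<Longrightarrow> l \<in> {1..D 0} \<Longrightarrow> (cmod (hip A (\<psi> k) (\<phi> l)))\<^sup>2 \<le> c" and c0: "c > 0"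
  shows "- log 2 c + kent (A \<times> {..<D t}) (gram (env t) (abamp t)) + kent {..<D t} (bker t)
    \<le> (\<Sum>k\<in>{1..D 0}. kent {..<D t} (mker (\<psi> k) t)) + (\<Sum>k\<in>{1..D 0}. kent {..<D t} (mker (\<phi> k) t))"
proof -
  have ins: "{0..n} = insert 0 (insert t ({0..n} - {0, t}))" using t by auto
  have "(\<Sum>z\<in>env t. nsq (A \<times> {..<D t}) (abamp t z)) = (\<Sum>i\<in>I. nsq (cfg D {0..n}) (\<Omega> i))"
  proof -
    have "(\<Sum>i\<in>I. nsq (cfg D {0..n}) (\<Omega> i)) = (\<Sum>x\<in>cfg D {0..n}. \<Sum>i\<in>I. (cmod (\<Omega> i x))\<^sup>2)"
      unfolding nsq_def by (rule sum.swap)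
    also have "\<dots> = (\<Sum>a<D 0. \<Sum>b<D t. \<Sum>x\<in>cfg D ({0..n} - {0, t}). \<Sum>i\<in>I. (cmod (\<Omega> i (x(0 := a, t := b))))\<^sup>2)"
      using t by (subst ins, subst sum_cfg_insert, force, subst sum_cfg_insert, force) (simp add: fun_upd_twist[of t 0])
    also have "\<dots> = (\<Sum>z\<in>A \<times> {..<D t}. \<Sum>y\<in>env t. (cmod (abamp t y z))\<^sup>2)"
      by (simp add: env_def abamp_def sum.cartesian_product')
    also have "\<dots> = (\<Sum>z\<in>env t. nsq (A \<times> {..<D t}) (abamp t z))"
      unfolding nsq_def by (rule sum.swap)
    finally show ?thesis ..
  qed
  then have u: "(\<Sum>z\<in>env t. nsq (A \<times> {..<D t}) (abamp t z)) = 1" using unit by simp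
  have "kent {..<D t} (bker t) = kent {..<D t} (gram (A \<times> env t) (\<lambda>(a, z) b. abamp t z (a, b)))"
    by (rule kent_cong) (auto simp: bker_gram[OF t])
  then show ?thesis
    using bipartite_uncertainty[OF finite_lessThan \<psi> \<phi> _ c0 u] c unfolding mker_def by simp
qed

lemma tripartite:
  assumes t: "1 \<le> t" "t \<le> n" and s: "1 \<le> s" "s \<le> n" and ts: "t \<noteq> s"
    and \<psi>: "orthobasis A {1..D 0} \<psi>" and \<phi>: "orthobasis A {1..D 0} \<phi>"
    and c: "\<And>k l. k \<in> {1..D 0} \<Longrightarrow> l \<in> {1..D 0} \<Longrightarrow> (cmod (hip A (\<psi> k) (\<phi> l)))\<^sup>2 \<le> c" and c0: "c > 0"
  shows "- log 2 c + kent {..<D t} (bker t) + kent {..<D s} (bker s)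
    \<le> (\<Sum>k\<in>{1..D 0}. kent {..<D t} (mker (\<psi> k) t)) + (\<Sum>k\<in>{1..D 0}. kent {..<D s} (mker (\<phi> k) s))"
proof -
  define Y where "Y = {0..n} - {0, t, s}"
  \<comment> \<open>All subsystems other than \<open>A\<close> and the two memories, together with
    the purifying label, form the remainder.\<close>
  define R where "R = cfg D Y \<times> I"
  define F where "F = (\<lambda>(a, b, c, z, i). \<Omega> i (z(0 := a, t := b, s := c)))"
  have Y: "s \<notin> Y" "t \<notin> Y" "0 \<notin> Y" "t \<noteq> 0" "s \<noteq> 0" using t s by (auto simp: Y_def)
  have U: "{0..n} = insert 0 (insert t (insert s Y))" and Ut: "{0..n} - {0, t} = insert s Y"
    and Us: "{0..n} - {0, s} = insert t Y" using t s ts by (auto simp: Y_def)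
  have finR: "finite R" using fin by (simp add: R_def Y_def finite_cfg)
  have tw: "z(s := c, 0 := a, t := b) = z(0 := a, t := b, s := c)" "z(t := b, 0 := a, s := c) = z(0 := a, t := b, s := c)"
    for z :: "nat \<Rightarrow> nat" and a b c using Y ts by (auto simp: fun_eq_iff)
  have "nsq (A \<times> {..<D t} \<times> {..<D s} \<times> R) F = (\<Sum>i\<in>I. nsq (cfg D {0..n}) (\<Omega> i))"
  proof -
    have "(\<Sum>i\<in>I. nsq (cfg D {0..n}) (\<Omega> i)) = (\<Sum>x\<in>cfg D {0..n}. \<Sum>i\<in>I. (cmod (\<Omega> i x))\<^sup>2)"
      unfolding nsq_def by (rule sum.swap)
    also have "\<dots> = (\<Sum>a<D 0. \<Sum>b<D t. \<Sum>c<D s. \<Sum>x\<in>cfg D Y. \<Sum>i\<in>I. (cmod (\<Omega> i (x(s := c, t := b, 0 := a))))\<^sup>2)"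
      unfolding U using Y ts by (simp add: sum_cfg_insert)
    also have "\<dots> = (\<Sum>a<D 0. \<Sum>b<D t. \<Sum>c<D s. \<Sum>x\<in>cfg D Y. \<Sum>i\<in>I. (cmod (\<Omega> i (x(0 := a, t := b, s := c))))\<^sup>2)"
    proof -
      have "x(s := c, t := b, 0 := a) = x(0 := a, t := b, s := c)" for x :: "nat \<Rightarrow> nat" and a b c
        using Y ts by (auto simp: fun_eq_iff)
      then show ?thesis by simp
    qed
    finally show ?thesis by (simp add: nsq_def F_def R_def sum.cartesian_product')
  qed
  then have u: "nsq (A \<times> {..<D t} \<times> {..<D s} \<times> R) F = 1" using unit by simp
  have 1: "kent {..<D t} (bker t) = kent {..<D t} (gram (A \<times> {..<D s} \<times> R) (\<lambda>(a, z) b. F (a, b, z)))"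
    by (rule kent_cong)
       (simp_all add: bker_gram[OF t] gram_def env_def Ut sum.cartesian_product' sum_cfg_insert[OF Y(1)] abamp_def F_def R_def tw)
  have 2: "kent {..<D s} (bker s) = kent {..<D s} (gram (A \<times> {..<D t} \<times> R) (\<lambda>(a, b, z) c. F (a, b, c, z)))"
    by (rule kent_cong)
       (simp_all add: bker_gram[OF s] gram_def env_def Us sum.cartesian_product' sum_cfg_insert[OF Y(2)] abamp_def F_def R_def tw)
  have 3: "kent {..<D t} (mker x t) = kent {..<D t} (gram ({..<D s} \<times> R) (\<lambda>z b. par A x F (b, z)))" for x
    by (rule kent_cong)
       (simp_all add: mker_def gram_def env_def Ut sum.cartesian_product' sum_cfg_insert[OF Y(1)] abamp_def F_def R_def par_def tw)
  have 4: "kent {..<D s} (mker x s) = kent {..<D s} (gram ({..<D t} \<times> R) (\<lambda>(b, z) c. par A x F (b, c, z)))" for x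
    by (rule kent_cong)
       (simp_all add: mker_def gram_def env_def Us sum.cartesian_product' sum_cfg_insert[OF Y(2)] abamp_def F_def R_def par_def tw)
  show ?thesis
    unfolding 1 2 3 4
    by (rule tripartite_uncertainty[OF finite_lessThan finite_lessThan finR \<psi> \<phi> _ c0 u]) (rule c)
qed

lemma chain:
  assumes \<phi>: "orthobasis A {1..D 0} \<phi>" and \<psi>: "orthobasis A {1..D 0} \<psi>"
    and \<beta>: "\<And>l. l \<in> {1..D 0} \<Longrightarrow> \<beta> l \<ge> 0" and \<beta>': "\<And>k. k \<in> {1..D 0} \<Longrightarrow> \<beta>' k > 0"
    and nest: "\<And>l. l \<in> {1..D 0} \<Longrightarrow> \<beta> l = 0 \<Longrightarrow> prob (\<phi> l) = 0"
    and le: "\<And>k. k \<in> {1..D 0} \<Longrightarrow> (\<Sum>l\<in>{1..D 0}. \<beta> l * (cmod (hip A (\<phi> l) (\<psi> k)))\<^sup>2) \<le> \<beta>' k"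
  shows "(\<Sum>l\<in>{1..D 0}. prob (\<phi> l) * log 2 (\<beta> l)) + kent A (bker 0)
    \<le> (\<Sum>k\<in>{1..D 0}. prob (\<psi> k) * log 2 (\<beta>' k)) + (\<Sum>k\<in>{1..D 0}. eta (prob (\<psi> k)))"
proof -
  have "kent A (bker 0) = kent A (gram (cfg D ({0..n} - {0}) \<times> I) (\<lambda>z a. \<Omega> (snd z) ((fst z)(0 := a))))"
    by (rule kent_cong) (simp_all add: bker_def gram_def sum.cartesian_product')
  then show ?thesis
    unfolding prob_def
    by (simp only:, intro chain_step \<phi> \<psi> \<beta> \<beta>' nest[unfolded prob_def])
       (use le in \<open>simp_all add: hip_cmod_commute[of A "\<psi> _" "\<phi> _"]\<close>)
qed

lemma prob_nonneg: "prob \<phi> \<ge> 0"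
  by (simp add: prob_def sum_nonneg)

lemma prob_total:
  assumes "orthobasis A {1..D 0} \<psi>"
  shows "(\<Sum>k\<in>{1..D 0}. prob (\<psi> k)) = 1"
proof -
  have ins: "{0..n} = insert 0 ({0..n} - {0})" by auto
  have "(\<Sum>k\<in>{1..D 0}. prob (\<psi> k)) = (\<Sum>z\<in>cfg D ({0..n} - {0}) \<times> I. nsq A (\<lambda>a. \<Omega> (snd z) ((fst z)(0 := a))))"
    unfolding prob_def by (subst sum.swap) (simp only: parseval[OF assms])
  also have "\<dots> = (\<Sum>x\<in>cfg D ({0..n} - {0}). \<Sum>i\<in>I. \<Sum>a<D 0. (cmod (\<Omega> i (x(0 := a))))\<^sup>2)"
    by (simp add: nsq_def sum.cartesian_product')
  also have "\<dots> = (\<Sum>a<D 0. \<Sum>x\<in>cfg D ({0..n} - {0}). \<Sum>i\<in>I. (cmod (\<Omega> i (x(0 := a))))\<^sup>2)"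
    by (rule trans[OF sum.cong[OF refl sum.swap] sum.swap])
  also have "\<dots> = (\<Sum>x\<in>cfg D {0..n}. \<Sum>i\<in>I. (cmod (\<Omega> i x))\<^sup>2)"
    by (subst (2) ins, subst sum_cfg_insert) auto
  also have "\<dots> = 1"
    unfolding unit[symmetric] nsq_def by (rule sum.swap)
  finally show ?thesis .
qed

end

subsection \<open>Products over configurations of basis labels\<close>

text \<open>Transfer-matrix recursion for the sum inside \<open>b\<close>: for
  \<open>j \<ge> 1\<close> the label \<open>l\<close> belongs to measurement \<open>j + 1\<close>,
  the labels of measurements 2 to \<open>j\<close> are summed over, and the first label is
  maximised.\<close>

fun path_weight :: "nat \<Rightarrow> (nat \<Rightarrow> nat \<Rightarrow> nat \<Rightarrow> real) \<Rightarrow> nat \<Rightarrow> nat \<Rightarrow> real" where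
  "path_weight d w 0 l = 0"
| "path_weight d w (Suc 0) l = Max ((\<lambda>k. w 1 k l) ` {1..d})"
| "path_weight d w (Suc (Suc j)) l = (\<Sum>k\<in>{1..d}. path_weight d w (Suc j) k * w (j + 2) k l)"

text \<open>The induction splits off the last intermediate label, which ends the shorter
  path.\<close>

lemma path_weight_eq_sum:
  "path_weight d w (Suc j) l = (\<Sum>kk\<in>PiE {2..j + 1} (\<lambda>_. {1..d}). let k = kk(j + 2 := l) in
     Max ((\<lambda>k1. w 1 k1 (k 2)) ` {1..d}) * (\<Prod>i\<in>{2..j + 1}. w i (k i) (k (i + 1))))"
proof (induction j arbitrary: l)
  \<comment> \<open>Here \<open>{2..1}\<close> is empty, the sum has the single function
    \<open>undefined\<close> everywhere, and the update supplies \<open>k 2 = l\<close>.\<close>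
  case 0
  show ?case by simp
next
  case (Suc j)
  define F where "F k = Max ((\<lambda>k1. w 1 k1 (k 2)) ` {1..d}) * (\<Prod>i\<in>{2..j + 1}. w i (k i) (k (i + 1)))" for k
  have ins: "{2..Suc j + 1} = insert (j + 2) {2..j + 1}" by auto
  have "(\<Sum>kk\<in>PiE {2..Suc j + 1} (\<lambda>_. {1..d}). let k = kk(Suc j + 2 := l) in
      Max ((\<lambda>k1. w 1 k1 (k 2)) ` {1..d}) * (\<Prod>i\<in>{2..Suc j + 1}. w i (k i) (k (i + 1)))) =
      (\<Sum>kk\<in>PiE (insert (j + 2) {2..j + 1}) (\<lambda>_. {1..d}). F kk * w (j + 2) (kk (j + 2)) l)"
    unfolding ins
  proof (intro sum.cong refl)
    fix kk
    let ?k = "kk(Suc j + 2 := l)"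
    have "(\<Prod>i\<in>{2..j + 1}. w i (?k i) (?k (i + 1))) = (\<Prod>i\<in>{2..j + 1}. w i (kk i) (kk (i + 1)))"
      by (intro prod.cong) auto
    then show "(let k = ?k in Max ((\<lambda>k1. w 1 k1 (k 2)) ` {1..d}) *
        (\<Prod>i\<in>insert (j + 2) {2..j + 1}. w i (k i) (k (i + 1)))) = F kk * w (j + 2) (kk (j + 2)) l"
      by (simp add: Let_def F_def)
  qed
  also have "\<dots> = (\<Sum>(y, g)\<in>{1..d} \<times> PiE {2..j + 1} (\<lambda>_. {1..d}). F (g(j + 2 := y)) * w (j + 2) y l)"
  proof -
    have "inj_on (\<lambda>(y, g). g(j + 2 := y)) ({1..d} \<times> PiE {2..j + 1} (\<lambda>_. {1..d}))"
      by (rule inj_combinator) simp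
    then show ?thesis
      unfolding PiE_insert_eq by (subst sum.reindex) (auto simp: case_prod_unfold)
  qed
  also have "\<dots> = (\<Sum>y\<in>{1..d}. (\<Sum>g\<in>PiE {2..j + 1} (\<lambda>_. {1..d}). F (g(j + 2 := y))) * w (j + 2) y l)"
    by (simp add: sum.cartesian_product sum_distrib_right)
  also have "\<dots> = path_weight d w (Suc (Suc j)) l"
    by (simp only: path_weight.simps Suc.IH F_def Let_def)
  finally show ?case ..
qed

text \<open>Logarithms of these weights are taken, so they must not vanish. Positivity propagates
  because every label has a predecessor with nonzero overlap.\<close>

lemma path_weight_pos:
  assumes d: "d > 0" and nn: "\<And>j k l. w j k l \<ge> (0::real)"
    and ex: "\<And>i l. l \<in> {1..d} \<Longrightarrow> 1 \<le> i \<Longrightarrow> i \<le> j \<Longrightarrow> \<exists>k\<in>{1..d}. w i k l > 0"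
    and "1 \<le> j" "l \<in> {1..d}"
  shows "path_weight d w j l > 0"
  using assms(4,5) ex
proof (induction j arbitrary: l rule: nat_induct_at_least)
  case base
  obtain k where k: "k \<in> {1..d}" "w 1 k l > 0" using base.prems(2)[OF base.prems(1) le_refl le_refl] by blast
  have "w 1 k l \<le> Max ((\<lambda>k. w 1 k l) ` {1..d})"
    by (rule Max_ge[OF _ imageI[OF k(1)]]) simp
  with k have "0 < Max ((\<lambda>k. w 1 k l) ` {1..d})" by linarith
  then show ?case by simp
next
  case (Suc j)
  obtain i where i: "j = Suc i" using Suc.hyps by (cases j) auto
  obtain k where k: "k \<in> {1..d}" "w (i + 2) k l > 0" using Suc.prems(2)[OF Suc.prems(1), of "i + 2"] i by auto
  have pos: "path_weight d w (Suc i) k > 0" if "k \<in> {1..d}" for k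
    unfolding i[symmetric] by (rule Suc.IH[OF that]) (rule Suc.prems(2), auto)
  show ?case
    unfolding i path_weight.simps
  proof (rule sum_pos2[of _ k])
    show "0 < path_weight d w (Suc i) k * w (i + 2) k l"
      using pos[OF k(1)] k(2) by (rule mult_pos_pos)
    show "0 \<le> path_weight d w (Suc i) k' * w (i + 2) k' l" if "k' \<in> {1..d}" for k'
      using less_imp_le[OF pos[OF that]] nn by (rule mult_nonneg_nonneg)
  qed (simp, rule k(1))
qed

lemma sum_eq_1_imp_pos:
  fixes f :: "'k \<Rightarrow> real"
  assumes "sum f K = 1"
  shows "\<exists>k\<in>K. f k > 0"
proof (rule ccontr)
  assume "\<not> (\<exists>k\<in>K. f k > 0)"
  then have "sum f K \<le> 0" by (intro sum_nonpos) (auto simp: not_less)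
  then show False using assms by simp
qed

lemma sum_pairs:
  fixes f :: "nat \<Rightarrow> nat \<Rightarrow> real"
  assumes "\<And>i j. f i j = f j i"
  shows "(\<Sum>i\<in>{1..m}. \<Sum>j\<in>{1..m}. f i j) = 2 * (\<Sum>i\<in>{1..m}. \<Sum>j\<in>{i+1..m}. f i j) + (\<Sum>i\<in>{1..m}. f i i)"
proof (induction m)
  case (Suc m)
  have "(\<Sum>i\<in>{1..Suc m}. \<Sum>j\<in>{i+1..Suc m}. f i j) = (\<Sum>i\<in>{1..m}. (\<Sum>j\<in>{i+1..m}. f i j) + f i (Suc m))"
    by (simp add: sum.cl_ivl_Suc)
  moreover have "(\<Sum>i\<in>{1..Suc m}. \<Sum>j\<in>{1..Suc m}. f i j) =
      (\<Sum>i\<in>{1..m}. \<Sum>j\<in>{1..m}. f i j) + 2 * (\<Sum>i\<in>{1..m}. f i (Suc m)) + f (Suc m) (Suc m)"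
  proof -
    have "(\<Sum>j\<in>{1..m}. f (Suc m) j) = (\<Sum>i\<in>{1..m}. f i (Suc m))"
      by (intro sum.cong refl assms)
    then show ?thesis by (simp add: sum.distrib)
  qed
  ultimately show ?case using Suc by (simp add: sum.distrib)
qed simp

subsection \<open>The inequality for several measurements without memory\<close>

context purification
begin

lemma transition_weight:
  assumes "orthobasis A {1..D 0} \<phi>" "orthobasis A {1..D 0} \<psi>" "l \<in> {1..D 0}"
  shows "\<exists>k\<in>{1..D 0}. (cmod (hip A (\<phi> k) (\<psi> l)))\<^sup>2 > 0"
proof -
  have "orthonormal A {1..D 0} \<psi>" using assms(2) by (simp add: orthobasis_def)
  from sum_eq_1_imp_pos[OF weights_sum1[OF assms(1) this assms(3)]]
  show ?thesis by (subst hip_cmod_commute)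
qed

text \<open>\<open>chain\<close> is iterated along the bases, each link adding one S(A) and the
  entropy of one more measurement. The logarithmic terms telescope, since the weights reached by one
  link are the weights from which the next one starts.\<close>

lemma multiple_measurements:
  fixes \<psi> :: "nat \<Rightarrow> nat \<Rightarrow> nat \<Rightarrow> complex"
  defines "w \<equiv> \<lambda>i k l. (cmod (hip A (\<psi> i k) (\<psi> (Suc i) l)))\<^sup>2"
  assumes d: "D 0 > 0" and \<psi>: "\<And>i. 1 \<le> i \<Longrightarrow> i \<le> m \<Longrightarrow> orthobasis A {1..D 0} (\<psi> i)"
    and j: "1 \<le> j" "Suc j \<le> m"
  shows "path_weight (D 0) w j l > 0 \<or> l \<notin> {1..D 0}"
    and "real j * kent A (bker 0) \<le> (\<Sum>k\<in>{1..D 0}. prob (\<psi> (Suc j) k) * log 2 (path_weight (D 0) w j k))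
    + (\<Sum>i\<in>{1..Suc j}. \<Sum>k\<in>{1..D 0}. eta (prob (\<psi> i k)))"
proof -
  have pos: "path_weight (D 0) w j k > 0" if "k \<in> {1..D 0}" "1 \<le> j" "Suc j \<le> m" for j k
  proof (rule path_weight_pos[OF d _ _ that(2,1)])
    fix i l assume "l \<in> {1..D 0}" "1 \<le> i" "i \<le> j"
    then show "\<exists>k\<in>{1..D 0}. w i k l > 0"
      unfolding w_def using that by (intro transition_weight \<psi>) auto
  qed (simp add: w_def)
  then show "path_weight (D 0) w j l > 0 \<or> l \<notin> {1..D 0}" using j by blast
  show "real j * kent A (bker 0) \<le> (\<Sum>k\<in>{1..D 0}. prob (\<psi> (Suc j) k) * log 2 (path_weight (D 0) w j k))
    + (\<Sum>i\<in>{1..Suc j}. \<Sum>k\<in>{1..D 0}. eta (prob (\<psi> i k)))"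
    using j
  proof (induction j rule: nat_induct_at_least)
    case base
    have ob: "orthobasis A {1..D 0} (\<psi> 1)" "orthobasis A {1..D 0} (\<psi> (Suc 1))" using \<psi> base by auto
    \<comment> \<open>The chain starts from the outcome probabilities of the first measurement as
      weights: their logarithmic term is minus its entropy. Averaging the first overlaps with these
      probabilities is at most their maximum, the origin of the maximum over the first label in
      \<open>b\<close>.\<close>
    have "(\<Sum>l\<in>{1..D 0}. prob (\<psi> 1 l) * log 2 (prob (\<psi> 1 l))) + kent A (bker 0)
      \<le> (\<Sum>k\<in>{1..D 0}. prob (\<psi> (Suc 1) k) * log 2 (path_weight (D 0) w 1 k))
        + (\<Sum>k\<in>{1..D 0}. eta (prob (\<psi> (Suc 1) k)))"
    proof (rule chain[OF ob prob_nonneg])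
      fix k assume k: "k \<in> {1..D 0}"
      show "path_weight (D 0) w 1 k > 0" by (rule pos[OF k]) (use base in auto)
      have "(\<Sum>l\<in>{1..D 0}. prob (\<psi> 1 l) * (cmod (hip A (\<psi> 1 l) (\<psi> (Suc 1) k)))\<^sup>2) \<le>
          (\<Sum>l\<in>{1..D 0}. prob (\<psi> 1 l) * path_weight (D 0) w 1 k)"
      proof (intro sum_mono mult_left_mono prob_nonneg)
        fix l assume "l \<in> {1..D 0}"
        then have "w 1 l k \<le> Max ((\<lambda>l. w 1 l k) ` {1..D 0})" by (intro Max_ge) auto
        then show "(cmod (hip A (\<psi> 1 l) (\<psi> (Suc 1) k)))\<^sup>2 \<le> path_weight (D 0) w 1 k"
          by (simp add: w_def)
      qed
      also have "\<dots> = path_weight (D 0) w 1 k"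
        unfolding sum_distrib_right[symmetric] prob_total[OF ob(1)] by simp
      finally show "(\<Sum>l\<in>{1..D 0}. prob (\<psi> 1 l) * (cmod (hip A (\<psi> 1 l) (\<psi> (Suc 1) k)))\<^sup>2) \<le> path_weight (D 0) w 1 k" .
    qed
    moreover have "(\<Sum>l\<in>{1..D 0}. prob (\<psi> 1 l) * log 2 (prob (\<psi> 1 l))) = - (\<Sum>l\<in>{1..D 0}. eta (prob (\<psi> 1 l)))"
      unfolding sum_negf[symmetric] by (intro sum.cong refl) (simp add: eta_ln prob_nonneg log_def)
    ultimately show ?case by simp
  next
    case (Suc j)
    have "(\<Sum>l\<in>{1..D 0}. prob (\<psi> (Suc j) l) * log 2 (path_weight (D 0) w j l)) + kent A (bker 0)
      \<le> (\<Sum>k\<in>{1..D 0}. prob (\<psi> (Suc (Suc j)) k) * log 2 (path_weight (D 0) w (Suc j) k))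
        + (\<Sum>k\<in>{1..D 0}. eta (prob (\<psi> (Suc (Suc j)) k)))"
    proof (rule chain)
      fix l assume l: "l \<in> {1..D 0}"
      have pl: "path_weight (D 0) w j l > 0" by (rule pos[OF l]) (use Suc in auto)
      then show "path_weight (D 0) w j l \<ge> 0" by simp
      show "path_weight (D 0) w (Suc j) l > 0" by (rule pos[OF l]) (use Suc in auto)
      show "prob (\<psi> (Suc j) l) = 0" if "path_weight (D 0) w j l = 0" using pl that by simp
      obtain i where "j = Suc i" using Suc.hyps by (cases j) auto
      then show "(\<Sum>k\<in>{1..D 0}. path_weight (D 0) w j k * (cmod (hip A (\<psi> (Suc j) k) (\<psi> (Suc (Suc j)) l)))\<^sup>2)
          \<le> path_weight (D 0) w (Suc j) l"
        by (simp add: w_def)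
    qed (use \<psi> Suc in auto)
    moreover have "real j * kent A (bker 0) \<le> (\<Sum>k\<in>{1..D 0}. prob (\<psi> (Suc j) k) * log 2 (path_weight (D 0) w j k))
      + (\<Sum>i\<in>{1..Suc j}. \<Sum>k\<in>{1..D 0}. eta (prob (\<psi> i k)))"
      using Suc.IH Suc.prems by simp
    moreover have "(\<Sum>i\<in>{1..Suc (Suc j)}. g i) = (\<Sum>i\<in>{1..Suc j}. g i) + g (Suc (Suc j))" for g :: "nat \<Rightarrow> real"
      by simp
    ultimately show ?case by (simp only: of_nat_Suc distrib_right)
  qed
qed

end

theorem theorem2:
  fixes m n d :: nat
    and D :: "nat \<Rightarrow> nat"
    and \<rho> :: op
    and \<psi> :: "nat \<Rightarrow> nat \<Rightarrow> nat \<Rightarrow> complex"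
    and S :: "nat \<Rightarrow> nat set"
  assumes m2: "m \<ge> 2" and n1: "1 \<le> n" and nm: "n \<le> m"
    and dA: "D 0 = d" and dpos: "\<forall>k\<le>n. 0 < D k"
    and dens: "is_density D {0..n} \<rho>"
    and onb: "\<forall>i\<in>{1..m}. \<forall>k\<in>{1..d}. \<forall>l\<in>{1..d}.
                ip d (\<psi> i k) (\<psi> i l) = (if k = l then 1 else 0)"
    and Sne: "\<forall>t\<in>{1..n}. S t \<noteq> {}"
    and Sdisj: "\<forall>t\<in>{1..n}. \<forall>t'\<in>{1..n}. t \<noteq> t' \<longrightarrow> S t \<inter> S t' = {}"
    and Sun: "(\<Union>t\<in>{1..n}. S t) = {1..m}"
  shows
    "let c = (\<lambda>i j. Max {(cmod (ip d (\<psi> i k) (\<psi> j l)))\<^sup>2 | k l. k \<in> {1..d} \<and> l \<in> {1..d}});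
         C = (\<Prod>i\<in>{1..m}. \<Prod>j\<in>{i+1..m}. c i j);
         b = Max ((\<lambda>km. \<Sum>kk\<in>PiE {2..m-1} (\<lambda>_. {1..d}).
                    let k = kk(m := km) in
                    (Max ((\<lambda>k1. (cmod (ip d (\<psi> 1 k1) (\<psi> 2 (k 2))))\<^sup>2) ` {1..d})) *
                    (\<Prod>i\<in>{2..m-1}. (cmod (ip d (\<psi> i (k i)) (\<psi> (i+1) (k (i+1)))))\<^sup>2)) ` {1..d});
         mt = (\<lambda>t. real (card (S t)));
         SA = ent D {0} (ptr D {0..n} {0} \<rho>);
         SB = (\<lambda>t. ent D {t} (ptr D {0..n} {t} \<rho>));
         SAB = (\<lambda>t. ent D {0, t} (ptr D {0..n} {0, t} \<rho>));
         condAB = (\<lambda>t. SAB t - SB t);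
         IAB = (\<lambda>t. SA + SB t - SAB t);
         \<rho>MB = (\<lambda>i t. meas d (\<psi> i) (ptr D {0..n} {0, t} \<rho>));
         SMB = (\<lambda>i t. ent D {0, t} (\<rho>MB i t));
         SM = (\<lambda>i t. ent D {0} (ptr D {0, t} {0} (\<rho>MB i t)));
         condMB = (\<lambda>i t. SMB i t - SB t);
         IMB = (\<lambda>i t. SM i t + SB t - SMB i t);
         \<delta> = 1 / (real m - 1) * log 2 (C / b ^ (m - 1)) + (real m - 1) * SA
             - (\<Sum>t\<in>{1..n}. mt t * (mt t - 1) / (2 * (real m - 1)) * SA)
             + (\<Sum>t\<in>{1..n}. mt t * (mt t - 1) / (2 * (real m - 1)) * IAB t)
             - (\<Sum>t\<in>{1..n}. \<Sum>i\<in>S t. IMB i t)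
     in (\<Sum>t\<in>{1..n}. \<Sum>i\<in>S t. condMB i t)
          \<ge> - 1 / (real m - 1) * log 2 C
            + 1 / (real m - 1) * (\<Sum>t\<in>{1..n}. mt t * (mt t - 1) / 2 * condAB t)
            + max 0 \<delta>"
proof -
  define c where "c = (\<lambda>i j. Max {(cmod (ip d (\<psi> i k) (\<psi> j l)))\<^sup>2 | k l. k \<in> {1..d} \<and> l \<in> {1..d}})"
  define C where "C = (\<Prod>i\<in>{1..m}. \<Prod>j\<in>{i+1..m}. c i j)"
  define b where "b = Max ((\<lambda>km. \<Sum>kk\<in>PiE {2..m-1} (\<lambda>_. {1..d}).
                    let k = kk(m := km) in
                    (Max ((\<lambda>k1. (cmod (ip d (\<psi> 1 k1) (\<psi> 2 (k 2))))\<^sup>2) ` {1..d})) *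
                    (\<Prod>i\<in>{2..m-1}. (cmod (ip d (\<psi> i (k i)) (\<psi> (i+1) (k (i+1)))))\<^sup>2)) ` {1..d})"
  define mt where "mt = (\<lambda>t. real (card (S t)))"
  define SA where "SA = ent D {0} (ptr D {0..n} {0} \<rho>)"
  define SB where "SB = (\<lambda>t. ent D {t} (ptr D {0..n} {t} \<rho>))"
  define SAB where "SAB = (\<lambda>t. ent D {0, t} (ptr D {0..n} {0, t} \<rho>))"
  define SMB where "SMB = (\<lambda>i t. ent D {0, t} (meas d (\<psi> i) (ptr D {0..n} {0, t} \<rho>)))"
  define SM where "SM = (\<lambda>i t. ent D {0} (ptr D {0, t} {0} (meas d (\<psi> i) (ptr D {0..n} {0, t} \<rho>))))"
  define \<delta> where "\<delta> = 1 / (real m - 1) * log 2 (C / b ^ (m - 1)) + (real m - 1) * SA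
             - (\<Sum>t\<in>{1..n}. mt t * (mt t - 1) / (2 * (real m - 1)) * SA)
             + (\<Sum>t\<in>{1..n}. mt t * (mt t - 1) / (2 * (real m - 1)) * (SA + SB t - SAB t))
             - (\<Sum>t\<in>{1..n}. \<Sum>i\<in>S t. SM i t + SB t - SMB i t)"

  obtain \<Omega> where \<Omega>: "\<And>x y. x \<in> cfg D {0..n} \<Longrightarrow> y \<in> cfg D {0..n} \<Longrightarrow>
      \<rho> x y = (\<Sum>i\<in>cfg D {0..n}. \<Omega> i x * cnj (\<Omega> i y))"
    "(\<Sum>i\<in>cfg D {0..n}. nsq (cfg D {0..n}) (\<Omega> i)) = 1"
    using density_purification[OF dens] by blast
  interpret purification D n "cfg D {0..n}" \<Omega> \<rho>
    by unfold_locales (use \<Omega> in \<open>auto simp: finite_cfg\<close>)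
  have d: "D 0 > 0" using dpos by auto
  have ip: "ip d u v = hip A u v" for u v by (simp add: ip_def hip_def dA)
  have ob: "orthobasis A {1..D 0} (\<psi> i)" if "1 \<le> i" "i \<le> m" for i
    by (rule orthonormal_imp_orthobasis) (use onb that dA in \<open>auto simp: orthonormal_def ip\<close>)

  have c_le: "(cmod (hip A (\<psi> i k) (\<psi> j l)))\<^sup>2 \<le> c i j" if "k \<in> {1..D 0}" "l \<in> {1..D 0}" for i j k l
  proof -
    have "finite {(cmod (ip d (\<psi> i k) (\<psi> j l)))\<^sup>2 | k l. k \<in> {1..d} \<and> l \<in> {1..d}}"
      by (rule finite_image_set2) simp_all
    then show ?thesis unfolding c_def by (rule Max_ge) (use that dA in \<open>auto simp: ip\<close>)
  qed
  \<comment> \<open>The squared overlaps of one basis vector with a whole basis sum to 1, so at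
    least one of them is positive.\<close>
  have c_pos: "c i j > 0" if "1 \<le> i" "i \<le> m" "1 \<le> j" "j \<le> m" for i j
  proof -
    have "(\<Sum>l\<in>{1..D 0}. (cmod (hip A (\<psi> i 1) (\<psi> j l)))\<^sup>2) = 1"
      using weights_sum1[OF ob[OF that(3,4)], of "{1..D 0}" "\<psi> i" 1] ob[OF that(1,2)] d
      by (simp add: orthobasis_def)
    from sum_eq_1_imp_pos[OF this] obtain l where l: "l \<in> {1..D 0}" "(cmod (hip A (\<psi> i 1) (\<psi> j l)))\<^sup>2 > 0" ..
    have "(cmod (hip A (\<psi> i 1) (\<psi> j l)))\<^sup>2 \<le> c i j" using l(1) d by (intro c_le) auto
    with l(2) show ?thesis by linarith
  qed
  \<comment> \<open>The index of the memory assigned to measurement \<open>i\<close>. It turns the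
    double sums over \<open>t\<close> and \<open>S t\<close> into sums over all
    measurements.\<close>
  define \<tau> where "\<tau> i = (THE t. t \<in> {1..n} \<and> i \<in> S t)" for i
  have \<tau>: "\<tau> i = t" if "t \<in> {1..n}" "i \<in> S t" for i t
    unfolding \<tau>_def
  proof (rule the_equality)
    show "t \<in> {1..n} \<and> i \<in> S t" using that by simp
    show "t' = t" if t': "t' \<in> {1..n} \<and> i \<in> S t'" for t'
    proof (rule ccontr)
      assume "t' \<noteq> t"
      then have "S t' \<inter> S t = {}" using Sdisj[rule_format, of t' t] t' \<open>t \<in> {1..n}\<close> by blast
      then show False using t' \<open>i \<in> S t\<close> by blast
    qed
  qed
  have \<tau>_mem: "\<tau> i \<in> {1..n} \<and> i \<in> S (\<tau> i)" if "i \<in> {1..m}" for i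
  proof -
    have "i \<in> (\<Union>t\<in>{1..n}. S t)" unfolding Sun by (rule that)
    then obtain t where t: "t \<in> {1..n}" "i \<in> S t" by blast
    then show ?thesis unfolding \<tau>[OF t] by blast
  qed
  have finS: "finite (S t)" if "t \<in> {1..n}" for t
  proof -
    have "S t \<subseteq> {1..m}" unfolding Sun[symmetric] using that by blast
    then show ?thesis by (rule finite_subset) simp
  qed
  have regroup: "(\<Sum>t\<in>{1..n}. \<Sum>i\<in>S t. g i t) = (\<Sum>i\<in>{1..m}. g i (\<tau> i))" for g :: "nat \<Rightarrow> nat \<Rightarrow> real"
  proof -
    have "(\<Sum>t\<in>{1..n}. \<Sum>i\<in>S t. g i t) = (\<Sum>t\<in>{1..n}. \<Sum>i\<in>S t. g i (\<tau> i))"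
    proof (intro sum.cong refl)
      fix t i assume "t \<in> {1..n}" "i \<in> S t"
      from \<tau>[OF this] show "g i t = g i (\<tau> i)" by simp
    qed
    also have "\<dots> = (\<Sum>i\<in>{1..m}. g i (\<tau> i))"
      unfolding Sun[symmetric] by (rule sum.UNION_disjoint[OF finite_atLeastAtMost _ Sdisj, symmetric]) (use finS in blast)
    finally show ?thesis .
  qed
  define a where "a i = SMB i (\<tau> i) - SB (\<tau> i)" for i
  define K where "K t = SAB t - SB t" for t
  \<comment> \<open>The conditional entropy of \<open>A\<close> appears only for pairs with a common
    memory. For different memories the tripartite relation gives the bound without it, and the
    subtracted memory entropies are those of the two sides.\<close>
  have pair: "(if \<tau> i = \<tau> j then K (\<tau> i) else 0) - log 2 (c i j) \<le> a i + a j"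
    if ij: "i \<in> {1..m}" "j \<in> {1..m}" for i j
  proof -
    have obi: "orthobasis A {1..D 0} (\<psi> i)" and obj: "orthobasis A {1..D 0} (\<psi> j)" and c0: "c i j > 0"
      using ij ob c_pos by auto
    have t: "1 \<le> \<tau> i" "\<tau> i \<le> n" "1 \<le> \<tau> j" "\<tau> j \<le> n" using \<tau>_mem ij by auto
    note MB = ent_MB[OF t(1,2) obi] ent_MB[OF t(3,4) obj]
    show ?thesis
    proof (cases "\<tau> i = \<tau> j")
      case True
      then show ?thesis
        using bipartite[OF t(1,2) obi obj c_le c0] MB ent_B[OF t(2)] ent_AB[OF t(1,2)]
        by (simp add: a_def K_def SMB_def SB_def SAB_def dA)
    next
      case False
      then show ?thesis
        using tripartite[OF t False obi obj c_le c0] MB ent_B[OF t(2)] ent_B[OF t(4)]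
        by (simp add: a_def K_def SMB_def SB_def SAB_def dA)
    qed
  qed
  define m' where "m' = real m - 1"
  have m': "m' > 0" using m2 by (simp add: m'_def)
  \<comment> \<open>Every measurement belongs to \<open>m - 1\<close> unordered pairs.\<close>
  have pairs_a: "(\<Sum>i\<in>{1..m}. \<Sum>j\<in>{i+1..m}. a i + a j) = m' * (\<Sum>i\<in>{1..m}. a i)"
  proof -
    have "(\<Sum>i\<in>{1..m}. \<Sum>j\<in>{1..m}. a i + a j) =
        2 * (\<Sum>i\<in>{1..m}. \<Sum>j\<in>{i+1..m}. a i + a j) + (\<Sum>i\<in>{1..m}. a i + a i)"
      by (rule sum_pairs) simp
    moreover have "(\<Sum>i\<in>{1..m}. \<Sum>j\<in>{1..m}. a i + a j) = 2 * (real m * (\<Sum>i\<in>{1..m}. a i))"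
      by (simp add: sum.distrib flip: sum_distrib_left)
    moreover have "(\<Sum>i\<in>{1..m}. a i + a i) = 2 * (\<Sum>i\<in>{1..m}. a i)"
      unfolding sum.distrib by simp
    ultimately show ?thesis unfolding m'_def left_diff_distrib by linarith
  qed
  \<comment> \<open>Within \<open>S t\<close> there are \<open>mt t * (mt t - 1) / 2\<close>
    unordered pairs; they are counted as ordered pairs minus the diagonal.\<close>
  have pairs_K: "(\<Sum>i\<in>{1..m}. \<Sum>j\<in>{i+1..m}. if \<tau> i = \<tau> j then K (\<tau> i) else 0) =
      (\<Sum>t\<in>{1..n}. mt t * (mt t - 1) / 2 * K t)"
  proof -
    have inner: "(\<Sum>j\<in>{1..m}. if t = \<tau> j then K t else 0) = mt t * K t" if "t \<in> {1..n}" for t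
    proof -
      have "{j\<in>{1..m}. t = \<tau> j} = S t"
      proof (intro equalityI subsetI)
        fix j assume "j \<in> {j\<in>{1..m}. t = \<tau> j}"
        then show "j \<in> S t" using \<tau>_mem[of j] by simp
      next
        fix j assume j: "j \<in> S t"
        then have "j \<in> {1..m}" unfolding Sun[symmetric] using that by blast
        then show "j \<in> {j\<in>{1..m}. t = \<tau> j}" using \<tau>[OF that j] by simp
      qed
      then show ?thesis by (simp add: mt_def flip: sum.inter_filter)
    qed
    have "(\<Sum>i\<in>{1..m}. \<Sum>j\<in>{1..m}. if \<tau> i = \<tau> j then K (\<tau> i) else 0) = (\<Sum>i\<in>{1..m}. mt (\<tau> i) * K (\<tau> i))"
      using \<tau>_mem by (intro sum.cong refl inner) auto
    also have "\<dots> = (\<Sum>t\<in>{1..n}. mt t * (mt t * K t))"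
      unfolding regroup[symmetric, where g = "\<lambda>i t. mt t * K t"] by (simp add: mt_def)
    finally have 1: "(\<Sum>i\<in>{1..m}. \<Sum>j\<in>{1..m}. if \<tau> i = \<tau> j then K (\<tau> i) else 0) = (\<Sum>t\<in>{1..n}. mt t * (mt t * K t))" .
    have 2: "(\<Sum>i\<in>{1..m}. K (\<tau> i)) = (\<Sum>t\<in>{1..n}. mt t * K t)"
      unfolding regroup[symmetric, where g = "\<lambda>i t. K t"] by (simp add: mt_def)
    have "2 * (\<Sum>i\<in>{1..m}. \<Sum>j\<in>{i+1..m}. if \<tau> i = \<tau> j then K (\<tau> i) else 0) =
        (\<Sum>t\<in>{1..n}. mt t * (mt t * K t)) - (\<Sum>t\<in>{1..n}. mt t * K t)"
      using sum_pairs[of "\<lambda>i j. if \<tau> i = \<tau> j then K (\<tau> i) else 0" m] 1 2 by simp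
    also have "\<dots> = 2 * (\<Sum>t\<in>{1..n}. mt t * (mt t - 1) / 2 * K t)"
      unfolding sum_distrib_left sum_subtractf[symmetric] by (intro sum.cong refl) (simp add: algebra_simps)
    finally show ?thesis by simp
  qed
  have logC: "log 2 C = (\<Sum>i\<in>{1..m}. \<Sum>j\<in>{i+1..m}. log 2 (c i j))"
  proof -
    have row: "(\<Prod>j\<in>{i+1..m}. c i j) > 0" if "i \<in> {1..m}" for i
      using that by (intro prod_pos c_pos) auto
    have "ln C = (\<Sum>i\<in>{1..m}. ln (\<Prod>j\<in>{i+1..m}. c i j))"
      unfolding C_def by (rule ln_prod) (simp, rule less_imp_neq[OF row, symmetric])
    also have "\<dots> = (\<Sum>i\<in>{1..m}. \<Sum>j\<in>{i+1..m}. ln (c i j))"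
      by (intro sum.cong refl ln_prod less_imp_neq[OF c_pos, symmetric]) auto
    finally have "ln C = (\<Sum>i\<in>{1..m}. \<Sum>j\<in>{i+1..m}. ln (c i j))" .
    then show ?thesis by (simp add: log_def sum_divide_distrib)
  qed
  have C_pos: "C > 0" unfolding C_def by (intro prod_pos c_pos) auto
  have "(\<Sum>i\<in>{1..m}. \<Sum>j\<in>{i+1..m}. (if \<tau> i = \<tau> j then K (\<tau> i) else 0) - log 2 (c i j))
      \<le> (\<Sum>i\<in>{1..m}. \<Sum>j\<in>{i+1..m}. a i + a j)"
    by (intro sum_mono pair) auto
  then have part1: "(\<Sum>t\<in>{1..n}. mt t * (mt t - 1) / 2 * K t) - log 2 C \<le> m' * (\<Sum>i\<in>{1..m}. a i)"
    unfolding pairs_a logC by (simp only: sum_subtractf pairs_K)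

  define w where "w = (\<lambda>i k l. (cmod (hip A (\<psi> i k) (\<psi> (Suc i) l)))\<^sup>2)"
  \<comment> \<open>The chain has \<open>m - 1 = Suc j\<close> links and ends at measurement
    \<open>m = Suc (Suc j)\<close>, which matches the successor patterns of
    \<open>path_weight\<close>.\<close>
  define j where "j = m - 2"
  have mj: "m = j + 2" using m2 by (simp add: j_def)
  have b_path: "b = Max ((\<lambda>l. path_weight (D 0) w (Suc j) l) ` {1..D 0})"
    unfolding b_def path_weight_eq_sum by (simp add: w_def ip dA mj numeral_2_eq_2)
  have "path_weight (D 0) w (Suc j) k > 0 \<or> k \<notin> {1..D 0}" for k
    unfolding w_def by (rule multiple_measurements(1)[where m = m, OF d]) (rule ob, auto simp: mj)
  then have pw_pos: "path_weight (D 0) w (Suc j) k > 0" if "k \<in> {1..D 0}" for k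
    using that by blast
  have chain: "real (Suc j) * kent A (bker 0) \<le>
      (\<Sum>k\<in>{1..D 0}. prob (\<psi> (Suc (Suc j)) k) * log 2 (path_weight (D 0) w (Suc j) k))
      + (\<Sum>i\<in>{1..Suc (Suc j)}. \<Sum>k\<in>{1..D 0}. eta (prob (\<psi> i k)))"
    unfolding w_def by (rule multiple_measurements(2)[where m = m, OF d]) (rule ob, auto simp: mj)
  have pw_le: "path_weight (D 0) w (Suc j) k \<le> b" if "k \<in> {1..D 0}" for k
    unfolding b_path by (intro Max_ge) (use that in auto)
  have b_pos: "b > 0" using pw_pos[of 1] pw_le[of 1] d by simp
  \<comment> \<open>The average over the last label is bounded by the outer maximum in
    \<open>b\<close>, because the probabilities sum to 1.\<close>
  have "(\<Sum>k\<in>{1..D 0}. prob (\<psi> m k) * log 2 (path_weight (D 0) w (Suc j) k)) \<le>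
      (\<Sum>k\<in>{1..D 0}. prob (\<psi> m k) * log 2 b)"
    using pw_pos pw_le b_pos by (intro sum_mono mult_left_mono prob_nonneg) auto
  also have "\<dots> = log 2 b"
    using prob_total[OF ob[of m]] m2 by (simp flip: sum_distrib_right)
  finally have "real (Suc j) * kent A (bker 0) \<le> log 2 b + (\<Sum>i\<in>{1..m}. \<Sum>k\<in>{1..D 0}. eta (prob (\<psi> i k)))"
    using chain by (simp add: mj)
  moreover have "kent A (bker 0) = SA" using ent_B[of 0] by (simp add: SA_def)
  moreover have "(\<Sum>k\<in>{1..D 0}. eta (prob (\<psi> i k))) = SM i (\<tau> i)" if "i \<in> {1..m}" for i
    using ent_M[of "\<tau> i" "\<psi> i"] ob[of i] \<tau>_mem[OF that] that by (simp add: SM_def dA)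
  moreover have "real (Suc j) = m'" by (simp add: m'_def mj)
  ultimately have part2: "m' * SA \<le> log 2 b + (\<Sum>i\<in>{1..m}. SM i (\<tau> i))" by simp

  define T where "T = (\<Sum>t\<in>{1..n}. mt t * (mt t - 1) / 2 * K t)"
  have "log 2 (C / b ^ (m - 1)) = log 2 C - m' * log 2 b"
    using C_pos b_pos m2 by (simp add: log_divide log_nat_power m'_def of_nat_diff)
  \<comment> \<open>The S(A) contributions of the mutual informations cancel against the separate
    S(A) sum, leaving the conditional entropies already present in the pairwise bound.\<close>
  moreover have "(\<Sum>t\<in>{1..n}. mt t * (mt t - 1) / (2 * m') * SA) -
      (\<Sum>t\<in>{1..n}. mt t * (mt t - 1) / (2 * m') * (SA + SB t - SAB t)) = T / m'"
    unfolding T_def K_def sum_subtractf[symmetric] sum_divide_distrib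
    by (intro sum.cong refl) (simp add: algebra_simps add_divide_distrib diff_divide_distrib)
  moreover have "(\<Sum>t\<in>{1..n}. \<Sum>i\<in>S t. SM i t + SB t - SMB i t) = (\<Sum>i\<in>{1..m}. SM i (\<tau> i)) - (\<Sum>i\<in>{1..m}. a i)"
    unfolding regroup[where g = "\<lambda>i t. SM i t + SB t - SMB i t"] sum_subtractf[symmetric]
    by (simp add: a_def algebra_simps)
  ultimately have "\<delta> = (log 2 C - m' * log 2 b) / m' + m' * SA - T / m'
      - ((\<Sum>i\<in>{1..m}. SM i (\<tau> i)) - (\<Sum>i\<in>{1..m}. a i))"
    unfolding \<delta>_def m'_def[symmetric] by simp
  also have "(log 2 C - m' * log 2 b) / m' = log 2 C / m' - log 2 b"
    using m' by (simp add: diff_divide_distrib)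
  \<comment> \<open>Adding \<open>\<delta>\<close> to the pairwise bound cancels both
    \<open>C\<close> and \<open>T\<close>. What remains is the bound without memory, with measured
    entropies converted to conditional ones by the mutual informations.\<close>
  finally have "\<delta> \<le> log 2 C / m' - T / m' + (\<Sum>i\<in>{1..m}. a i)"
    using part2 by simp
  moreover have "T / m' - log 2 C / m' \<le> (\<Sum>i\<in>{1..m}. a i)"
    using part1 m' by (simp add: T_def divide_simps mult.commute flip: diff_divide_distrib)
  ultimately have "- 1 / m' * log 2 C + 1 / m' * T + max 0 \<delta> \<le> (\<Sum>i\<in>{1..m}. a i)"
    by (simp add: max_def)
  also have "(\<Sum>i\<in>{1..m}. a i) = (\<Sum>t\<in>{1..n}. \<Sum>i\<in>S t. SMB i t - SB t)"
    unfolding regroup[where g = "\<lambda>i t. SMB i t - SB t"] a_def ..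
  finally show ?thesis
    unfolding T_def K_def \<delta>_def m'_def
    unfolding C_def unfolding c_def b_def mt_def SA_def SB_def SAB_def SMB_def SM_def Let_def .
qed

end
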